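(* Let $N$ be a Poisson random measure on $\mathcal{W}$ with intensity $\nu$, let $h$ be a strictly positive jointly measurable function on $\mathcal{W}\times\mathcal{M}$ such that $\int_{\mathcal{W}}h(w,N)\,N(dw)=1$ almost surely, and let $P$ be the random probability measure $P(dw)=h(w,N)\,N(dw)$ on $\mathcal{W}$. Let $\mathbf{W}=(W_1,\ldots,W_n)$ be random elements of $\mathcal{W}$ such that, given $P$ (that is, given $N$), $W_1,\ldots,W_n$ are i.i.d. with distribution $P$. Then the following hold. (i) The posterior distribution of $N|\mathbf{W}$ is the conditional law, given $\mathbf{W}$, of the random measure $$N_n^*=N+\sum_{j=1}^{n(\mathbf{p})}\delta_{W_j^*},$$ where in this representation the conditional law of $N$ given $\mathbf{W}$ is $$\pi^*(dN|\mathbf{W})=[\psi_n(\mathbf{W})]^{-1}\left[\prod_{j=1}^{n(\mathbf{p})}[h(W_j^*,N_n^* )]^{e_j}\right]\mathcal{P}(dN|\nu).$$ (ii) The posterior distribution of $P|\mathbf{W}$ is the conditional distribution, given $\mathbf{W}$, of the random probability measure $$P_n^*(dw)=h(w,N_n^* )\,N_n^*(dw)=h(w,N_n^* )\,N(dw)+\sum_{j=1}^{n(\mathbf{p})}h(W_j^*,N_n^* )\,\delta_{W_j^*}(dw),$$ where the law of $N|\mathbf{W}$ is $\pi^*(dN|\mathbf{W})$. (iii) The joint exchangeable marginal distribution of $\mathbf{W}$ is $$\mathbb{P}(d\mathbf{W}|\nu)=\psi_n(\mathbf{W})\prod_{j=1}^{n(\mathbf{p})}\nu(dW_j^* ).$$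 Additionally, the exchangeable partition probability function (EPPF) derived from the marginal distribution of $\mathbf{W}$ is $$p(e_1,\ldots,e_{n(\mathbf{p})})=\int_{\mathcal{W}^{n(\mathbf{p})}}\psi_n(\mathbf{w})\prod_{j=1}^{n(\mathbf{p})}\nu(dw_j^* ).$$
   Context: $\mathcal{W}$ is a Polish space (with a fixed complete separable metric, which determines the bounded sets). $\mathcal{M}$ is the space of boundedly finite Borel measures on $\mathcal{W}$ with its usual sigma-field. $\nu$ is a sigma-finite nonatomic measure on $\mathcal{W}$, finite on bounded Borel sets, and $\mathcal{P}(dN|\nu)$ is the law on $\mathcal{M}$ of a Poisson random measure with mean intensity $\nu$. A vector $\mathbf{W}=(W_1,\ldots,W_n)\in\mathcal{W}^n$ is identified with $(\mathbf{W}^*,\mathbf{p})$, where $\mathbf{W}^*=(W_1^*,\ldots,W^*_{n(\mathbf{p})})$ are its distinct values and $\mathbf{p}=\{C_1,\ldots,C_{n(\mathbf{p})}\}$ is the partition of $\{1,\ldots,n\}$ with cells $C_j=\{i:W_i=W_j^*\}$; $e_j=|C_j|$. The expression $\psi(\mathbf{W})\prod_{j=1}^{n(\mathbf{p})}\nu(dW_j^* )$ denotes the measure on $\mathcal{W}^n$ whose integral of a nonnegative measurable $g$ is $\sum_{\mathbf{p}}\int_{\mathcal{W}^{n(\mathbf{p})}}g(\mathbf{w})\psi(\mathbf{w})\prod_{j=1}^{n(\mathbf{p})}\nu(dw_j^* )$, where the sum is over all partitions $\mathbf{p}$ of $\{1,\ldots,n\}$ and, in the term for $\mathbf{p}$,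 $\mathbf{w}=(w_1,\ldots,w_n)$ with $w_i=w_j^*$ for $i\in C_j$. With $N_n^*=N+\sum_{j=1}^{n(\mathbf{p})}\delta_{W_j^*}$, define $$\psi_n(\mathbf{W})=\int_{\mathcal{M}}\left[\prod_{j=1}^{n(\mathbf{p})}[h(W_j^*,N_n^* )]^{e_j}\right]\mathcal{P}(dN|\nu).$$ The EPPF is the marginal probability $\pi(\mathbf{p})=p(e_1,\ldots,e_{n(\mathbf{p})})$ that the partition of $\{1,\ldots,n\}$ induced by the ties among $W_1,\ldots,W_n$ equals $\mathbf{p}$. *)

theory Defs
  imports "HOL-Probability.Probability"
begin

text \<open>
  All Borel measures on a Polish space and, inside them, the boundedly finite ones. Both carry the
  sigma-field generated by the evaluations \<open>N \<mapsto> N(A)\<close>, \<open>A\<close> Borel, which on boundedly finite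
  measures is the Borel sigma-field of the weak-hash topology. \<open>bounded\<close> refers to the complete
  metric that is part of class \<^class>\<open>polish_space\<close>.
\<close>

definition borel_measures :: "'w::polish_space measure measure" where
  "borel_measures =
     (SUP A \<in> sets borel. vimage_algebra {N. sets N = sets borel} (\<lambda>N. emeasure N A) borel)"

definition bf_measures :: "'w::polish_space measure measure" where
  "bf_measures =
     restrict_space borel_measures {N. \<forall>B\<in>sets borel. bounded B \<longrightarrow> emeasure N B < \<infinity>}"

text \<open>
  The Poisson probabilities are written out because \<^const>\<open>poisson_pmf\<close> does not cover rate 0.
  That \<open>N(B) = \<infinity>\<close> almost surely when \<open>\<nu>(B) = \<infinity>\<close> need not be required: for sigma-finite \<open>\<nu>\<close> it
  is a consequence.
\<close>

definition poisson_random_measure ::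
    "'a measure \<Rightarrow> 'w::polish_space measure \<Rightarrow> ('a \<Rightarrow> 'w measure) \<Rightarrow> bool" where
  "poisson_random_measure \<Omega> \<nu> N \<longleftrightarrow>
     N \<in> measurable \<Omega> bf_measures \<and>
     (\<forall>B\<in>sets borel. emeasure \<nu> B < \<infinity> \<longrightarrow>
        (\<forall>k::nat. measure \<Omega> {\<omega>\<in>space \<Omega>. emeasure (N \<omega>) B = of_nat k} =
           measure \<nu> B ^ k / fact k * exp (- measure \<nu> B))) \<and>
     (\<forall>(m::nat) B. (\<forall>i<m. B i \<in> sets borel) \<longrightarrow> disjoint_family_on B {..<m} \<longrightarrow>
        prob_space.indep_vars \<Omega> (\<lambda>_. borel) (\<lambda>i \<omega>. emeasure (N \<omega>) (B i)) {..<m})"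

text \<open>
  \<open>K\<close> is a version of the conditional law of \<open>Y\<close> (with values in \<open>SY\<close>) given \<open>X\<close> (with values in
  \<open>SX\<close>). Measurability of \<open>K\<close> is required everywhere, total mass 1 only almost surely, since the
  kernels of interest are probability measures only outside a null set.
\<close>

definition conditional_law ::
    "'a measure \<Rightarrow> 'x measure \<Rightarrow> ('a \<Rightarrow> 'x) \<Rightarrow> 'y measure \<Rightarrow> ('a \<Rightarrow> 'y) \<Rightarrow> ('x \<Rightarrow> 'y measure) \<Rightarrow> bool"
  where
  "conditional_law \<Omega> SX X SY Y K \<longleftrightarrow>
     X \<in> measurable \<Omega> SX \<and> Y \<in> measurable \<Omega> SY \<and>
     (\<forall>x\<in>space SX. sets (K x) = sets SY) \<and>
     (\<forall>B\<in>sets SY. (\<lambda>x. emeasure (K x) B) \<in> borel_measurable SX) \<and>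
     (AE \<omega> in \<Omega>. prob_space (K (X \<omega>))) \<and>
     (\<forall>A\<in>sets SX. \<forall>B\<in>sets SY.
        emeasure \<Omega> {\<omega>\<in>space \<Omega>. X \<omega> \<in> A \<and> Y \<omega> \<in> B} =
        (\<integral>\<^sup>+\<omega>. indicator A (X \<omega>) * emeasure (K (X \<omega>)) B \<partial>\<Omega>))"

text \<open>A vector \<open>(w\<^sub>1, \<dots>, w\<^sub>n)\<close> is an element of the product space over \<open>{1..n}\<close>.\<close>

abbreviation vec_space :: "nat \<Rightarrow> (nat \<Rightarrow> 'w::polish_space) measure" where
  "vec_space n \<equiv> PiM {1..n} (\<lambda>_. borel)"

text \<open>
  The distinct values of \<open>w\<close> are \<open>w ` {1..n}\<close>; they are used directly as indices of the cells, so
  that \<open>tie_cell n w x\<close> is \<open>C\<^sub>j\<close> for \<open>x = w\<^sub>j\<^sup>*\<close>, and its cardinality is \<open>e\<^sub>j\<close>.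
\<close>

definition tie_cell :: "nat \<Rightarrow> (nat \<Rightarrow> 'w) \<Rightarrow> 'w \<Rightarrow> nat set" where
  "tie_cell n w x = {i\<in>{1..n}. w i = x}"

definition tie_partition :: "nat \<Rightarrow> (nat \<Rightarrow> 'w) \<Rightarrow> nat set set" where
  "tie_partition n w = tie_cell n w ` (w ` {1..n})"

text \<open>The measure \<open>N + \<Sum>x\<in>V. c x \<cdot> \<delta>\<^sub>x\<close>.\<close>

definition add_atoms ::
    "'w::polish_space measure \<Rightarrow> ('w \<Rightarrow> ennreal) \<Rightarrow> 'w set \<Rightarrow> 'w measure" where
  "add_atoms N c V =
     measure_of UNIV (sets borel) (\<lambda>B. emeasure N B + (\<Sum>x\<in>V. c x * emeasure (return borel x) B))"

text \<open>\<open>N\<^sub>n\<^sup>*\<close>\<close>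

definition N_star :: "nat \<Rightarrow> (nat \<Rightarrow> 'w::polish_space) \<Rightarrow> 'w measure \<Rightarrow> 'w measure" where
  "N_star n w N = add_atoms N (\<lambda>_. 1) (w ` {1..n})"

text \<open>The random measure \<open>h(x,N) N(dx)\<close> as a function of \<open>N\<close>.\<close>

definition h_measure ::
    "('w::polish_space \<Rightarrow> 'w measure \<Rightarrow> real) \<Rightarrow> 'w measure \<Rightarrow> 'w measure" where
  "h_measure h N = density N (\<lambda>x. ennreal (h x N))"

definition tie_likelihood ::
    "('w::polish_space \<Rightarrow> 'w measure \<Rightarrow> real) \<Rightarrow> nat \<Rightarrow> (nat \<Rightarrow> 'w) \<Rightarrow> 'w measure \<Rightarrow> ennreal" where
  "tie_likelihood h n w N =
     (\<Prod>x\<in>w ` {1..n}. ennreal (h x (N_star n w N)) ^ card (tie_cell n w x))"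

text \<open>In \<open>psi\<close> and \<open>pi_star\<close> the argument \<open>L\<close> stands for the Poisson law on \<^const>\<open>bf_measures\<close>.\<close>

definition psi ::
    "'w::polish_space measure measure \<Rightarrow> ('w \<Rightarrow> 'w measure \<Rightarrow> real) \<Rightarrow> nat \<Rightarrow> (nat \<Rightarrow> 'w) \<Rightarrow> ennreal"
  where
  "psi L h n w = (\<integral>\<^sup>+N. tie_likelihood h n w N \<partial>L)"

definition pi_star ::
    "'w::polish_space measure measure \<Rightarrow> ('w \<Rightarrow> 'w measure \<Rightarrow> real) \<Rightarrow> nat \<Rightarrow> (nat \<Rightarrow> 'w) \<Rightarrow>
      'w measure measure" where
  "pi_star L h n w = density L (\<lambda>N. inverse (psi L h n w) * tie_likelihood h n w N)"

text \<open>
  Given a partition \<open>p\<close> of \<open>{1..n}\<close> and one point \<open>x C\<close> for every cell \<open>C \<in> p\<close>, the vector \<open>w\<close> with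
  \<open>w i = x C\<close> for \<open>i \<in> C\<close>. The product measure of \<open>\<nu>\<close> over the cells is \<open>PiM p (\<lambda>_. \<nu>)\<close>.
\<close>

definition from_cells :: "nat \<Rightarrow> nat set set \<Rightarrow> (nat set \<Rightarrow> 'w) \<Rightarrow> nat \<Rightarrow> 'w" where
  "from_cells n p x = (\<lambda>i\<in>{1..n}. x (THE C. C \<in> p \<and> i \<in> C))"

end

theory Submission
  imports Defs "HOL-Combinatorics.Permutations"
begin

text \<open>
  The joint law of \<open>(W, N)\<close> is given by \<open>E \<integral> g(w, N) \<Prod>\<^sub>i h(w\<^sub>i, N) N(dw\<^sub>1) \<dots> N(dw\<^sub>n)\<close>, which equals
  \<open>\<Sum>\<^sub>p \<integral> E [g(w, N\<^sub>n\<^sup>*) \<Prod>\<^sub>i h(w\<^sub>i, N\<^sub>n\<^sup>*)] \<Prod>\<^sub>j \<nu>(dw\<^sub>j\<^sup>*)\<close>, and all claims are read off from this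
  identity. It comes from the Mecke equation
  \<open>E \<integral> f(x, N) N(dx) = \<integral> E f(x, N + \<delta>\<^sub>x) \<nu>(dx)\<close> by induction on \<open>n\<close>: integrating a further point
  against \<open>N\<^sub>n\<^sup>*\<close> either repeats an old value, so that the new index joins an existing cell, or draws
  a new value from \<open>N\<close>, which by Mecke opens a singleton cell. The Mecke equation itself is checked
  on events about finitely many counts; refining the sets involved to disjoint cells and using
  independence reduces it to \<open>E (X f(X)) = \<lambda> E f(X + 1)\<close> for a Poisson variable \<open>X\<close> with mean \<open>\<lambda>\<close>.
\<close>

section \<open>Spaces of measures\<close>

text \<open>The weight \<open>h\<close> sees the whole measure, so every use of the Mecke equation
  shifts the argument of each factor \<open>h (w i)\<close> together with that of \<open>g\<close>.
  The identity is therefore proved for arbitrary \<open>g\<close>, which can absorb the remaining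
  factors; in the end all of them are evaluated at the same \<open>N_star n w m\<close>.
  Nonatomicity of \<nu> enters only through null sets: a newly drawn value almost never hits an old
  one, and different cells almost never receive equal values. Dividing by \<open>psi\<close> rests
  on two facts. It is never 0, because \<open>h\<close> is strictly positive; it is finite almost
  everywhere, because the choice \<open>g = 1\<close> shows that its integrals over all partitions
  add up to 1. The posterior is then Bayes' formula, and the EPPF is the case where \<open>g\<close>
  is the indicator of a tie pattern. Realizations of \<open>N\<close> may have infinite mass but are
  finite on balls. Exhausting the space by balls gives the measurability of integrals as functions
  of the measure, and the finite cover that uniqueness in the Mecke equation requires.\<close>

lemma space_borel_measures: "space borel_measures = {N::'w::polish_space measure. sets N = sets borel}"
  by (auto simp: borel_measures_def space_Sup_eq_UN)

lemma space_bf_measures: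
  "space bf_measures = {N::'w::polish_space measure. sets N = sets borel \<and>
     (\<forall>B\<in>sets borel. bounded B \<longrightarrow> emeasure N B < \<infinity>)}"
  by (auto simp: bf_measures_def space_restrict_space space_borel_measures)

lemma space_bf_measuresD:
  assumes "m \<in> space (bf_measures :: 'w::polish_space measure measure)"
  shows "sets m = sets borel" "space m = UNIV" "measurable m K = measurable borel K"
    "B \<in> sets borel \<Longrightarrow> bounded B \<Longrightarrow> emeasure m B < \<infinity>"
proof -
  show "sets m = sets borel" using assms by (simp add: space_bf_measures)
  then show "space m = UNIV" "measurable m K = measurable borel K"
    using sets_eq_imp_space_eq[of m borel] by (auto intro: measurable_cong_sets)
  show "B \<in> sets borel \<Longrightarrow> bounded B \<Longrightarrow> emeasure m B < \<infinity>" using assms by (auto simp: space_bf_measures)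
qed

lemma measurable_emeasure_borel_measures[measurable]:
  "B \<in> sets borel \<Longrightarrow> (\<lambda>N. emeasure N B) \<in> borel_measurable borel_measures"
  by (auto intro!: measurable_Sup1 measurable_vimage_algebra1 simp: borel_measures_def)

lemma measurable_emeasure_bf_measures[measurable]:
  "B \<in> sets borel \<Longrightarrow> (\<lambda>N. emeasure N B) \<in> borel_measurable bf_measures"
  unfolding bf_measures_def
  by (rule measurable_restrict_space1) (rule measurable_emeasure_borel_measures)

lemma measurable_borel_measuresI:
  fixes f :: "'a \<Rightarrow> 'w::polish_space measure"
  assumes "\<And>x. x \<in> space M \<Longrightarrow> sets (f x) = sets borel"
    and "\<And>B. B \<in> sets borel \<Longrightarrow> (\<lambda>x. emeasure (f x) B) \<in> borel_measurable M"
  shows "f \<in> measurable M borel_measures"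
  unfolding borel_measures_def
  by (intro measurable_Sup2) (auto intro!: measurable_vimage_algebra2 assms)

lemma measurable_bf_measuresI:
  fixes f :: "'a \<Rightarrow> 'w::polish_space measure"
  assumes "\<And>x. x \<in> space M \<Longrightarrow> f x \<in> space bf_measures"
    and "\<And>B. B \<in> sets borel \<Longrightarrow> (\<lambda>x. emeasure (f x) B) \<in> borel_measurable M"
  shows "f \<in> measurable M bf_measures"
  unfolding bf_measures_def
  using assms(1) by (intro measurable_restrict_space2 measurable_borel_measuresI assms(2))
    (auto simp: space_bf_measures)

text \<open>The centre \<open>undefined\<close> is just some fixed point: balls of integer radius
  about any point increase to the whole space, and a boundedly finite measure is finite on each of
  them.\<close>

lemma nn_integral_balls:
  fixes f :: "'w::polish_space \<Rightarrow> ennreal"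
  assumes "m \<in> space bf_measures" and [measurable]: "f \<in> borel_measurable borel"
  shows "(\<integral>\<^sup>+x. f x \<partial>m) = (SUP k::nat. \<integral>\<^sup>+x. f x * indicator (ball undefined (real k)) x \<partial>m)"
proof -
  have [measurable_cong]: "sets m = sets borel" using space_bf_measuresD[OF assms(1)] by simp
  have "(SUP k::nat. f x * indicator (ball undefined (real k)) x) = f x" for x
  proof (rule antisym)
    show "(SUP k::nat. f x * indicator (ball undefined (real k)) x) \<le> f x"
      by (rule SUP_least) (auto simp: indicator_def)
    obtain k :: nat where "dist undefined x < real k" using reals_Archimedean2 by blast
    then show "f x \<le> (SUP k::nat. f x * indicator (ball undefined (real k)) x)"
      by (intro SUP_upper2[where i=k]) (auto simp: indicator_def)
  qed
  then have "(\<integral>\<^sup>+x. f x \<partial>m) = (\<integral>\<^sup>+x. (SUP k::nat. f x * indicator (ball undefined (real k)) x) \<partial>m)"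
    by simp
  also have "\<dots> = (SUP k::nat. \<integral>\<^sup>+x. f x * indicator (ball undefined (real k)) x \<partial>m)"
    by (rule nn_integral_monotone_convergence_SUP)
       (auto simp: incseq_def le_fun_def indicator_def)
  finally show ?thesis .
qed

lemma nn_integral_bf_measures_measurable:
  fixes K :: "'a \<Rightarrow> 'w::polish_space measure"
  assumes f[measurable]: "(\<lambda>(x, y). f x y) \<in> borel_measurable (M \<Otimes>\<^sub>M borel)"
    and K: "K \<in> measurable M bf_measures"
  shows "(\<lambda>x. \<integral>\<^sup>+y. f x y \<partial>K x) \<in> borel_measurable M"
proof -
  \<comment> \<open>Restricting \<open>K x\<close> to a ball and dividing by \<open>c k x\<close> gives a subprobability kernel, for which the
    library has the result.\<close>
  define c where "c k x = 1 + emeasure (K x) (ball undefined (real k))" for k :: nat and x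
  define S where "S k x = density (K x) (\<lambda>y. inverse (c k x) * indicator (ball undefined (real k)) y)"
    for k :: nat and x
  have Kx: "K x \<in> space bf_measures" if "x \<in> space M" for x
    using measurable_space[OF K that] .
  have c[measurable]: "c k \<in> borel_measurable M" for k
    unfolding c_def using measurable_compose[OF K measurable_emeasure_bf_measures] by measurable
  \<comment> \<open>The summand 1 in \<open>c\<close> keeps the divisor nonzero where the ball
    carries no mass; it is finite because balls are bounded. Hence multiplying by
    \<open>c k x\<close> later undoes the scaling exactly.\<close>
  have c_fin: "c k x \<noteq> 0" "c k x < top" if "x \<in> space M" for k x
    using space_bf_measuresD(4)[OF Kx[OF that], of "ball undefined (real k)"] by (auto simp: c_def)
  have emS: "emeasure (S k x) B = inverse (c k x) * emeasure (K x) (B \<inter> ball undefined (real k))"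
    if "x \<in> space M" "B \<in> sets borel" for k x B
  proof -
    have [measurable_cong]: "sets (K x) = sets borel" using space_bf_measuresD[OF Kx[OF that(1)]] by simp
    have "emeasure (S k x) B = (\<integral>\<^sup>+y. inverse (c k x) * indicator (B \<inter> ball undefined (real k)) y \<partial>K x)"
      unfolding S_def using that(2)
      by (subst emeasure_density) (auto intro!: nn_integral_cong simp: indicator_def)
    also have "\<dots> = inverse (c k x) * emeasure (K x) (B \<inter> ball undefined (real k))"
      using that(2) by (intro nn_integral_cmult_indicator) auto
    finally show ?thesis .
  qed
  have S[measurable]: "S k \<in> measurable M (subprob_algebra borel)" for k
  proof (rule measurable_subprob_algebra)
    fix x assume x: "x \<in> space M"
    show s: "sets (S k x) = sets borel" using space_bf_measuresD[OF Kx[OF x]] by (simp add: S_def)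
    show "subprob_space (S k x)"
    proof (rule subprob_spaceI)
      have "space (S k x) = UNIV" using sets_eq_imp_space_eq[OF s] by simp
      then have "emeasure (S k x) (space (S k x)) = inverse (c k x) * emeasure (K x) (ball undefined (real k))"
        using emS[OF x, of UNIV k] by simp
      also have "\<dots> \<le> inverse (c k x) * c k x" by (intro mult_left_mono) (auto simp: c_def)
      also have "\<dots> = 1" using ennreal_divide_self[OF c_fin[OF x, of k]] by (simp add: mult.commute flip: divide_ennreal_def)
      finally show "emeasure (S k x) (space (S k x)) \<le> 1" .
      show "space (S k x) \<noteq> {}" using \<open>space (S k x) = UNIV\<close> by simp
    qed
  next
    fix B :: "'w::polish_space set" assume B: "B \<in> sets borel"
    have "(\<lambda>x. inverse (c k x) * emeasure (K x) (B \<inter> ball undefined (real k))) \<in> borel_measurable M"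
      using measurable_compose[OF K measurable_emeasure_bf_measures[of "B \<inter> ball undefined (real k)"]] B
      by measurable
    then show "(\<lambda>x. emeasure (S k x) B) \<in> borel_measurable M"
      by (rule measurable_cong[THEN iffD1, rotated]) (simp add: emS B)
  qed
  have "(\<lambda>x. SUP k::nat. c k x * (\<integral>\<^sup>+y. f x y \<partial>S k x)) \<in> borel_measurable M"
    using nn_integral_measurable_subprob_algebra2[OF f S] by measurable
  moreover have "(SUP k::nat. c k x * (\<integral>\<^sup>+y. f x y \<partial>S k x)) = (\<integral>\<^sup>+y. f x y \<partial>K x)" if x: "x \<in> space M" for x
  proof -
    have [measurable_cong]: "sets (K x) = sets borel" using space_bf_measuresD[OF Kx[OF x]] by simp
    have fx: "f x \<in> borel_measurable borel" using measurable_Pair2[OF f x] by simp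
    have "c k x * (\<integral>\<^sup>+y. f x y \<partial>S k x) = (\<integral>\<^sup>+y. f x y * indicator (ball undefined (real k)) y \<partial>K x)" for k
    proof -
      have [measurable]: "(\<lambda>y. inverse (c k x) * indicator (ball undefined (real k)) y) \<in> borel_measurable (K x)"
        unfolding space_bf_measuresD(3)[OF Kx[OF x]]
        by (intro borel_measurable_times_ennreal measurable_const borel_measurable_indicator) simp_all
      have fm: "(\<lambda>y. f x y * indicator (ball undefined (real k)) y) \<in> borel_measurable (K x)" "f x \<in> borel_measurable (K x)"
        unfolding space_bf_measuresD(3)[OF Kx[OF x]]
        by (intro borel_measurable_times_ennreal borel_measurable_indicator fx; simp)+
      have "c k x * (\<integral>\<^sup>+y. f x y \<partial>S k x)
          = c k x * (\<integral>\<^sup>+y. inverse (c k x) * (f x y * indicator (ball undefined (real k)) y) \<partial>K x)"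
        unfolding S_def by (subst nn_integral_density) (auto intro!: fm nn_integral_cong arg_cong2[where f="(*)"] simp: mult_ac)
      also have "\<dots> = c k x * inverse (c k x) * (\<integral>\<^sup>+y. f x y * indicator (ball undefined (real k)) y \<partial>K x)"
        by (subst nn_integral_cmult[OF fm(1)]) (simp add: mult_ac)
      also have "c k x * inverse (c k x) = 1"
        using ennreal_divide_self[OF c_fin[OF x, of k]] by (simp add: flip: divide_ennreal_def)
      finally show ?thesis by simp
    qed
    then show ?thesis using nn_integral_balls[OF Kx[OF x] fx] by simp
  qed
  ultimately show ?thesis using measurable_cong by (metis (no_types, lifting))
qed

text \<open>The constraints form a set of pairs, so that intersecting two such events amounts to
  uniting their constraint sets.\<close>

definition count_cylinder :: "('w::polish_space set \<times> ennreal set) set \<Rightarrow> 'w measure set" where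
  "count_cylinder F = {m \<in> space bf_measures. \<forall>(B, U)\<in>F. emeasure m B \<in> U}"

definition count_cylinders :: "'w::polish_space measure set set" where
  "count_cylinders = count_cylinder ` {F. finite F \<and> F \<subseteq> sets borel \<times> sets borel}"

lemma sets_count_cylinder:
  assumes F: "finite F" "F \<subseteq> sets borel \<times> sets borel"
  shows "count_cylinder F \<in> sets bf_measures"
proof -
  have "{m \<in> space bf_measures. emeasure m (fst p) \<in> snd p} \<in> sets bf_measures" if "p \<in> F" for p
  proof -
    have [measurable]: "fst p \<in> sets borel" "snd p \<in> sets borel" using F that by auto
    show ?thesis by measurable
  qed
  then have "{m \<in> space bf_measures. \<forall>p\<in>F. emeasure m (fst p) \<in> snd p} \<in> sets bf_measures"
    by (rule sets.sets_Collect_finite_All) (use F in auto)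
  then show ?thesis by (simp add: count_cylinder_def case_prod_beta')
qed

lemma Int_stable_count_cylinders: "Int_stable count_cylinders"
proof (rule Int_stableI)
  fix a b :: "'w::polish_space measure set" assume "a \<in> count_cylinders" "b \<in> count_cylinders"
  then obtain F G where "a = count_cylinder F" "b = count_cylinder G" "finite F" "finite G"
    "F \<subseteq> sets borel \<times> sets borel" "G \<subseteq> sets borel \<times> sets borel"
    by (auto simp: count_cylinders_def)
  then show "a \<inter> b \<in> count_cylinders"
    unfolding count_cylinders_def by (intro image_eqI[of _ _ "F \<union> G"]) (auto simp: count_cylinder_def)
qed

lemma space_in_count_cylinders: "space bf_measures \<in> count_cylinders"
  unfolding count_cylinders_def by (intro image_eqI[of _ _ "{}"]) (auto simp: count_cylinder_def)

text \<open>For the nontrivial inclusion, the identity map is measurable from the sigma-field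
  generated by the cylinders into \<open>bf_measures\<close>, since every evaluation is; preimages
  under the identity are the sets themselves.\<close>

lemma sets_bf_measures: "sets bf_measures = sigma_sets (space bf_measures) count_cylinders"
proof (rule antisym)
  show "sigma_sets (space bf_measures) count_cylinders \<subseteq> sets bf_measures"
    by (rule sets.sigma_sets_subset) (auto simp: count_cylinders_def sets_count_cylinder)
  let ?S = "sigma (space bf_measures) count_cylinders"
  have cl: "count_cylinders \<subseteq> Pow (space bf_measures)"
    by (auto simp: count_cylinders_def count_cylinder_def)
  have "(\<lambda>m. m) \<in> measurable ?S bf_measures"
  proof (rule measurable_bf_measuresI)
    fix B :: "'w::polish_space set" assume B: "B \<in> sets borel"
    show "(\<lambda>m. emeasure m B) \<in> borel_measurable ?S"
    proof (rule measurableI)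
      fix U :: "ennreal set" assume U: "U \<in> sets borel"
      have "(\<lambda>m. emeasure m B) -` U \<inter> space ?S = count_cylinder {(B, U)}"
        using cl by (auto simp: count_cylinder_def space_measure_of_conv)
      also have "\<dots> \<in> sets ?S" using B U cl by (auto simp: count_cylinders_def)
      finally show "(\<lambda>m. emeasure m B) -` U \<inter> space ?S \<in> sets ?S" .
    qed simp
  qed (use cl in \<open>simp add: space_measure_of_conv\<close>)
  then have "(\<lambda>m. m) -` X \<inter> space ?S \<in> sets ?S" if "X \<in> sets bf_measures" for X
    using that by (rule measurable_sets)
  moreover have "(\<lambda>m. m) -` X \<inter> space ?S = X" if "X \<in> sets bf_measures" for X
    using sets.sets_into_space[OF that] by (auto simp: space_measure_of_conv)
  ultimately show "sets bf_measures \<subseteq> sigma_sets (space bf_measures) count_cylinders"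
    using sets_measure_of[OF cl] by (metis subsetI)
qed

section \<open>Positive functionals and uniqueness\<close>

text \<open>
  Iterated integrals over kernels that are not finite measures are compared as functionals of the
  integrand, because the library has no composition of such kernels.
\<close>

locale nn_functional =
  fixes M :: "'a measure" and \<Phi> :: "('a \<Rightarrow> ennreal) \<Rightarrow> ennreal"
  assumes cong: "\<And>f g. f \<in> borel_measurable M \<Longrightarrow> g \<in> borel_measurable M \<Longrightarrow>
      (\<And>x. x \<in> space M \<Longrightarrow> f x = g x) \<Longrightarrow> \<Phi> f = \<Phi> g"
    and add: "\<And>f g. f \<in> borel_measurable M \<Longrightarrow> g \<in> borel_measurable M \<Longrightarrow> \<Phi> (\<lambda>x. f x + g x) = \<Phi> f + \<Phi> g"
    and cmult: "\<And>c f. f \<in> borel_measurable M \<Longrightarrow> \<Phi> (\<lambda>x. c * f x) = c * \<Phi> f"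
    and SUP: "\<And>F::nat \<Rightarrow> _. incseq F \<Longrightarrow> (\<And>i. F i \<in> borel_measurable M) \<Longrightarrow>
        \<Phi> (\<lambda>x. SUP i. F i x) = (SUP i. \<Phi> (F i))"
begin

lemma mono:
  assumes "f \<in> borel_measurable M" "g \<in> borel_measurable M" "f \<le> g"
  shows "\<Phi> f \<le> \<Phi> g"
proof -
  \<comment> \<open>Monotonicity is a case of monotone continuity: apply \<open>SUP\<close> to the
    increasing sequence \<open>f, g, g, ...\<close>.\<close>
  define F where "F i = (if i = 0 then f else g)" for i :: nat
  have F: "incseq F" "\<And>i. F i \<in> borel_measurable M" using assms by (auto simp: F_def incseq_def)
  have "(SUP i. F i x) = g x" for x
    using assms(3) by (intro antisym SUP_least SUP_upper2[of 1]) (auto simp: F_def le_fun_def)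
  then have "\<Phi> g = (SUP i. \<Phi> (F i))" using SUP[OF F] by simp
  also have "\<dots> \<ge> \<Phi> (F 0)" by (rule SUP_upper) simp
  finally show ?thesis by (simp add: F_def)
qed

lemma zero: "\<Phi> (\<lambda>x. 0) = 0"
  using cmult[of "\<lambda>_. 0" 0] by simp

lemma sum:
  "(\<And>i. i \<in> I \<Longrightarrow> f i \<in> borel_measurable M) \<Longrightarrow> \<Phi> (\<lambda>x. \<Sum>i\<in>I. f i x) = (\<Sum>i\<in>I. \<Phi> (f i))"
  by (induction I rule: infinite_finite_induct)
    (auto simp: zero add)

lemma suminf:
  fixes f :: "nat \<Rightarrow> 'a \<Rightarrow> ennreal"
  assumes [measurable]: "\<And>i. f i \<in> borel_measurable M"
  shows "\<Phi> (\<lambda>x. \<Sum>i. f i x) = (\<Sum>i. \<Phi> (f i))"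
proof -
  have "\<Phi> (\<lambda>x. \<Sum>i. f i x) = \<Phi> (\<lambda>x. SUP n. \<Sum>i<n. f i x)"
    by (simp add: suminf_eq_SUP)
  also have "\<dots> = (SUP n. \<Phi> (\<lambda>x. \<Sum>i<n. f i x))"
    by (rule SUP) (auto intro!: incseq_SucI simp: le_fun_def)
  also have "\<dots> = (SUP n. \<Sum>i<n. \<Phi> (f i))"
    by (simp add: sum)
  finally show ?thesis by (simp add: suminf_eq_SUP)
qed

text \<open>The measure can only be \<open>A \<mapsto> \<Phi> (indicator A)\<close>. Additivity and
  monotone continuity make it countably additive, and the usual approximation by simple functions
  extends the equality from indicators to all integrands.\<close>

lemma eq_nn_integral:
  obtains \<mu> where "sets \<mu> = sets M" "\<And>f. f \<in> borel_measurable M \<Longrightarrow> \<Phi> f = (\<integral>\<^sup>+x. f x \<partial>\<mu>)"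
proof
  define \<mu> where "\<mu> = measure_of (space M) (sets M) (\<lambda>A. \<Phi> (indicator A))"
  show sets: "sets \<mu> = sets M" by (simp add: \<mu>_def)
  then have [measurable_cong]: "sets \<mu> = sets M" .
  have sp: "space \<mu> = space M" using sets by (rule sets_eq_imp_space_eq)
  have em: "emeasure \<mu> A = \<Phi> (indicator A)" if "A \<in> sets M" for A
    unfolding \<mu>_def
  proof (rule emeasure_measure_of_sigma[OF sets.sigma_algebra_axioms])
    show "positive (sets M) (\<lambda>A. \<Phi> (indicator A))"
      using zero by (simp add: positive_def indicator_def[abs_def])
    show "countably_additive (sets M) (\<lambda>A. \<Phi> (indicator A))"
    proof (rule countably_additiveI)
      fix A :: "nat \<Rightarrow> 'a set" assume A: "range A \<subseteq> sets M" "disjoint_family A"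
      then have "(\<Sum>i. \<Phi> (indicator (A i))) = \<Phi> (\<lambda>x. \<Sum>i. indicator (A i) x)"
        by (subst suminf) auto
      also have "(\<lambda>x. \<Sum>i. indicator (A i) x) = (indicator (\<Union>i. A i) :: 'a \<Rightarrow> ennreal)"
        using suminf_indicator[OF A(2)] by (simp add: fun_eq_iff)
      finally show "(\<Sum>i. \<Phi> (indicator (A i))) = \<Phi> (indicator (\<Union>i. A i))" .
    qed
  qed fact
  show "\<Phi> f = (\<integral>\<^sup>+x. f x \<partial>\<mu>)" if "f \<in> borel_measurable M" for f
    using that
  proof (induction rule: borel_measurable_induct)
    case prems: (cong f g)
    then show ?case using cong[of f g] nn_integral_cong[of \<mu> f g] sp by simp
  next
    case (set A) then show ?case by (simp add: em sets)
  next
    case (mult u c) then show ?case by (simp add: cmult nn_integral_cmult)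
  next
    case prems: (add u v) then show ?case by (simp add: add nn_integral_add)
  next
    case (seq U)
    then show ?case
      using SUP[of U] nn_integral_monotone_convergence_SUP[of U \<mu>] by (simp add: SUP_apply[abs_def])
  qed
qed

end

lemma nn_functional_integral:
  assumes "g \<in> measurable N M"
  shows "nn_functional M (\<lambda>f. \<integral>\<^sup>+y. f (g y) \<partial>N)"
proof (rule nn_functional.intro)
  note [measurable] = assms
  fix F :: "nat \<Rightarrow> _ \<Rightarrow> ennreal" assume F: "incseq F" and [measurable]: "\<And>i. F i \<in> borel_measurable M"
  show "(\<integral>\<^sup>+y. (SUP i. F i (g y)) \<partial>N) = (SUP i. \<integral>\<^sup>+y. F i (g y) \<partial>N)"
    using F by (intro nn_integral_monotone_convergence_SUP) (auto simp: incseq_def le_fun_def)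
next
  fix f f' :: "_ \<Rightarrow> ennreal" assume "\<And>x. x \<in> space M \<Longrightarrow> f x = f' x"
  then show "(\<integral>\<^sup>+y. f (g y) \<partial>N) = (\<integral>\<^sup>+y. f' (g y) \<partial>N)"
    using measurable_space[OF assms] by (intro nn_integral_cong) simp
qed (use assms in \<open>simp_all add: nn_integral_add nn_integral_cmult\<close>)

text \<open>Closure under mixing brings iterated integrals, whose inner measure depends on the outer
  variable and may be infinite, into the scope of the uniqueness principle below.\<close>

lemma nn_functional_mixture:
  assumes "\<And>x. x \<in> space N \<Longrightarrow> nn_functional M (\<Psi> x)"
    and [measurable]: "\<And>f. f \<in> borel_measurable M \<Longrightarrow> (\<lambda>x. \<Psi> x f) \<in> borel_measurable N"
  shows "nn_functional M (\<lambda>f. \<integral>\<^sup>+x. \<Psi> x f \<partial>N)"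
proof (rule nn_functional.intro)
  fix F :: "nat \<Rightarrow> _ \<Rightarrow> ennreal" assume F: "incseq F" and [measurable]: "\<And>i. F i \<in> borel_measurable M"
  have "(\<integral>\<^sup>+x. \<Psi> x (\<lambda>y. SUP i. F i y) \<partial>N) = (\<integral>\<^sup>+x. (SUP i. \<Psi> x (F i)) \<partial>N)"
    using F by (intro nn_integral_cong nn_functional.SUP[OF assms(1)]) auto
  \<comment> \<open>Monotonicity in \<open>i\<close> is known only for \<open>x\<close> in
    \<open>space N\<close>; the indicator makes the sequence increasing at every point.\<close>
  also have "\<dots> = (\<integral>\<^sup>+x. (SUP i. \<Psi> x (F i) * indicator (space N) x) \<partial>N)"
    by (intro nn_integral_cong) simp
  also have "\<dots> = (SUP i. \<integral>\<^sup>+x. \<Psi> x (F i) * indicator (space N) x \<partial>N)"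
    using F nn_functional.mono[OF assms(1)]
    by (intro nn_integral_monotone_convergence_SUP) (auto simp: incseq_def le_fun_def indicator_def)
  also have "\<dots> = (SUP i. \<integral>\<^sup>+x. \<Psi> x (F i) \<partial>N)"
    by (intro SUP_cong nn_integral_cong refl) simp
  finally show "(\<integral>\<^sup>+x. \<Psi> x (\<lambda>y. SUP i. F i y) \<partial>N) = (SUP i. \<integral>\<^sup>+x. \<Psi> x (F i) \<partial>N)" .
next
  fix f g :: "_ \<Rightarrow> ennreal" assume [measurable]: "f \<in> borel_measurable M" "g \<in> borel_measurable M"
  show "(\<integral>\<^sup>+x. \<Psi> x (\<lambda>y. f y + g y) \<partial>N) = (\<integral>\<^sup>+x. \<Psi> x f \<partial>N) + (\<integral>\<^sup>+x. \<Psi> x g \<partial>N)"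
    by (subst nn_integral_add[symmetric]) (auto intro!: nn_integral_cong nn_functional.add[OF assms(1)])
next
  fix c :: ennreal and f :: "_ \<Rightarrow> ennreal" assume [measurable]: "f \<in> borel_measurable M"
  show "(\<integral>\<^sup>+x. \<Psi> x (\<lambda>y. c * f y) \<partial>N) = c * (\<integral>\<^sup>+x. \<Psi> x f \<partial>N)"
    by (subst nn_integral_cmult[symmetric]) (auto intro!: nn_integral_cong nn_functional.cmult[OF assms(1)])
next
  fix f g :: "_ \<Rightarrow> ennreal" assume "f \<in> borel_measurable M" "g \<in> borel_measurable M" "\<And>x. x \<in> space M \<Longrightarrow> f x = g x"
  then show "(\<integral>\<^sup>+x. \<Psi> x f \<partial>N) = (\<integral>\<^sup>+x. \<Psi> x g \<partial>N)"
    by (intro nn_integral_cong nn_functional.cong[OF assms(1)])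
qed

text \<open>Once both functionals are represented by measures, this is uniqueness of measures on an
  intersection-stable generator. The sets \<open>A i\<close>, of finite mass, supply the
  sigma-finiteness.\<close>

lemma nn_functional_eqI:
  assumes \<Phi>: "nn_functional M \<Phi>" and \<Psi>: "nn_functional M \<Psi>"
    and E: "Int_stable E" "E \<subseteq> Pow (space M)" "sets M = sigma_sets (space M) E"
    and eq: "\<And>X. X \<in> E \<Longrightarrow> \<Phi> (indicator X) = \<Psi> (indicator X)"
    and A: "range A \<subseteq> E" "(\<Union>i::nat. A i) = space M" "\<And>i. \<Phi> (indicator (A i)) \<noteq> \<infinity>"
    and f: "f \<in> borel_measurable M"
  shows "\<Phi> f = \<Psi> f"
proof -
  obtain \<mu> where \<mu>: "sets \<mu> = sets M" "\<And>f. f \<in> borel_measurable M \<Longrightarrow> \<Phi> f = (\<integral>\<^sup>+x. f x \<partial>\<mu>)"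
    using nn_functional.eq_nn_integral[OF \<Phi>] by blast
  obtain \<nu> where \<nu>: "sets \<nu> = sets M" "\<And>f. f \<in> borel_measurable M \<Longrightarrow> \<Psi> f = (\<integral>\<^sup>+x. f x \<partial>\<nu>)"
    using nn_functional.eq_nn_integral[OF \<Psi>] by blast
  have EM: "X \<in> sets M" if "X \<in> E" for X using that E(3) by auto
  have em: "emeasure \<mu> X = \<Phi> (indicator X)" "emeasure \<nu> X = \<Psi> (indicator X)" if "X \<in> E" for X
    using EM[OF that] \<mu> \<nu> by simp_all
  have "\<mu> = \<nu>"
  proof (rule measure_eqI_generator_eq[where E=E and A=A and \<Omega>="space M"])
    show "emeasure \<mu> (A i) \<noteq> \<infinity>" for i using A(1) A(3)[of i] em(1)[of "A i"] by (simp add: image_subset_iff)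
  qed (use E A \<mu>(1) \<nu>(1) em eq in auto)
  then show ?thesis using \<mu>(2)[OF f] \<nu>(2)[OF f] by simp
qed

section \<open>Poisson counts on disjoint cells\<close>

context prob_space
begin

text \<open>The Stein-Chen identity. It is the recursion \<open>(k + 1) q (k + 1) = l q k\<close>
  for the Poisson weights, summed against \<open>F (k + 1)\<close>.\<close>

lemma poisson_nn_integral:
  fixes X :: "'a \<Rightarrow> ennreal"
  assumes [measurable]: "X \<in> borel_measurable M" and [measurable]: "F \<in> borel_measurable borel"
    and l: "0 \<le> l"
    and p: "\<And>k::nat. prob {x\<in>space M. X x = of_nat k} = l ^ k / fact k * exp (- l)"
  shows "(\<integral>\<^sup>+x. X x * F (X x) \<partial>M) = ennreal l * (\<integral>\<^sup>+x. F (X x + 1) \<partial>M)"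
proof -
  define D where "D k = {x\<in>space M. X x = of_nat k}" for k
  define q where "q k = l ^ k / fact k * exp (- l)" for k
  have [measurable]: "D k \<in> sets M" for k unfolding D_def by measurable
  have q0: "0 \<le> q k" for k using l by (simp add: q_def)
  have eD: "emeasure M (D k) = ennreal (q k)" for k using p[of k] by (simp add: emeasure_eq_measure D_def q_def)
  have dis: "disjoint_family D" by (auto simp: disjoint_family_on_def D_def)
  \<comment> \<open>The prescribed probabilities already add up to 1, so all other values of the
    extended variable \<open>X\<close>, infinity included, have probability 0.\<close>
  have "(\<lambda>k. l ^ k / fact k * exp (- l)) sums (exp l * exp (- l))"
    using exp_converges[of l] by (intro sums_mult2) (simp add: divide_inverse mult.commute)
  then have qs: "q sums 1" unfolding q_def by (simp add: exp_minus)
  have "emeasure M (\<Union>k. D k) = (\<Sum>k. ennreal (q k))"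
    using suminf_emeasure[OF _ dis, of M] by (simp add: eD image_subset_iff)
  also have "\<dots> = 1" using suminf_ennreal_eq[OF q0 qs] by simp
  also have "(\<Union>k. D k) = {x\<in>space M. x \<in> (\<Union>k. D k)}" by (auto simp: D_def)
  finally have "AE x in M. x \<in> (\<Union>k. D k)" by (subst AE_iff_emeasure_eq_1) measurable
  then have int: "(\<integral>\<^sup>+x. G (X x) \<partial>M) = (\<Sum>k. G (of_nat k) * ennreal (q k))"
    if [measurable]: "G \<in> borel_measurable borel" for G :: "ennreal \<Rightarrow> ennreal"
  proof -
    assume ae: "AE x in M. x \<in> (\<Union>k. D k)"
    have "(\<integral>\<^sup>+x. G (X x) \<partial>M) = (\<integral>\<^sup>+x. (\<Sum>k. G (of_nat k) * indicator (D k) x) \<partial>M)"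
    proof (rule nn_integral_cong_AE, use ae in eventually_elim)
      case (elim x)
      then obtain k where k: "x \<in> D k" by auto
      have "(\<Sum>k. G (of_nat k) * indicator (D k) x) = G (of_nat k)"
        by (rule suminf_cmult_indicator[OF dis k])
      then show ?case using k by (simp add: D_def)
    qed
    also have "\<dots> = (\<Sum>k. \<integral>\<^sup>+x. G (of_nat k) * indicator (D k) x \<partial>M)"
      by (rule nn_integral_suminf) measurable
    also have "\<dots> = (\<Sum>k. G (of_nat k) * ennreal (q k))"
      by (simp add: nn_integral_cmult_indicator eD)
    finally show ?thesis .
  qed
  have step: "of_nat (Suc k) * F (of_nat (Suc k)) * ennreal (q (Suc k))
      = ennreal l * (F (of_nat k + 1) * ennreal (q k))" for k
  proof -
    have "real (Suc k) * q (Suc k) = l * q k" by (simp add: q_def fact_Suc del: of_nat_Suc)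
    then have "ennreal (real (Suc k)) * ennreal (q (Suc k)) = ennreal l * ennreal (q k)"
      using q0 l by (metis ennreal_mult of_nat_0_le_iff)
    then have a: "of_nat (Suc k) * ennreal (q (Suc k)) = ennreal l * ennreal (q k)"
      by (simp add: ennreal_of_nat_eq_real_of_nat del: of_nat_Suc)
    have "of_nat (Suc k) * F (of_nat (Suc k)) * ennreal (q (Suc k))
        = (of_nat (Suc k) * ennreal (q (Suc k))) * F (of_nat (Suc k))"
      by (simp only: mult_ac)
    then show ?thesis unfolding a by (simp add: mult_ac add_ac)
  qed
  have "(\<integral>\<^sup>+x. X x * F (X x) \<partial>M) = (\<Sum>k. of_nat k * F (of_nat k) * ennreal (q k))"
    by (rule int[of "\<lambda>y. y * F y"]) measurable
  \<comment> \<open>The term for \<open>k = 0\<close> vanishes because of the factor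
    \<open>k\<close>, so the series may start one index later.\<close>
  also have "\<dots> = (\<Sum>k. of_nat (Suc k) * F (of_nat (Suc k)) * ennreal (q (Suc k)))"
    using suminf_offset[of "\<lambda>k. of_nat k * F (of_nat k) * ennreal (q k)" 1] by simp
  also have "\<dots> = ennreal l * (\<Sum>k. F (of_nat k + 1) * ennreal (q k))"
    unfolding step by (rule ennreal_suminf_cmult)
  also have "(\<Sum>k. F (of_nat k + 1) * ennreal (q k)) = (\<integral>\<^sup>+x. F (X x + 1) \<partial>M)"
    by (rule int[of "\<lambda>y. F (y + 1)", symmetric]) measurable
  finally show ?thesis .
qed

text \<open>By independence the vector of counts has a product law, so coordinate \<open>j\<close>
  can be integrated with the others frozen, and the Poisson identity is applied in that coordinate.
  Finite intensity is asked of cell \<open>j\<close> only, as the refinement used later may also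
  produce cells of infinite intensity.\<close>

lemma poisson_cells:
  fixes N :: "'a \<Rightarrow> 'w::polish_space measure" and E :: "nat \<Rightarrow> 'w set"
  assumes N: "poisson_random_measure M \<nu> N"
    and E: "\<And>i. E i \<in> sets borel" "disjoint_family_on E {..<r}"
    and j: "j < r" "emeasure \<nu> (E j) < \<infinity>"
    and [measurable]: "\<phi> \<in> borel_measurable (PiM {..<r} (\<lambda>_. borel))"
  shows "(\<integral>\<^sup>+\<omega>. emeasure (N \<omega>) (E j) * \<phi> (\<lambda>i\<in>{..<r}. emeasure (N \<omega>) (E i)) \<partial>M)
    = emeasure \<nu> (E j) * (\<integral>\<^sup>+\<omega>. \<phi> ((\<lambda>i\<in>{..<r}. emeasure (N \<omega>) (E i))(j := emeasure (N \<omega>) (E j) + 1)) \<partial>M)"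
proof -
  let ?I = "{..<r}" and ?J = "{..<r} - {j}"
  define X where "X i \<omega> = emeasure (N \<omega>) (E i)" for i \<omega>
  define l where "l = measure \<nu> (E j)"
  have Nm: "N \<in> measurable M bf_measures" using N by (simp add: poisson_random_measure_def)
  have X[measurable]: "X i \<in> borel_measurable M" for i
    unfolding X_def using measurable_compose[OF Nm measurable_emeasure_bf_measures[OF E(1)[of i]]] .
  have ind: "indep_vars (\<lambda>_. borel) X ?I"
    using N E unfolding poisson_random_measure_def X_def by blast
  have pX: "prob {\<omega>\<in>space M. X j \<omega> = of_nat k} = l ^ k / fact k * exp (- l)" for k :: nat
    using N E j unfolding poisson_random_measure_def X_def l_def by blast
  have l: "ennreal l = emeasure \<nu> (E j)" "0 \<le> l"
    using j unfolding l_def by (simp_all add: emeasure_eq_ennreal_measure)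
  have ne: "?I \<noteq> {}" using j by auto
  have dPi: "distr M (PiM ?I (\<lambda>_. borel)) (\<lambda>\<omega>. \<lambda>i\<in>?I. X i \<omega>) = PiM ?I (\<lambda>i. distr M borel (X i))"
    using ind indep_vars_iff_distr_eq_PiM[OF ne, where M'="\<lambda>_. borel" and X=X] X by simp
  interpret P: product_prob_space "\<lambda>i. distr M borel (X i)" ?I
    by (intro product_prob_spaceI prob_space_distr X)
  have Iins: "insert j ?J = ?I" using j by auto
  have int: "(\<integral>\<^sup>+\<omega>. G (\<lambda>i\<in>?I. X i \<omega>) \<partial>M)
      = (\<integral>\<^sup>+x. \<integral>\<^sup>+\<omega>. G (x(j := X j \<omega>)) \<partial>M \<partial>PiM ?J (\<lambda>i. distr M borel (X i)))"
    if [measurable]: "G \<in> borel_measurable (PiM ?I (\<lambda>_. borel))" for G :: "(nat \<Rightarrow> ennreal) \<Rightarrow> ennreal"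
  proof -
    have G: "G \<in> borel_measurable (PiM (insert j ?J) (\<lambda>i. distr M borel (X i)))"
      unfolding Iins by measurable
    have "(\<integral>\<^sup>+\<omega>. G (\<lambda>i\<in>?I. X i \<omega>) \<partial>M) = (\<integral>\<^sup>+x. G x \<partial>PiM ?I (\<lambda>i. distr M borel (X i)))"
      unfolding dPi[symmetric] by (subst nn_integral_distr) measurable
    also have "\<dots> = (\<integral>\<^sup>+x. \<integral>\<^sup>+y. G (x(j := y)) \<partial>distr M borel (X j) \<partial>PiM ?J (\<lambda>i. distr M borel (X i)))"
      using P.product_nn_integral_insert[OF _ _ G] unfolding Iins by simp
    also have "\<dots> = (\<integral>\<^sup>+x. \<integral>\<^sup>+\<omega>. G (x(j := X j \<omega>)) \<partial>M \<partial>PiM ?J (\<lambda>i. distr M borel (X i)))"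
    proof (intro nn_integral_cong nn_integral_distr X)
      fix x assume x: "x \<in> space (PiM ?J (\<lambda>i. distr M borel (X i)))"
      have "(\<lambda>y. x(j := y)) \<in> measurable borel (PiM (insert j ?J) (\<lambda>_. borel))"
        using x by (intro measurable_fun_upd[where J="?J"]) (auto simp: space_PiM)
      then show "(\<lambda>y. G (x(j := y))) \<in> borel_measurable (distr M borel (X j))"
        unfolding Iins by simp
    qed
    finally show ?thesis .
  qed
  have upd[measurable]: "(\<lambda>x. x(j := x j + 1)) \<in> measurable (PiM ?I (\<lambda>_. borel)) (PiM ?I (\<lambda>_. borel :: ennreal measure))"
    using j by (intro measurable_fun_upd[where J="?I"]) (auto intro!: borel_measurable_add measurable_component_singleton)
  have "(\<integral>\<^sup>+\<omega>. X j \<omega> * \<phi> (\<lambda>i\<in>?I. X i \<omega>) \<partial>M) = (\<integral>\<^sup>+\<omega>. (\<lambda>x. x j * \<phi> x) (\<lambda>i\<in>?I. X i \<omega>) \<partial>M)"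
    using j by simp
  also have "\<dots> = (\<integral>\<^sup>+x. \<integral>\<^sup>+\<omega>. X j \<omega> * \<phi> (x(j := X j \<omega>)) \<partial>M \<partial>PiM ?J (\<lambda>i. distr M borel (X i)))"
    using j by (subst int) (auto intro!: borel_measurable_times_ennreal measurable_component_singleton)
  also have "\<dots> = (\<integral>\<^sup>+x. ennreal l * (\<integral>\<^sup>+\<omega>. \<phi> (x(j := X j \<omega> + 1)) \<partial>M) \<partial>PiM ?J (\<lambda>i. distr M borel (X i)))"
  proof (intro nn_integral_cong poisson_nn_integral[where F="\<lambda>y. \<phi> (x(j := y))" for x] l(2) pX X)
    fix x assume x: "x \<in> space (PiM ?J (\<lambda>i. distr M borel (X i)))"
    have "(\<lambda>y. x(j := y)) \<in> measurable borel (PiM (insert j ?J) (\<lambda>_. borel))"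
      using x by (intro measurable_fun_upd[where J="?J"]) (auto simp: space_PiM)
    then show "(\<lambda>y. \<phi> (x(j := y))) \<in> borel_measurable borel"
      unfolding Iins by measurable
  qed
  also have "\<dots> = ennreal l * (\<integral>\<^sup>+x. \<integral>\<^sup>+\<omega>. \<phi> (x(j := X j \<omega> + 1)) \<partial>M \<partial>PiM ?J (\<lambda>i. distr M borel (X i)))"
  proof (rule nn_integral_cmult)
    have [measurable_cong]: "sets (PiM ?J (\<lambda>i. distr M borel (X i))) = sets (PiM ?J (\<lambda>_. borel))"
      by (intro sets_PiM_cong) auto
    have "(\<lambda>(x, \<omega>). x(j := X j \<omega> + 1)) \<in> measurable (PiM ?J (\<lambda>_. borel) \<Otimes>\<^sub>M M) (PiM (insert j ?J) (\<lambda>_. borel))"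
      unfolding split_beta' by (intro measurable_fun_upd[where J="?J"]) auto
    then have [measurable]: "(\<lambda>(x, \<omega>). x(j := X j \<omega> + 1)) \<in> measurable (PiM ?J (\<lambda>_. borel) \<Otimes>\<^sub>M M) (PiM ?I (\<lambda>_. borel))"
      unfolding Iins .
    show "(\<lambda>x. \<integral>\<^sup>+\<omega>. \<phi> (x(j := X j \<omega> + 1)) \<partial>M) \<in> borel_measurable (PiM ?J (\<lambda>i. distr M borel (X i)))"
      using measurable_compose[OF \<open>(\<lambda>(x, \<omega>). x(j := X j \<omega> + 1)) \<in> measurable (PiM ?J (\<lambda>_. borel) \<Otimes>\<^sub>M M) (PiM ?I (\<lambda>_. borel))\<close>, of \<phi> borel]
      by (intro borel_measurable_nn_integral) (simp add: split_beta')
  qed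
  \<comment> \<open>The product formula \<open>int\<close> is now read backwards, for the integrand
    with its coordinate \<open>j\<close> raised by one.\<close>
  also have "(\<integral>\<^sup>+x. \<integral>\<^sup>+\<omega>. \<phi> (x(j := X j \<omega> + 1)) \<partial>M \<partial>PiM ?J (\<lambda>i. distr M borel (X i)))
      = (\<integral>\<^sup>+\<omega>. (\<lambda>x. \<phi> (x(j := x j + 1))) (\<lambda>i\<in>?I. X i \<omega>) \<partial>M)"
    by (subst int) (use j in \<open>simp_all\<close>)
  also have "\<dots> = (\<integral>\<^sup>+\<omega>. \<phi> ((\<lambda>i\<in>?I. X i \<omega>)(j := X j \<omega> + 1)) \<partial>M)"
    using j by simp
  finally show ?thesis unfolding X_def l .
qed

end

section \<open>The Mecke equation\<close>

lemma sets_add_atoms [simp]: "sets (add_atoms m c V) = sets borel"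
  and space_add_atoms [simp]: "space (add_atoms m c V) = UNIV"
proof -
  have *: "sigma_algebra UNIV (sets borel :: 'w::polish_space set set)"
    using sets.sigma_algebra_axioms[of borel] by simp
  show "sets (add_atoms m c V) = sets borel" "space (add_atoms m c V) = UNIV"
    unfolding add_atoms_def using sigma_algebra.sigma_sets_eq[OF *]
    by (auto simp: sets_measure_of space_measure_of)
qed

lemma emeasure_add_atoms:
  fixes m :: "'w::polish_space measure"
  assumes m: "sets m = sets borel" and B: "B \<in> sets borel"
  shows "emeasure (add_atoms m c V) B = emeasure m B + (\<Sum>x\<in>V. c x * indicator B x)"
proof -
  have "emeasure (add_atoms m c V) B = emeasure m B + (\<Sum>x\<in>V. c x * emeasure (return borel x) B)"
    unfolding add_atoms_def
  proof (rule emeasure_measure_of_sigma[OF _ _ _ B])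
    show "sigma_algebra UNIV (sets borel :: 'w set set)"
      using sets.sigma_algebra_axioms[of "borel :: 'w measure"] by simp
    show "positive (sets borel) (\<lambda>B. emeasure m B + (\<Sum>x\<in>V. c x * emeasure (return borel x) B))"
      by (auto simp: positive_def)
    show "countably_additive (sets borel) (\<lambda>B. emeasure m B + (\<Sum>x\<in>V. c x * emeasure (return borel x) B))"
    proof (rule countably_additiveI)
      fix A :: "nat \<Rightarrow> 'w set" assume A: "range A \<subseteq> sets borel" "disjoint_family A"
      have "(\<Sum>i. emeasure m (A i) + (\<Sum>x\<in>V. c x * emeasure (return borel x) (A i)))
          = (\<Sum>i. emeasure m (A i)) + (\<Sum>x\<in>V. \<Sum>i. c x * emeasure (return borel x) (A i))"
        by (subst suminf_add[symmetric]) (auto simp: suminf_sum)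
      also have "\<dots> = emeasure m (\<Union>i. A i) + (\<Sum>x\<in>V. c x * emeasure (return borel x) (\<Union>i. A i))"
        using A m by (simp add: suminf_emeasure suminf_indicator image_subset_iff sets.countable_UN)
      finally show "(\<Sum>i. emeasure m (A i) + (\<Sum>x\<in>V. c x * emeasure (return borel x) (A i)))
          = emeasure m (\<Union>i. A i) + (\<Sum>x\<in>V. c x * emeasure (return borel x) (\<Union>i. A i))" .
    qed
  qed
  then show ?thesis using B by simp
qed

lemma add_atoms_in_bf_measures:
  fixes m :: "'w::polish_space measure"
  assumes m: "m \<in> space bf_measures" and "finite V" and c: "\<And>x. x \<in> V \<Longrightarrow> c x < \<infinity>"
  shows "add_atoms m c V \<in> space bf_measures"
proof -
  have "emeasure (add_atoms m c V) B < \<infinity>" if "B \<in> sets borel" "bounded B" for B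
    using space_bf_measuresD(1,4)[OF m] that c \<open>finite V\<close>
    by (auto simp: emeasure_add_atoms indicator_def ennreal_mult_less_top)
  then show ?thesis by (simp add: space_bf_measures)
qed

lemma nn_integral_add_atoms:
  fixes m :: "'w::polish_space measure"
  assumes m: "sets m = sets borel" and f: "f \<in> borel_measurable borel"
  shows "(\<integral>\<^sup>+x. f x \<partial>add_atoms m c V) = (\<integral>\<^sup>+x. f x \<partial>m) + (\<Sum>x\<in>V. c x * f x)"
  using f
proof (induction rule: borel_measurable_induct)
  case (cong f g)
  then show ?case by (simp add: fun_eq_iff[symmetric] ext)
next
  case (set A)
  then show ?case using m by (simp add: emeasure_add_atoms)
next
  case prems: (mult u a)
  have [measurable]: "u \<in> borel_measurable m" "u \<in> borel_measurable (add_atoms m c V)"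
    using prems(2) m by (simp_all cong: measurable_cong_sets)
  show ?case using prems(4)
    by (simp add: nn_integral_cmult distrib_left sum_distrib_left mult_ac)
next
  case prems: (add u v)
  have [measurable]: "u \<in> borel_measurable m" "u \<in> borel_measurable (add_atoms m c V)"
    "v \<in> borel_measurable m" "v \<in> borel_measurable (add_atoms m c V)"
    using prems(1,3) m by (simp_all cong: measurable_cong_sets)
  show ?case using prems(6,7)
    by (simp add: nn_integral_add distrib_left sum.distrib add_ac)
next
  case prems: (seq U)
  have [measurable]: "U i \<in> borel_measurable m" "U i \<in> borel_measurable (add_atoms m c V)" for i
    using prems(1)[of i] m by (simp_all cong: measurable_cong_sets)
  have inc: "incseq (\<lambda>i. U i x)" for x using prems(3) by (auto simp: incseq_def le_fun_def)
  have "(\<integral>\<^sup>+x. (SUP i. U i) x \<partial>add_atoms m c V) = (SUP i. \<integral>\<^sup>+x. U i x \<partial>add_atoms m c V)"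
    using prems(3) by (simp add: SUP_apply[abs_def] nn_integral_monotone_convergence_SUP)
  also have "\<dots> = (SUP i. (\<integral>\<^sup>+x. U i x \<partial>m) + (\<Sum>x\<in>V. c x * U i x))" using prems(5) by simp
  also have "\<dots> = (SUP i. \<integral>\<^sup>+x. U i x \<partial>m) + (SUP i. \<Sum>x\<in>V. c x * U i x)"
    using prems(3) by (intro ennreal_SUP_add)
      (auto simp: incseq_def le_fun_def intro!: nn_integral_mono sum_mono mult_left_mono)
  also have "(SUP i. \<Sum>x\<in>V. c x * U i x) = (\<Sum>x\<in>V. SUP i. c x * U i x)"
    using prems(3) by (intro incseq_sumI2 ennreal_SUP_sum) (auto simp: incseq_def le_fun_def intro!: mult_left_mono)
  also have "\<dots> = (\<Sum>x\<in>V. c x * (SUP i. U i) x)"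
    by (simp add: SUP_mult_left_ennreal SUP_apply image_comp)
  also have "(SUP i. \<integral>\<^sup>+x. U i x \<partial>m) = (\<integral>\<^sup>+x. (SUP i. U i) x \<partial>m)"
    using prems(3) by (simp add: SUP_apply[abs_def] nn_integral_monotone_convergence_SUP)
  finally show ?case .
qed

abbreviation add_point :: "'w::polish_space measure \<Rightarrow> 'w \<Rightarrow> 'w measure" where
  "add_point m x \<equiv> add_atoms m (\<lambda>_. 1) {x}"

lemma measurable_add_point:
  "(\<lambda>(x, m). add_point m x) \<in> measurable (borel \<Otimes>\<^sub>M bf_measures) bf_measures"
proof (rule measurable_bf_measuresI)
  fix p assume "p \<in> space (borel \<Otimes>\<^sub>M bf_measures :: ('w::polish_space \<times> 'w measure) measure)"
  then show "(\<lambda>(x, m). add_point m x) p \<in> space bf_measures"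
    by (auto simp: space_pair_measure intro!: add_atoms_in_bf_measures)
next
  fix B :: "'w::polish_space set" assume [measurable]: "B \<in> sets borel"
  have "(\<lambda>p. emeasure (snd p) B + indicator B (fst p)) \<in> borel_measurable (borel \<Otimes>\<^sub>M bf_measures)"
    by measurable
  then show "(\<lambda>p. emeasure ((\<lambda>(x, m). add_point m x) p) B) \<in> borel_measurable (borel \<Otimes>\<^sub>M bf_measures)"
    by (rule measurable_cong[THEN iffD1, rotated])
      (auto simp: space_pair_measure emeasure_add_atoms space_bf_measuresD(1))
qed

section \<open>From cylinder events to the full Mecke equation\<close>

context prob_space
begin

text \<open>On disjoint cells the insertion of a point is a shift of one coordinate: a point in
  \<open>E j\<close> raises the count of that cell by one and leaves the others unchanged. The cells
  refine \<open>A\<close> along with the sets in \<open>F\<close>, so both the factor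
  \<open>emeasure (N \<omega>) A\<close> and the event are functions of the cell counts.\<close>

lemma poisson_mecke_cylinder:
  fixes N :: "'a \<Rightarrow> 'w::polish_space measure"
  assumes N: "poisson_random_measure M \<nu> N" and \<nu>: "sets \<nu> = sets borel"
    and A: "A \<in> sets borel" "emeasure \<nu> A < \<infinity>"
    and F: "finite F" "F \<subseteq> sets borel \<times> sets borel"
  shows "(\<integral>\<^sup>+\<omega>. emeasure (N \<omega>) A * indicator (count_cylinder F) (N \<omega>) \<partial>M)
    = (\<integral>\<^sup>+x. (\<integral>\<^sup>+\<omega>. indicator (count_cylinder F) (add_point (N \<omega>) x) \<partial>M) * indicator A x \<partial>\<nu>)"
proof -
  obtain fs where fs: "set fs = F" using finite_list[OF F(1)] by blast
  define m where "m = length fs"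
  \<comment> \<open>The index \<open>m\<close>, one past the sets of the cylinder, stands for
    \<open>A\<close> itself, so that \<open>A\<close> is cut by the same cells.\<close>
  define B where "B i = (if i < m then fst (fs ! i) else A)" for i
  define U where "U i = snd (fs ! i)" for i
  have fsF: "fs ! i \<in> F" if "i < m" for i using that fs by (auto simp: m_def)
  have B[measurable]: "B i \<in> sets borel" for i
    using A(1) F(2) fsF[of i] by (auto simp: B_def)
  have U: "U i \<in> sets borel" if "i < m" for i
    using F(2) fsF[OF that] by (auto simp: U_def)
  \<comment> \<open>Points are sorted into cells by the set of \<open>i \<le> m\<close> with \<open>x \<in> B i\<close>, encoded as a number.\<close>
  define r where "r = Suc (set_encode {..m})"
  define E where "E k = {x. \<forall>i. (i \<le> m \<and> x \<in> B i) = (i \<in> set_decode k)}" for k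
  have E[measurable]: "E k \<in> sets borel" for k
  proof -
    have "{x \<in> space borel. \<forall>i. (i \<le> m \<and> x \<in> B i) = (i \<in> set_decode k)} \<in> sets borel"
      by measurable
    then show ?thesis by (simp add: E_def)
  qed
  have Edis: "i = k" if "x \<in> E i" "x \<in> E k" for x i k
  proof -
    have "set_decode i = set_decode k" using that unfolding E_def by blast
    then show ?thesis by (metis set_decode_inverse)
  qed
  then have Ed: "disjoint_family_on E X" for X by (auto simp: disjoint_family_on_def)
  have Eex: "\<exists>k<r. x \<in> E k" for x
  proof (intro exI conjI)
    let ?k = "set_encode {i. i \<le> m \<and> x \<in> B i}"
    have fin: "finite {i. i \<le> m \<and> x \<in> B i}" by simp
    show "x \<in> E ?k" using fin by (simp add: E_def)
    \<comment> \<open>Codes are monotone under inclusion, so the code of the full index set is the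
      largest one; \<open>r\<close> is its successor.\<close>
    have "set_decode ?k \<subseteq> set_decode (set_encode {..m})" using fin by auto
    then show "?k < r" unfolding r_def by (intro le_imp_less_Suc subset_decode_imp_le)
  qed
  \<comment> \<open>The codes of the cells that make up \<open>B i\<close>.\<close>
  define J where "J i = {k. k < r \<and> i \<in> set_decode k}" for i
  have J: "finite (J i)" for i by (simp add: J_def)
  have BE: "B i = (\<Union>k\<in>J i. E k)" if "i \<le> m" for i
  proof (intro set_eqI iffI)
    fix x assume "x \<in> B i"
    moreover obtain k where "k < r" "x \<in> E k" using Eex by blast
    ultimately show "x \<in> (\<Union>k\<in>J i. E k)" using that by (auto simp: J_def E_def)
  qed (use that in \<open>auto simp: J_def E_def\<close>)
  have BN: "emeasure n (B i) = (\<Sum>k\<in>J i. emeasure n (E k))" if "i \<le> m" "sets n = sets borel" for i n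
    using that J Ed[of "J i"] by (simp add: BE sum_emeasure image_subset_iff)
  have AB: "A = B m" by (simp add: B_def)
  \<comment> \<open>The cylinder indicator as a function of the cell counts \<open>v\<close>: the
    inner sum reassembles the count of \<open>B i\<close>.\<close>
  define \<phi> where "\<phi> v = (\<Prod>i<m. indicator (U i) (\<Sum>k\<in>J i. v k) :: ennreal)" for v
  have \<phi>[measurable]: "\<phi> \<in> borel_measurable (PiM {..<r} (\<lambda>_. borel))"
  proof -
    have [measurable]: "(\<lambda>v. \<Sum>k\<in>J i. v k) \<in> borel_measurable (PiM {..<r} (\<lambda>_. borel :: ennreal measure))" for i
      by (intro borel_measurable_sum measurable_component_singleton) (simp add: J_def)
    show ?thesis unfolding \<phi>_def
      by (intro borel_measurable_prod_ennreal measurable_compose[OF _ borel_measurable_indicator[OF U]]) auto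
  qed
  have cyl: "indicator (count_cylinder F) n = \<phi> (\<lambda>k\<in>{..<r}. emeasure n (E k))"
    if n: "n \<in> space bf_measures" for n
  proof -
    have "n \<in> count_cylinder F \<longleftrightarrow> (\<forall>i<m. emeasure n (B i) \<in> U i)"
      using n unfolding count_cylinder_def fs[symmetric]
      by (simp add: all_set_conv_all_nth B_def U_def m_def case_prod_beta')
    moreover have "(\<Sum>k\<in>J i. (\<lambda>k\<in>{..<r}. emeasure n (E k)) k) = emeasure n (B i)" if "i < m" for i
      unfolding BN[OF less_imp_le[OF that] space_bf_measuresD(1)[OF n]]
      by (rule sum.cong) (auto simp: J_def)
    ultimately show ?thesis unfolding \<phi>_def
      by (auto simp: indicator_def prod_eq_1_iff split: if_splits intro!: prod_zero[symmetric])
  qed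
  have Nm: "N \<in> measurable M bf_measures" using N by (simp add: poisson_random_measure_def)
  have Nbf: "N \<omega> \<in> space bf_measures" if "\<omega> \<in> space M" for \<omega> using measurable_space[OF Nm that] .
  have [measurable]: "(\<lambda>\<omega>. emeasure (N \<omega>) (E k)) \<in> borel_measurable M" for k
    using measurable_compose[OF Nm measurable_emeasure_bf_measures[OF E]] .
  define v where "v \<omega> = (\<lambda>k\<in>{..<r}. emeasure (N \<omega>) (E k))" for \<omega>
  have v[measurable]: "v \<in> measurable M (PiM {..<r} (\<lambda>_. borel))" unfolding v_def by measurable
  have fin: "emeasure \<nu> (E j) < \<infinity>" if "j \<in> J m" for j
  proof -
    have "E j \<subseteq> A" unfolding AB BE[OF order_refl] using that by auto
    then show ?thesis using A \<nu> by (auto intro: order_le_less_trans[OF emeasure_mono])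
  qed
  have addp: "indicator (count_cylinder F) (add_point (N \<omega>) x)
      = \<phi> ((v \<omega>)(j := emeasure (N \<omega>) (E j) + 1))" if "\<omega> \<in> space M" "x \<in> E j" "j < r" for \<omega> x j
  proof -
    have "add_point (N \<omega>) x \<in> space bf_measures"
      using Nbf[OF that(1)] by (intro add_atoms_in_bf_measures) auto
    moreover have "(\<lambda>k\<in>{..<r}. emeasure (add_point (N \<omega>) x) (E k)) = (v \<omega>)(j := emeasure (N \<omega>) (E j) + 1)"
    proof
      fix k
      have "indicator (E k) x = (if k = j then 1 else 0 :: ennreal)"
      proof (cases "k = j")
        case False
        then have "x \<notin> E k" using Edis[OF that(2), of k] by blast
        then show ?thesis using False by simp
      qed (use that(2) in simp)
      then have "emeasure (add_point (N \<omega>) x) (E k) = emeasure (N \<omega>) (E k) + (if k = j then 1 else 0)"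
        by (simp add: emeasure_add_atoms[OF space_bf_measuresD(1)[OF Nbf[OF that(1)]] E])
      then show "(\<lambda>k\<in>{..<r}. emeasure (add_point (N \<omega>) x) (E k)) k = ((v \<omega>)(j := emeasure (N \<omega>) (E j) + 1)) k"
        using that(3) by (cases "k = j") (simp_all add: v_def)
    qed
    ultimately show ?thesis by (simp add: cyl)
  qed
  have "(\<integral>\<^sup>+\<omega>. emeasure (N \<omega>) A * indicator (count_cylinder F) (N \<omega>) \<partial>M)
      = (\<integral>\<^sup>+\<omega>. (\<Sum>j\<in>J m. emeasure (N \<omega>) (E j) * \<phi> (v \<omega>)) \<partial>M)"
    by (intro nn_integral_cong)
      (simp add: AB BN space_bf_measuresD(1)[OF Nbf] cyl[OF Nbf] v_def sum_distrib_right)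
  also have "\<dots> = (\<Sum>j\<in>J m. \<integral>\<^sup>+\<omega>. emeasure (N \<omega>) (E j) * \<phi> (v \<omega>) \<partial>M)"
    by (rule nn_integral_sum) measurable
  also have "\<dots> = (\<Sum>j\<in>J m. emeasure \<nu> (E j) * (\<integral>\<^sup>+\<omega>. \<phi> ((v \<omega>)(j := emeasure (N \<omega>) (E j) + 1)) \<partial>M))"
    unfolding v_def by (intro sum.cong refl poisson_cells[OF N E Ed _ fin \<phi>]) (simp add: J_def)
  also have "\<dots> = (\<Sum>j\<in>J m. \<integral>\<^sup>+x. (\<integral>\<^sup>+\<omega>. \<phi> ((v \<omega>)(j := emeasure (N \<omega>) (E j) + 1)) \<partial>M) * indicator (E j) x \<partial>\<nu>)"
    by (intro sum.cong refl, subst nn_integral_cmult_indicator) (auto simp: \<nu> mult.commute)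
  also have "\<dots> = (\<integral>\<^sup>+x. (\<Sum>j\<in>J m. (\<integral>\<^sup>+\<omega>. \<phi> ((v \<omega>)(j := emeasure (N \<omega>) (E j) + 1)) \<partial>M) * indicator (E j) x) \<partial>\<nu>)"
    by (rule nn_integral_sum[symmetric]) (use \<nu> in \<open>simp cong: measurable_cong_sets\<close>)
  also have "\<dots> = (\<integral>\<^sup>+x. (\<integral>\<^sup>+\<omega>. indicator (count_cylinder F) (add_point (N \<omega>) x) \<partial>M) * indicator A x \<partial>\<nu>)"
  proof (intro nn_integral_cong)
    fix x
    let ?g = "\<lambda>j. \<integral>\<^sup>+\<omega>. \<phi> ((v \<omega>)(j := emeasure (N \<omega>) (E j) + 1)) \<partial>M"
    obtain k where k: "k < r" "x \<in> E k" using Eex by blast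
    have ind: "indicator (E j) x = (if j = k then 1 else 0 :: ennreal)" for j
    proof (cases "j = k")
      case False
      then have "x \<notin> E j" using Edis[OF k(2), of j] by blast
      then show ?thesis using False by simp
    qed (use k in simp)
    have "x \<in> A \<longleftrightarrow> k \<in> J m" using k unfolding AB by (auto simp: E_def J_def)
    moreover have "?g k = (\<integral>\<^sup>+\<omega>. indicator (count_cylinder F) (add_point (N \<omega>) x) \<partial>M)"
      by (intro nn_integral_cong) (simp add: addp[OF _ k(2,1)])
    moreover have "(\<Sum>j\<in>J m. ?g j * indicator (E j) x) = (\<Sum>j\<in>J m. if j = k then ?g j else 0)"
      unfolding ind by (intro sum.cong) auto
    moreover have "\<dots> = (if k \<in> J m then ?g k else 0)" using J by (rule sum.delta)
    ultimately show "(\<Sum>j\<in>J m. ?g j * indicator (E j) x)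
        = (\<integral>\<^sup>+\<omega>. indicator (count_cylinder F) (add_point (N \<omega>) x) \<partial>M) * indicator A x"
      by (simp add: indicator_def)
  qed
  finally show ?thesis .
qed

text \<open>Both sides are positive functionals of the integrand and agree on products of a Borel
  set of finite intensity with a cylinder. Balls times the whole space of measures form the cover
  needed for uniqueness; its finite mass is read off from the right-hand side, which on a product is
  at most the intensity of its first factor.\<close>

lemma poisson_mecke:
  fixes N :: "'a \<Rightarrow> 'w::polish_space measure"
  assumes N: "poisson_random_measure M \<nu> N" and \<nu>: "sets \<nu> = sets borel"
    and fin: "\<And>B. B \<in> sets borel \<Longrightarrow> bounded B \<Longrightarrow> emeasure \<nu> B < \<infinity>"
    and L: "L = distr M bf_measures N"
    and f: "(\<lambda>(x, m). f x m) \<in> borel_measurable (borel \<Otimes>\<^sub>M bf_measures)"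
  shows "(\<integral>\<^sup>+m. \<integral>\<^sup>+x. f x m \<partial>m \<partial>L) = (\<integral>\<^sup>+x. \<integral>\<^sup>+m. f x (add_point m x) \<partial>L \<partial>\<nu>)"
proof -
  let ?S = "borel \<Otimes>\<^sub>M bf_measures :: ('w \<times> 'w measure) measure"
  let ?Ea = "{A \<in> sets borel. emeasure \<nu> A < \<infinity>}"
  let ?E = "{A \<times> G | A G. A \<in> ?Ea \<and> G \<in> (count_cylinders :: 'w measure set set)}"
  have Nm: "N \<in> measurable M bf_measures" using N by (simp add: poisson_random_measure_def)
  have sL: "sets L = sets bf_measures" "space L = space bf_measures" by (simp_all add: L)
  interpret L: prob_space L unfolding L by (rule prob_space_distr[OF Nm])
  note [measurable_cong] = sL(1) \<nu>
  have cc: "G \<in> sets bf_measures" if "G \<in> count_cylinders" for G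
    using that by (auto simp: sets_bf_measures)
  define \<Phi> where "\<Phi> g = (\<integral>\<^sup>+m. \<integral>\<^sup>+x. g (x, m) \<partial>m \<partial>L)" for g :: "'w \<times> 'w measure \<Rightarrow> ennreal"
  define \<Psi> where "\<Psi> g = (\<integral>\<^sup>+x. \<integral>\<^sup>+m. g (x, add_point m x) \<partial>L \<partial>\<nu>)" for g :: "'w \<times> 'w measure \<Rightarrow> ennreal"
  have \<Phi>: "nn_functional ?S \<Phi>"
    unfolding \<Phi>_def
  proof (rule nn_functional_mixture)
    fix m assume "m \<in> space L"
    then have m: "m \<in> space bf_measures" by (simp add: sL)
    show "nn_functional ?S (\<lambda>g. \<integral>\<^sup>+x. g (x, m) \<partial>m)"
      using m by (intro nn_functional_integral) (simp add: space_bf_measuresD(3))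
  next
    fix g :: "'w \<times> 'w measure \<Rightarrow> ennreal" assume [measurable]: "g \<in> borel_measurable ?S"
    have "(\<lambda>m. \<integral>\<^sup>+x. g (x, m) \<partial>m) \<in> borel_measurable bf_measures"
      by (rule nn_integral_bf_measures_measurable) measurable
    then show "(\<lambda>m. \<integral>\<^sup>+x. g (x, m) \<partial>m) \<in> borel_measurable L" by measurable
  qed
  have \<Psi>: "nn_functional ?S \<Psi>"
    unfolding \<Psi>_def
  proof (rule nn_functional_mixture)
    fix x
    have "(\<lambda>m. (x, m)) \<in> measurable L ?S" by measurable
    from measurable_compose[OF this measurable_add_point]
    have "(\<lambda>m. add_point m x) \<in> measurable L bf_measures" by simp
    then show "nn_functional ?S (\<lambda>g. \<integral>\<^sup>+m. g (x, add_point m x) \<partial>L)"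
      by (intro nn_functional_integral measurable_Pair) auto
  next
    fix g :: "'w \<times> 'w measure \<Rightarrow> ennreal" assume g: "g \<in> borel_measurable ?S"
    have "(\<lambda>(x, m). (x, add_point m x)) \<in> measurable ?S ?S"
      unfolding split_beta'
      by (intro measurable_Pair measurable_fst) (use measurable_add_point in \<open>simp add: split_beta'\<close>)
    from measurable_compose[OF this g]
    have "(\<lambda>(x, m). g (x, add_point m x)) \<in> borel_measurable (\<nu> \<Otimes>\<^sub>M L)"
      by (simp add: split_beta' cong: measurable_cong_sets)
    then show "(\<lambda>x. \<integral>\<^sup>+m. g (x, add_point m x) \<partial>L) \<in> borel_measurable \<nu>"
      by (rule L.borel_measurable_nn_integral)
  qed
  have cover: "(\<Union>k::nat. ball undefined (real k)) = (UNIV :: 'w set)"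
    using reals_Archimedean2 by (auto simp: set_eq_iff)
  have ballE: "ball undefined (real k) \<in> ?Ea" for k :: nat using fin by auto
  have eq: "\<Phi> (indicator X) = \<Psi> (indicator X)" "\<Phi> (indicator X) \<le> emeasure \<nu> (fst ` X)"
    if "X \<in> ?E" for X
  proof -
    from that obtain A F where X: "X = A \<times> count_cylinder F" "A \<in> sets borel" "emeasure \<nu> A < \<infinity>"
      and F: "finite F" "F \<subseteq> sets borel \<times> sets borel"
      by (auto simp: count_cylinders_def)
    let ?G = "count_cylinder F"
    have [measurable]: "?G \<in> sets bf_measures" "A \<in> sets borel" using sets_count_cylinder[OF F] X by simp_all
    have "\<Phi> (indicator X) = (\<integral>\<^sup>+m. emeasure m A * indicator ?G m \<partial>L)"
      unfolding \<Phi>_def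
    proof (intro nn_integral_cong)
      fix m assume "m \<in> space L"
      then have m: "sets m = sets borel" using space_bf_measuresD(1) by (simp add: sL)
      have "(\<integral>\<^sup>+x. indicator X (x, m) \<partial>m) = (\<integral>\<^sup>+x. indicator ?G m * indicator A x \<partial>m)"
        by (intro nn_integral_cong) (auto simp: X indicator_def)
      also have "\<dots> = emeasure m A * indicator ?G m"
        using m X by (subst nn_integral_cmult_indicator) (auto simp: mult.commute)
      finally show "(\<integral>\<^sup>+x. indicator X (x, m) \<partial>m) = emeasure m A * indicator ?G m" .
    qed
    also have "\<dots> = (\<integral>\<^sup>+\<omega>. emeasure (N \<omega>) A * indicator ?G (N \<omega>) \<partial>M)"
      unfolding L using Nm by (subst nn_integral_distr) auto
    finally have 1: "\<Phi> (indicator X) = \<dots>" .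
    also have "\<dots> = (\<integral>\<^sup>+x. (\<integral>\<^sup>+\<omega>. indicator ?G (add_point (N \<omega>) x) \<partial>M) * indicator A x \<partial>\<nu>)"
      by (rule poisson_mecke_cylinder[OF N \<nu> X(2,3) F])
    also have "\<dots> = \<Psi> (indicator X)"
      unfolding \<Psi>_def
    proof (intro nn_integral_cong)
      fix x
      have "(\<lambda>m. (x, m)) \<in> measurable bf_measures ?S" by measurable
      from measurable_compose[OF this measurable_add_point]
      have m: "(\<lambda>m. add_point m x) \<in> measurable bf_measures bf_measures" by simp
      have "(\<integral>\<^sup>+m. indicator X (x, add_point m x) \<partial>L) = (\<integral>\<^sup>+\<omega>. indicator X (x, add_point (N \<omega>) x) \<partial>M)"
        unfolding L by (rule nn_integral_distr[OF Nm]) (use m in \<open>simp add: X indicator_times\<close>)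
      also have "\<dots> = (\<integral>\<^sup>+\<omega>. indicator ?G (add_point (N \<omega>) x) * indicator A x \<partial>M)"
        by (intro nn_integral_cong) (simp add: X indicator_times mult.commute)
      also have "\<dots> = (\<integral>\<^sup>+\<omega>. indicator ?G (add_point (N \<omega>) x) \<partial>M) * indicator A x"
        using measurable_compose[OF measurable_compose[OF Nm m] borel_measurable_indicator[OF sets_count_cylinder[OF F]]]
        by (intro nn_integral_multc) auto
      finally show "(\<integral>\<^sup>+\<omega>. indicator ?G (add_point (N \<omega>) x) \<partial>M) * indicator A x
          = (\<integral>\<^sup>+m. indicator X (x, add_point m x) \<partial>L)" by simp
    qed
    finally show 2: "\<Phi> (indicator X) = \<Psi> (indicator X)" .
    show "\<Phi> (indicator X) \<le> emeasure \<nu> (fst ` X)"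
    \<comment> \<open>The projection of \<open>X\<close> to the first coordinate equals
      \<open>A\<close> only if the cylinder is nonempty.\<close>
    proof (cases "?G = {}")
      case True
      then have "\<Psi> (indicator X) = 0" by (simp add: X \<Psi>_def)
      then show ?thesis using 2 by simp
    next
      case False
      then have X1: "fst ` X = A" by (simp add: X)
      have "\<Psi> (indicator X) \<le> (\<integral>\<^sup>+x. \<integral>\<^sup>+m. indicator A x \<partial>L \<partial>\<nu>)"
        unfolding \<Psi>_def by (intro nn_integral_mono) (auto simp: X indicator_def)
      also have "\<dots> = emeasure \<nu> A" using X \<nu> by (simp add: L.emeasure_space_1)
      finally show ?thesis using 2 X1 by simp
    qed
  qed
  have "\<Phi> (\<lambda>(x, m). f x m) = \<Psi> (\<lambda>(x, m). f x m)"
  proof (rule nn_functional_eqI[OF \<Phi> \<Psi>, where E="?E" and A="\<lambda>k. ball undefined (real k) \<times> space bf_measures"])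
    show "Int_stable ?E"
    proof (rule Int_stableI)
      fix a b assume "a \<in> ?E" "b \<in> ?E"
      then obtain A A' G G' where *: "a = A \<times> G" "b = A' \<times> G'" "A \<in> ?Ea" "A' \<in> ?Ea"
        "G \<in> (count_cylinders :: 'w measure set set)" "G' \<in> (count_cylinders :: 'w measure set set)" by blast
      have "emeasure \<nu> (A \<inter> A') \<le> emeasure \<nu> A" using * \<nu> by (intro emeasure_mono) auto
      then have "A \<inter> A' \<in> ?Ea" using * by (auto intro: order_le_less_trans)
      moreover have "G \<inter> G' \<in> count_cylinders"
        using * Int_stable_count_cylinders by (auto simp: Int_stable_def)
      ultimately show "a \<inter> b \<in> ?E" using * by (auto simp: Times_Int_Times)
    qed
    show "?E \<subseteq> Pow (space ?S)"
      using cc sets.sets_into_space by (fastforce simp: space_pair_measure)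
    \<comment> \<open>Sets of finite intensity generate the Borel sets, since each Borel set is the
      union of its bounded pieces in the balls.\<close>
    have "sets (borel :: 'w measure) = sigma_sets UNIV ?Ea"
    proof (rule antisym)
      show "sigma_sets UNIV ?Ea \<subseteq> sets borel"
        using sets.sigma_sets_subset[of ?Ea borel] by auto
      show "sets borel \<subseteq> sigma_sets UNIV ?Ea"
      proof
        fix B :: "'w set" assume B: "B \<in> sets borel"
        have "B \<inter> ball undefined (real k) \<in> sigma_sets UNIV ?Ea" for k :: nat
          using B fin[of "B \<inter> ball undefined (real k)"]
          by (intro sigma_sets.Basic) (auto intro: bounded_subset[OF bounded_ball])
        then have "(\<Union>k::nat. B \<inter> ball undefined (real k)) \<in> sigma_sets UNIV ?Ea"
          by (rule sigma_sets.Union)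
        then show "B \<in> sigma_sets UNIV ?Ea"
          unfolding Int_UN_distrib[symmetric] cover by simp
      qed
    qed
    then have "sets ?S = sets (sigma (space borel \<times> space bf_measures) ?E)"
      using sets.sets_into_space[OF cc] ballE cover space_in_count_cylinders
      by (intro sets_pair_eq[where Ca="range (\<lambda>k::nat. ball undefined (real k))" and Cb="{space bf_measures}"])
        (auto simp: sets_bf_measures)
    moreover have "?E \<subseteq> Pow (space borel \<times> space bf_measures)" using \<open>?E \<subseteq> Pow (space ?S)\<close>
      by (simp add: space_pair_measure)
    ultimately show "sets ?S = sigma_sets (space ?S) ?E"
      by (simp add: space_pair_measure)
    show "range (\<lambda>k. ball undefined (real k) \<times> space bf_measures) \<subseteq> ?E"
      using ballE space_in_count_cylinders by blast
    then have kE: "ball undefined (real k) \<times> space bf_measures \<in> ?E" for k by blast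
    show "(\<Union>k. ball undefined (real k) \<times> space bf_measures) = space ?S"
      using cover by (auto simp: space_pair_measure)
    show "\<Phi> (indicator (ball undefined (real k) \<times> space bf_measures)) \<noteq> \<infinity>" for k
    proof -
      have "\<Phi> (indicator (ball undefined (real k) \<times> space bf_measures)) \<le> emeasure \<nu> (ball undefined (real k))"
        using order_trans[OF eq(2)[OF kE[of k]] emeasure_mono[of "fst ` (ball undefined (real k) \<times> space bf_measures)" "ball undefined (real k)" \<nu>]]
        by (auto simp: \<nu>)
      then show ?thesis using fin[of "ball undefined (real k)"] by (auto simp: top_unique)
    qed
  qed (use eq f in auto)
  then show ?thesis by (simp add: \<Phi>_def \<Psi>_def)
qed

end

section \<open>Vectors with ties\<close>

text \<open>Deleting \<open>a\<close> from a partition of \<open>insert a A\<close> leaves a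
  partition of \<open>A\<close> and a record of the cell that \<open>a\<close> had joined, if any.
  This is the combinatorial counterpart of drawing one more sample point.\<close>

lemma sum_partition_on_insert:
  fixes F :: "'b set set \<Rightarrow> 'c::comm_monoid_add"
  assumes A: "finite A" and a: "a \<notin> A"
  shows "(\<Sum>q | partition_on (insert a A) q. F q)
    = (\<Sum>p | partition_on A p. F (insert {a} p) + (\<Sum>C\<in>p. F (insert (insert a C) (p - {C}))))"
proof -
  let ?P = "{p. partition_on A p}"
  \<comment> \<open>The pair \<open>(p, {})\<close> stands for a new singleton cell.\<close>
  define \<Phi> where "\<Phi> = (\<lambda>(p, C). insert (insert a C) (p - {C}))"
  have fin: "finite ?P" by (rule finitely_many_partition_on[OF A])
  have finp: "finite p" if "p \<in> ?P" for p using that A finite_elements by auto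
  have ap: "a \<notin> C" if "p \<in> ?P" "C \<in> insert {} p" for p C
    using that a by (auto simp: partition_on_def)
  have ex: "C = C' \<and> p - {C} = p' - {C'}" if "p \<in> ?P" "p' \<in> ?P" "C \<in> insert {} p" "C' \<in> insert {} p'"
    "\<Phi> (p, C) = \<Phi> (p', C')" for p p' C C'
  proof -
    have eq: "insert (insert a C) (p - {C}) = insert (insert a C') (p' - {C'})"
      using that by (simp add: \<Phi>_def)
    \<comment> \<open>The altered cell is the only one containing \<open>a\<close>, so it can be
      recognized in the result; this gives injectivity.\<close>
    have n1: "insert a C \<notin> p' - {C'}" using ap[OF that(2), of "insert a C"] by auto
    have n2: "insert a C \<notin> p - {C}" using ap[OF that(1), of "insert a C"] by auto
    have *: "insert a C = insert a C'" using eq n1 by (metis insertI1 insertE)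
    then have "C = C'" using insert_ident[OF ap[OF that(1,3)] ap[OF that(2,4)]] by simp
    moreover have "p - {C} = p' - {C'}"
      using eq insert_ident[OF n2 n1] unfolding *[symmetric] by simp
    ultimately show ?thesis by simp
  qed
  have "bij_betw \<Phi> (SIGMA p:?P. insert {} p) {q. partition_on (insert a A) q}"
  proof (rule bij_betw_imageI)
    show "inj_on \<Phi> (SIGMA p:?P. insert {} p)"
    proof (rule inj_onI, clarify)
      fix p C p' C' assume pP: "partition_on A p" "partition_on A p'"
        and C: "C \<in> insert {} p" "C' \<in> insert {} p'" and eq: "\<Phi> (p, C) = \<Phi> (p', C')"
      have *: "C = C'" "p - {C} = p' - {C'}" using ex[OF _ _ C eq] pP by auto
      have "{} \<notin> p" "{} \<notin> p'" using pP by (auto simp: partition_on_def)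
      then have "p = p'" using C * by (cases "C = {}") blast+
      then show "p = p' \<and> C = C'" using * by simp
    qed
    show "\<Phi> ` (SIGMA p:?P. insert {} p) = {q. partition_on (insert a A) q}"
    proof (intro equalityI subsetI)
      fix q assume "q \<in> \<Phi> ` (SIGMA p:?P. insert {} p)"
      then obtain p C where p: "partition_on A p" "C \<in> insert {} p" and q: "q = insert (insert a C) (p - {C})"
        by (auto simp: \<Phi>_def)
      have "\<Union>q = insert a A" using p unfolding q by (auto simp: partition_on_def)
      moreover have "disjoint q"
        unfolding q disjoint_def
      proof (intro ballI impI)
        fix X Y assume XY: "X \<in> insert (insert a C) (p - {C})" "Y \<in> insert (insert a C) (p - {C})" "X \<noteq> Y"
        have d: "D \<inter> D' = {}" if "D \<in> p" "D' \<in> p" "D \<noteq> D'" for D D'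
          using p(1) that by (auto simp: partition_on_def disjoint_def)
        have na: "a \<notin> D" if "D \<in> p" for D using ap[of p D] p(1) that by simp
        have dC: "D \<inter> insert a C = {}" if "D \<in> p - {C}" for D
          using that na[of D] d[of D C] p(2) by auto
        show "X \<inter> Y = {}"
        proof (cases "X = insert a C")
          case True
          then show ?thesis using XY dC[of Y] by blast
        next
          case False
          then show ?thesis using XY dC[of X] d[of X Y] by blast
        qed
      qed
      moreover have "{} \<notin> q" using p unfolding q by (auto simp: partition_on_def)
      ultimately show "q \<in> {q. partition_on (insert a A) q}" by (simp add: partition_on_def)
    next
      fix q assume "q \<in> {q. partition_on (insert a A) q}"
      then have q: "\<Union>q = insert a A" "disjoint q" "{} \<notin> q" by (auto simp: partition_on_def)
      then obtain D where D: "D \<in> q" "a \<in> D" by blast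
      \<comment> \<open>The inverse construction: strip \<open>a\<close> from its cell
        \<open>D\<close>, and drop what remains if it is empty.\<close>
      define C where "C = D - {a}"
      define p where "p = (if C = {} then q - {D} else insert C (q - {D}))"
      have dis: "X \<inter> Y = {}" if "X \<in> q" "Y \<in> q" "X \<noteq> Y" for X Y
        using q(2) that by (auto simp: disjoint_def)
      have nD: "X \<inter> D = {}" if "X \<in> q - {D}" for X using dis[of X D] that D by auto
      have iD: "insert a C = D" using D by (auto simp: C_def)
      have "C \<notin> q - {D}"
      proof
        assume "C \<in> q - {D}"
        then have "C \<inter> D = {}" using nD by blast
        then have "C = {}" by (auto simp: C_def)
        then show False using \<open>C \<in> q - {D}\<close> q(3) by simp
      qed
      have Up: "\<Union>p = A"
      proof -
        have "\<Union>p = C \<union> \<Union>(q - {D})" by (auto simp: p_def)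
        moreover have "\<Union>q = D \<union> \<Union>(q - {D})" using D by blast
        moreover have "D \<inter> \<Union>(q - {D}) = {}" using nD by blast
        ultimately have "\<Union>p = \<Union>q - {a}" using D by (auto simp: C_def)
        then show ?thesis using q(1) a by auto
      qed
      have "disjoint p"
        unfolding disjoint_def
      proof (intro ballI impI)
        fix X Y assume XY: "X \<in> p" "Y \<in> p" "X \<noteq> Y"
        have CD: "C \<subseteq> D" by (auto simp: C_def)
        have m: "X = C \<or> X \<in> q - {D}" "Y = C \<or> Y \<in> q - {D}" using XY by (auto simp: p_def split: if_splits)
        then show "X \<inter> Y = {}" using XY(3) nD[of X] nD[of Y] dis[of X Y] CD by blast
      qed
      moreover have "{} \<notin> p" using q(3) by (auto simp: p_def)
      ultimately have "partition_on A p" using Up by (simp add: partition_on_def)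
      moreover have "C \<in> insert {} p" by (simp add: p_def)
      moreover have "p - {C} = q - {D}" using \<open>C \<notin> q - {D}\<close> q(3) by (auto simp: p_def)
      then have "\<Phi> (p, C) = q" using D by (auto simp: \<Phi>_def iD)
      ultimately show "q \<in> \<Phi> ` (SIGMA p:?P. insert {} p)" by force
    qed
  qed
  then have "(\<Sum>q | partition_on (insert a A) q. F q) = (\<Sum>z\<in>(SIGMA p:?P. insert {} p). F (\<Phi> z))"
    by (rule sum.reindex_bij_betw[symmetric])
  also have "\<dots> = (\<Sum>p\<in>?P. \<Sum>C\<in>insert {} p. F (\<Phi> (p, C)))"
    by (subst sum.Sigma) (use fin finp in auto)
  also have "\<dots> = (\<Sum>p\<in>?P. F (insert {a} p) + (\<Sum>C\<in>p. F (insert (insert a C) (p - {C}))))"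
  proof (rule sum.cong[OF refl])
    fix p assume p: "p \<in> ?P"
    then have "{} \<notin> p" by (auto simp: partition_on_def)
    then show "(\<Sum>C\<in>insert {} p. F (\<Phi> (p, C))) = F (insert {a} p) + (\<Sum>C\<in>p. F (insert (insert a C) (p - {C})))"
      using finp[OF p] by (simp add: \<Phi>_def)
  qed
  finally show ?thesis by simp
qed

section \<open>Vectors with a prescribed pattern of ties\<close>

lemma from_cells_eq:
  assumes p: "partition_on {1..n} p" and C: "C \<in> p" "i \<in> C"
  shows "from_cells n p x i = x C"
proof -
  have "i \<in> {1..n}" using p C by (auto simp: partition_on_def)
  moreover have "(THE C. C \<in> p \<and> i \<in> C) = C"
    using p C by (intro the_equality) (auto simp: partition_on_def disjoint_def)
  ultimately show ?thesis by (simp add: from_cells_def)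
qed

lemma from_cells_eqI:
  assumes p: "partition_on {1..n} p" and w: "w \<in> extensional {1..n}"
    and eq: "\<And>C i. C \<in> p \<Longrightarrow> i \<in> C \<Longrightarrow> w i = x C"
  shows "from_cells n p x = w"
proof
  fix i
  show "from_cells n p x i = w i"
  proof (cases "i \<in> {1..n}")
    case True
    then obtain C where "C \<in> p" "i \<in> C" using partition_onD1[OF p] by (metis UnionE)
    then show ?thesis using from_cells_eq[OF p] eq by simp
  next
    case False
    then show ?thesis using w by (auto simp: from_cells_def extensional_def)
  qed
qed

lemma from_cells_extensional: "from_cells n p x \<in> extensional {1..n}"
  by (simp add: from_cells_def)

lemma from_cells_image:
  assumes p: "partition_on {1..n} p"
  shows "from_cells n p x ` {1..n} = x ` p"
proof (intro equalityI subsetI)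
  fix y assume "y \<in> from_cells n p x ` {1..n}"
  then obtain i where "i \<in> {1..n}" "y = from_cells n p x i" by auto
  moreover obtain C where "C \<in> p" "i \<in> C" using partition_onD1[OF p] \<open>i \<in> {1..n}\<close> by (metis UnionE)
  ultimately show "y \<in> x ` p" using from_cells_eq[OF p] by auto
next
  fix y assume "y \<in> x ` p"
  then obtain C where C: "C \<in> p" "y = x C" by auto
  have "C \<noteq> {}" using C p by (auto simp: partition_on_def)
  then obtain i where "i \<in> C" by blast
  then have "i \<in> {1..n}" "from_cells n p x i = y" using C p from_cells_eq[OF p] by (auto simp: partition_on_def)
  then show "y \<in> from_cells n p x ` {1..n}" by (metis imageI)
qed

lemma measurable_from_cells:
  assumes p: "partition_on {1..n} p"
  shows "from_cells n p \<in> measurable (PiM p (\<lambda>_. M)) (PiM {1..n} (\<lambda>_. M))"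
  unfolding from_cells_def
proof (rule measurable_restrict)
  fix i assume "i \<in> {1..n}"
  then obtain C where C: "C \<in> p" "i \<in> C" using partition_onD1[OF p] by (metis UnionE)
  have "(THE C. C \<in> p \<and> i \<in> C) = C"
    using p C by (intro the_equality) (auto simp: partition_on_def disjoint_def)
  then show "(\<lambda>x. x (THE C. C \<in> p \<and> i \<in> C)) \<in> measurable (PiM p (\<lambda>_. M)) M"
    using C by (simp add: measurable_component_singleton)
qed

context sigma_finite_measure
begin

lemma product_sigma_finite_const: "product_sigma_finite (\<lambda>_. M)"
  by unfold_locales

text \<open>Relabelling coordinates maps boxes to boxes and merely reorders the product of their
  side masses. It serves three purposes: cells enlarged by a new index, exchangeability of the
  sample, and symmetry of the EPPF.\<close>

lemma distr_PiM_bij_betw: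
  assumes J: "finite J" and f: "bij_betw f J I"
  shows "distr (PiM I (\<lambda>_. M)) (PiM J (\<lambda>_. M)) (\<lambda>x. \<lambda>j\<in>J. x (f j)) = PiM J (\<lambda>_. M)"
proof -
  interpret P: product_sigma_finite "\<lambda>_. M" by (rule product_sigma_finite_const)
  have I: "finite I" using J f bij_betw_finite by blast
  have m: "(\<lambda>x. \<lambda>j\<in>J. x (f j)) \<in> measurable (PiM I (\<lambda>_. M)) (PiM J (\<lambda>_. M))"
    using f by (intro measurable_restrict measurable_component_singleton) (auto simp: bij_betw_def)
  let ?g = "inv_into J f"
  show ?thesis
  proof (rule P.PiM_eqI[OF J])
    fix A assume A: "\<And>j. j \<in> J \<Longrightarrow> A j \<in> sets M"
    have g: "?g i \<in> J" "f (?g i) = i" if "i \<in> I" for i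
      using that f by (auto simp: bij_betw_def inv_into_into f_inv_into_f)
    have gf: "?g (f j) = j" if "j \<in> J" for j using that f by (simp add: bij_betw_def)
    have "(\<lambda>x. \<lambda>j\<in>J. x (f j)) -` Pi\<^sub>E J A \<inter> space (PiM I (\<lambda>_. M)) = Pi\<^sub>E I (\<lambda>i. A (?g i))"
    proof (intro equalityI subsetI)
      fix x assume x: "x \<in> (\<lambda>x. \<lambda>j\<in>J. x (f j)) -` Pi\<^sub>E J A \<inter> space (PiM I (\<lambda>_. M))"
      show "x \<in> Pi\<^sub>E I (\<lambda>i. A (?g i))"
      proof (rule PiE_I)
        fix i assume i: "i \<in> I"
        have "x (f (?g i)) \<in> A (?g i)" using x g(1)[OF i] by (auto simp: PiE_iff)
        then show "x i \<in> A (?g i)" using g(2)[OF i] by simp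
      qed (use x in \<open>auto simp: space_PiM PiE_iff extensional_def\<close>)
    next
      fix x assume x: "x \<in> Pi\<^sub>E I (\<lambda>i. A (?g i))"
      have "x (f j) \<in> A j" if "j \<in> J" for j
        using x that f gf[OF that] by (auto simp: PiE_iff bij_betw_def)
      moreover have "x i \<in> space M" if "i \<in> I" for i
        using x that A[OF g(1)[OF that]] sets.sets_into_space by (fastforce simp: PiE_iff)
      ultimately show "x \<in> (\<lambda>x. \<lambda>j\<in>J. x (f j)) -` Pi\<^sub>E J A \<inter> space (PiM I (\<lambda>_. M))"
        using x by (auto simp: space_PiM PiE_iff)
    qed
    then have "emeasure (distr (PiM I (\<lambda>_. M)) (PiM J (\<lambda>_. M)) (\<lambda>x. \<lambda>j\<in>J. x (f j))) (Pi\<^sub>E J A)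
        = emeasure (PiM I (\<lambda>_. M)) (Pi\<^sub>E I (\<lambda>i. A (?g i)))"
      using A J by (subst emeasure_distr[OF m]) (auto intro!: sets_PiM_I_finite)
    also have "\<dots> = (\<Prod>i\<in>I. emeasure M (A (?g i)))"
      using I A g by (intro P.emeasure_PiM) auto
    also have "\<dots> = (\<Prod>j\<in>J. emeasure M (A (?g (f j))))"
      by (rule prod.reindex_bij_betw[OF f, symmetric])
    also have "\<dots> = (\<Prod>j\<in>J. emeasure M (A j))" by (intro prod.cong) (auto simp: gf)
    finally show "emeasure (distr (PiM I (\<lambda>_. M)) (PiM J (\<lambda>_. M)) (\<lambda>x. \<lambda>j\<in>J. x (f j))) (Pi\<^sub>E J A)
        = (\<Prod>j\<in>J. emeasure M (A j))" .
  qed simp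
qed

end

section \<open>Integration over vectors with ties\<close>

locale nonatomic_measure = sigma_finite_measure \<nu> for \<nu> :: "'w::polish_space measure" +
  assumes sets_eq[measurable_cong]: "sets \<nu> = sets borel"
    and nonatomic: "emeasure \<nu> {x} = 0"
begin

sublocale P: product_sigma_finite "\<lambda>_. \<nu>"
  by (rule product_sigma_finite_const)

lemma AE_notin_finite: "finite V \<Longrightarrow> AE y in \<nu>. y \<notin> V"
proof (rule AE_I[of _ _ V])
  assume V: "finite V"
  have "emeasure \<nu> V = (\<Sum>x\<in>V. emeasure \<nu> {x})"
    using V by (intro emeasure_eq_sum_singleton) (auto simp: sets_eq)
  then show "emeasure \<nu> V = 0" by (simp add: nonatomic)
  show "V \<in> sets \<nu>" using V by (auto simp: sets_eq intro: borel_closed finite_imp_closed)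
qed auto

text \<open>With all coordinates but \<open>i\<close> fixed, a tie with coordinate \<open>j\<close>
  confines the free one to a single point, which is null for a nonatomic measure. Finitely many
  pairs remain to be combined.\<close>

lemma AE_PiM_inj_on:
  assumes I: "finite I"
  shows "AE x in PiM I (\<lambda>_. \<nu>). inj_on x I"
proof -
  have "AE x in PiM I (\<lambda>_. \<nu>). x i \<noteq> x j" if ij: "i \<in> I" "j \<in> I" "i \<noteq> j" for i j
  proof -
    let ?J = "I - {i}"
    have ins: "insert i ?J = I" using ij by auto
    let ?A = "{x \<in> space (PiM I (\<lambda>_. \<nu>)). x i = x j}"
    have c: "(\<lambda>x. x k) \<in> borel_measurable (PiM I (\<lambda>_. \<nu>))" if "k \<in> I" for k
      using measurable_component_singleton[OF that, of "\<lambda>_. \<nu>"] measurable_cong_sets[OF refl sets_eq] by blast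
    have A[measurable]: "?A \<in> sets (PiM I (\<lambda>_. \<nu>))"
      using c ij by (intro measurable_equality_set) auto
    have "emeasure (PiM I (\<lambda>_. \<nu>)) ?A = (\<integral>\<^sup>+x. indicator ?A x \<partial>PiM (insert i ?J) (\<lambda>_. \<nu>))"
      unfolding ins by simp
    also have "\<dots> = (\<integral>\<^sup>+x. \<integral>\<^sup>+y. indicator ?A (x(i := y)) \<partial>\<nu> \<partial>PiM ?J (\<lambda>_. \<nu>))"
      by (rule P.product_nn_integral_insert) (use I A ins in auto)
    also have "\<dots> = (\<integral>\<^sup>+x. 0 \<partial>PiM ?J (\<lambda>_. \<nu>))"
    proof (intro nn_integral_cong)
      fix x
      have "AE y in \<nu>. indicator ?A (x(i := y)) = (0::ennreal)"
        using AE_notin_finite[of "{x j}"] ij by (auto simp: indicator_def elim!: eventually_mono)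
      then show "(\<integral>\<^sup>+y. indicator ?A (x(i := y)) \<partial>\<nu>) = 0"
        by (subst nn_integral_cong_AE) auto
    qed
    finally have "emeasure (PiM I (\<lambda>_. \<nu>)) ?A = 0" by simp
    then show ?thesis by (intro AE_I[of _ _ ?A]) (auto simp: A)
  qed
  then have "AE x in PiM I (\<lambda>_. \<nu>). \<forall>i\<in>I. \<forall>j\<in>I. i \<noteq> j \<longrightarrow> x i \<noteq> x j"
    using I by (auto intro!: AE_finite_allI)
  then show ?thesis by eventually_elim (auto simp: inj_on_def)
qed

definition tie_sum :: "nat \<Rightarrow> ((nat \<Rightarrow> 'w) \<Rightarrow> ennreal) \<Rightarrow> ennreal" where
  "tie_sum n g = (\<Sum>p | partition_on {1..n} p. \<integral>\<^sup>+x. g (from_cells n p x) \<partial>PiM p (\<lambda>_. \<nu>))"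

lemma measurable_from_cells_borel:
  assumes "partition_on {1..n} p" "g \<in> borel_measurable (vec_space n)"
  shows "(\<lambda>x. g (from_cells n p x)) \<in> borel_measurable (PiM p (\<lambda>_. \<nu>))"
proof -
  have "sets (PiM {1..n} (\<lambda>_. \<nu>)) = sets (vec_space n)" by (intro sets_PiM_cong) (auto simp: sets_eq)
  then show ?thesis
    using measurable_compose[OF measurable_from_cells[OF assms(1), of \<nu>], of g borel] assms(2)
    by (simp cong: measurable_cong_sets)
qed

lemma measurable_vec_upd:
  "(\<lambda>(w, y). w(Suc n := y)) \<in> measurable (vec_space n \<Otimes>\<^sub>M borel) (vec_space (Suc n))"
  unfolding split_beta' atLeastAtMostSuc_conv[of 1 n, simplified]
  by (intro measurable_fun_upd[where J="{1..n}"]) auto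

text \<open>The index \<open>Suc n\<close> either joins a cell of a partition of
  \<open>{1..n}\<close> and copies its value, or forms a cell of its own with a fresh value
  integrated against \<nu>. The two summands under \<open>tie_sum n\<close> are these two
  cases.\<close>

lemma tie_sum_Suc:
  assumes g: "g \<in> borel_measurable (vec_space (Suc n))"
  shows "tie_sum (Suc n) g
    = tie_sum n (\<lambda>w. (\<Sum>y\<in>w ` {1..n}. g (w(Suc n := y))) + (\<integral>\<^sup>+y. g (w(Suc n := y)) \<partial>\<nu>))"
proof -
  let ?a = "Suc n"
  define F where "F q = (\<integral>\<^sup>+x. g (from_cells ?a q x) \<partial>PiM q (\<lambda>_. \<nu>))" for q
  have S: "insert ?a {1..n} = {1..Suc n}" by auto
  have "tie_sum ?a g = (\<Sum>q | partition_on (insert ?a {1..n}) q. F q)"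
    unfolding tie_sum_def F_def S ..
  also have "\<dots> = (\<Sum>p | partition_on {1..n} p. F (insert {?a} p) + (\<Sum>C\<in>p. F (insert (insert ?a C) (p - {C}))))"
    by (rule sum_partition_on_insert) auto
  also have "\<dots> = tie_sum n (\<lambda>w. (\<Sum>y\<in>w ` {1..n}. g (w(?a := y))) + (\<integral>\<^sup>+y. g (w(?a := y)) \<partial>\<nu>))"
    unfolding tie_sum_def
  proof (rule sum.cong[OF refl])
    fix p assume "p \<in> {p. partition_on {1..n} p}"
    then have p: "partition_on {1..n} p" by simp
    let ?w = "from_cells n p"
    let ?\<nu> = "PiM p (\<lambda>_. \<nu>)"
    have finp: "finite p" using p finite_elements by blast
    have na: "?a \<notin> C" "C \<noteq> {?a}" "C \<noteq> {}" if "C \<in> p" for C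
    proof -
      have "C \<subseteq> {1..n}" using partition_onD1[OF p] that by blast
      then show "?a \<notin> C" by auto
      then show "C \<noteq> {?a}" by blast
      show "C \<noteq> {}" using p that by (auto simp: partition_on_def)
    qed
    have dis: "C = D" if "C \<in> p" "D \<in> p" "i \<in> C" "i \<in> D" for C D i
      using p that by (auto simp: partition_on_def disjoint_def)
    have Up: "\<Union>p = {1..n}" using p by (simp add: partition_on_def)
    have wm: "?w \<in> measurable ?\<nu> (vec_space n)"
    proof -
      have "sets (PiM {1..n} (\<lambda>_. \<nu>)) = sets (vec_space n)" by (intro sets_PiM_cong) (auto simp: sets_eq)
      then show ?thesis using measurable_from_cells[OF p, of \<nu>] by (simp cong: measurable_cong_sets)
    qed
    have p1: "partition_on {1..Suc n} (insert {?a} p)"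
      unfolding partition_on_def disjoint_def
    proof (intro conjI ballI impI)
      show "\<Union>(insert {?a} p) = {1..Suc n}" unfolding S[symmetric] Union_insert Up by simp
      fix X Y assume "X \<in> insert {?a} p" "Y \<in> insert {?a} p" "X \<noteq> Y"
      then show "X \<inter> Y = {}" using dis na(1) by blast
    next
      show "{} \<notin> insert {?a} p" using na(3) by blast
    qed
    have gw: "(\<lambda>(x, y). g ((?w x)(?a := y))) \<in> borel_measurable (?\<nu> \<Otimes>\<^sub>M \<nu>)"
    proof -
      have "(\<lambda>z. (?w (fst z), snd z)) \<in> measurable (?\<nu> \<Otimes>\<^sub>M \<nu>) (vec_space n \<Otimes>\<^sub>M borel)"
        using measurable_compose[OF measurable_fst wm] by (intro measurable_Pair) (auto cong: measurable_cong_sets simp: sets_eq)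
      from measurable_compose[OF measurable_compose[OF this measurable_vec_upd] g]
      show ?thesis by (simp add: split_beta')
    qed
    have F1: "F (insert {?a} p) = (\<integral>\<^sup>+x. \<integral>\<^sup>+y. g ((?w x)(?a := y)) \<partial>\<nu> \<partial>?\<nu>)"
    proof -
      have "{?a} \<notin> p" using na by blast
      then have "F (insert {?a} p)
          = (\<integral>\<^sup>+x. \<integral>\<^sup>+y. g (from_cells ?a (insert {?a} p) (x({?a} := y))) \<partial>\<nu> \<partial>?\<nu>)"
        unfolding F_def using finp measurable_from_cells_borel[OF p1 g]
        by (intro P.product_nn_integral_insert) auto
      moreover have "from_cells ?a (insert {?a} p) (x({?a} := y)) = (?w x)(?a := y)" for x :: "nat set \<Rightarrow> 'w" and y
      proof (rule from_cells_eqI[OF p1])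
        show "(?w x)(?a := y) \<in> extensional {1..?a}"
          using from_cells_extensional[of n p x] by (auto simp: extensional_def)
        fix C i assume C: "C \<in> insert {?a} p" "i \<in> C"
        show "((?w x)(?a := y)) i = (x({?a} := y)) C"
        proof (cases "C = {?a}")
          case False
          then have "C \<in> p" using C by simp
          then show ?thesis using from_cells_eq[OF p _ C(2), of x] na(1)[of C] C False by auto
        qed (use C in auto)
      qed
      ultimately show ?thesis by simp
    qed
    have F2: "F (insert (insert ?a C) (p - {C})) = (\<integral>\<^sup>+x. g ((?w x)(?a := x C)) \<partial>?\<nu>)" if C: "C \<in> p" for C
    proof -
      let ?q = "insert (insert ?a C) (p - {C})"
      \<comment> \<open>\<open>?f\<close> sends each cell of \<open>?q\<close> to the cell of
        \<open>p\<close> it comes from. The enlarged cell thus inherits the variable of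
        \<open>C\<close>, and both product measures agree after relabelling.\<close>
      let ?f = "\<lambda>D. D - {?a}"
      have q: "partition_on {1..Suc n} ?q"
        unfolding partition_on_def disjoint_def
      proof (intro conjI ballI impI)
        have "\<Union>?q = insert ?a (\<Union>p)" using C by blast
        then show "\<Union>?q = {1..Suc n}" unfolding Up S .
        fix X Y assume "X \<in> ?q" "Y \<in> ?q" "X \<noteq> Y"
        then show "X \<inter> Y = {}" using dis na(1) C by blast
      next
        show "{} \<notin> ?q" using na(3) by blast
      qed
      have fq: "?f D = D" if "D \<in> p" for D using na(1)[OF that] by auto
      have fC: "?f (insert ?a C) = C" using na(1)[OF C] by auto
      have bij: "bij_betw ?f ?q p"
      proof (rule bij_betw_imageI)
        show "inj_on ?f ?q" using fq fC by (auto simp: inj_on_def)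
        show "?f ` ?q = p" using fq fC C by auto
      qed
      have rm: "(\<lambda>x. \<lambda>D\<in>?q. x (?f D)) \<in> measurable ?\<nu> (PiM ?q (\<lambda>_. \<nu>))"
        using bij by (intro measurable_restrict measurable_component_singleton) (auto simp: bij_betw_def)
      have "F ?q = (\<integral>\<^sup>+x. g (from_cells ?a ?q x) \<partial>distr ?\<nu> (PiM ?q (\<lambda>_. \<nu>)) (\<lambda>x. \<lambda>D\<in>?q. x (?f D)))"
        unfolding F_def using finp by (subst distr_PiM_bij_betw[OF _ bij]) auto
      also have "\<dots> = (\<integral>\<^sup>+x. g (from_cells ?a ?q (\<lambda>D\<in>?q. x (?f D))) \<partial>?\<nu>)"
        by (rule nn_integral_distr[OF rm]) (use measurable_from_cells_borel[OF q g] in simp)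
      finally have "F ?q = \<dots>" .
      moreover have "from_cells ?a ?q (\<lambda>D\<in>?q. x (?f D)) = (?w x)(?a := x C)" for x :: "nat set \<Rightarrow> 'w"
      proof (rule from_cells_eqI[OF q])
        show "(?w x)(?a := x C) \<in> extensional {1..?a}"
          using from_cells_extensional[of n p x] by (auto simp: extensional_def)
        fix D i assume D: "D \<in> ?q" "i \<in> D"
        show "((?w x)(?a := x C)) i = (\<lambda>D\<in>?q. x (?f D)) D"
        proof (cases "D = insert ?a C")
          case True
          then show ?thesis using D fC from_cells_eq[OF p C, of i x] by auto
        next
          case False
          then have "D \<in> p" "i \<noteq> ?a" using D na(1) by blast+
          then show ?thesis using from_cells_eq[OF p _ D(2), of x] D(1) fq by simp
        qed
      qed
      ultimately show ?thesis by simp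
    qed
    have m2: "(\<lambda>x. g ((?w x)(?a := x C))) \<in> borel_measurable ?\<nu>" if "C \<in> p" for C
    proof -
      have "(\<lambda>x. (x, x C)) \<in> measurable ?\<nu> (?\<nu> \<Otimes>\<^sub>M \<nu>)"
        using that by (intro measurable_Pair measurable_component_singleton measurable_ident) simp_all
      from measurable_compose[OF this gw] show ?thesis by simp
    qed
    \<comment> \<open>Almost everywhere different cells carry different values, so passing from
      cells to the set of values merges no terms.\<close>
    have ae: "AE x in ?\<nu>. (\<Sum>y\<in>?w x ` {1..n}. g ((?w x)(?a := y))) = (\<Sum>C\<in>p. g ((?w x)(?a := x C)))"
      using AE_PiM_inj_on[OF finp]
      by eventually_elim (simp only: from_cells_image[OF p] sum.reindex o_def)
    have "(\<integral>\<^sup>+x. (\<Sum>y\<in>?w x ` {1..n}. g ((?w x)(?a := y))) + (\<integral>\<^sup>+y. g ((?w x)(?a := y)) \<partial>\<nu>) \<partial>?\<nu>)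
        = (\<integral>\<^sup>+x. (\<Sum>C\<in>p. g ((?w x)(?a := x C))) + (\<integral>\<^sup>+y. g ((?w x)(?a := y)) \<partial>\<nu>) \<partial>?\<nu>)"
      by (rule nn_integral_cong_AE) (use ae in eventually_elim, simp)
    also have "\<dots> = (\<Sum>C\<in>p. \<integral>\<^sup>+x. g ((?w x)(?a := x C)) \<partial>?\<nu>) + (\<integral>\<^sup>+x. \<integral>\<^sup>+y. g ((?w x)(?a := y)) \<partial>\<nu> \<partial>?\<nu>)"
      using m2 borel_measurable_nn_integral[OF gw] by (simp add: nn_integral_add nn_integral_sum)
    finally show "F (insert {?a} p) + (\<Sum>C\<in>p. F (insert (insert ?a C) (p - {C})))
        = (\<integral>\<^sup>+x. (\<Sum>y\<in>?w x ` {1..n}. g ((?w x)(?a := y))) + (\<integral>\<^sup>+y. g ((?w x)(?a := y)) \<partial>\<nu>) \<partial>?\<nu>)"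
      by (simp add: F1 F2 add.commute)
  qed
  finally show ?thesis .
qed

lemma tie_sum_0: "tie_sum 0 g = g (\<lambda>_. undefined)"
  by (simp add: tie_sum_def partition_on_empty from_cells_def P.nn_integral_empty)

end

section \<open>The multivariate Mecke equation\<close>

lemma space_vec_space: "space (vec_space n) = extensional {1..n}"
  by (simp add: space_PiM PiE_UNIV_domain PiE_def Pi_def)

text \<open>Counting each value at its first occurrence makes the index set independent of
  \<open>w\<close>, so measurability in \<open>w\<close> can be checked term by term.\<close>

lemma sum_image_first:
  fixes f :: "'b \<Rightarrow> 'c::comm_monoid_add" and n :: nat
  shows "(\<Sum>x\<in>w ` {1..n}. f x) = (\<Sum>i\<in>{1..n}. if \<exists>j\<in>{1..<i}. w j = w i then 0 else f (w i))"
proof (induction n)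
  case (Suc n)
  have S: "{1..Suc n} = insert (Suc n) {1..n}" by auto
  have "(\<exists>j\<in>{1..<Suc n}. w j = w (Suc n)) \<longleftrightarrow> w (Suc n) \<in> w ` {1..n}"
    unfolding atLeastLessThanSuc_atLeastAtMost by (metis imageE imageI)
  then show ?case using Suc unfolding S by (auto simp: insert_absorb add.commute)
qed simp

lemma space_bf_measures_N_star:
  "m \<in> space bf_measures \<Longrightarrow> N_star n w m \<in> space bf_measures"
  unfolding N_star_def by (intro add_atoms_in_bf_measures) auto

lemma measurable_N_star:
  "(\<lambda>(w, m). N_star n w m) \<in> measurable (vec_space n \<Otimes>\<^sub>M bf_measures) (bf_measures :: 'w::polish_space measure measure)"
proof (rule measurable_bf_measuresI)
  fix p assume "p \<in> space (vec_space n \<Otimes>\<^sub>M bf_measures :: ((nat \<Rightarrow> 'w) \<times> 'w measure) measure)"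
  then show "(\<lambda>(w, m). N_star n w m) p \<in> space bf_measures"
    by (auto simp: space_pair_measure intro!: space_bf_measures_N_star)
next
  fix B :: "'w set" assume B[measurable]: "B \<in> sets borel"
  let ?M = "vec_space n \<Otimes>\<^sub>M bf_measures :: ((nat \<Rightarrow> 'w) \<times> 'w measure) measure"
  have c: "(\<lambda>p. fst p i) \<in> measurable ?M borel" if "i \<in> {1..n}" for i
    using measurable_compose[OF measurable_fst measurable_component_singleton[OF that, of "\<lambda>_. borel"]] .
  have "(\<lambda>p. if \<exists>j\<in>{1..<i}. fst p j = fst p i then 0 else indicator B (fst p i) :: ennreal) \<in> borel_measurable ?M"
    if i: "i \<in> {1..n}" for i
  proof (rule measurable_If)
    show "(\<lambda>p. indicator B (fst p i) :: ennreal) \<in> borel_measurable ?M"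
      by (rule measurable_compose[OF c[OF i] borel_measurable_indicator[OF B]])
    have "{p \<in> space ?M. fst p j = fst p i} \<in> sets ?M" if "j \<in> {1..<i}" for j
      using that i by (intro measurable_equality_set c) auto
    then show "{p \<in> space ?M. \<exists>j\<in>{1..<i}. fst p j = fst p i} \<in> sets ?M"
      by (intro sets.sets_Collect_finite_Ex) auto
  qed simp
  then have "(\<lambda>p. emeasure (snd p) B + (\<Sum>x\<in>fst p ` {1..n}. indicator B x)) \<in> borel_measurable ?M"
    unfolding sum_image_first by measurable
  then show "(\<lambda>p. emeasure ((\<lambda>(w, m). N_star n w m) p) B) \<in> borel_measurable ?M"
    by (rule measurable_cong[THEN iffD1, rotated])
      (auto simp: space_pair_measure N_star_def emeasure_add_atoms space_bf_measuresD(1))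
qed

lemma measurable_N_star1:
  assumes "w \<in> space (vec_space n)"
  shows "N_star n w \<in> measurable bf_measures bf_measures"
  using measurable_Pair2[OF measurable_N_star assms] by simp

text \<open>The point inserted by the Mecke equation plays the role of the new distinct value. It
  must differ from the old ones: otherwise the left side would carry its atom twice and the right
  side once.\<close>

lemma N_star_add_point:
  fixes m :: "'w::polish_space measure"
  assumes m: "sets m = sets borel" and y: "y \<notin> w ` {1..n}"
  shows "N_star n w (add_point m y) = N_star (Suc n) (w(Suc n := y)) m"
proof -
  have im: "(w(Suc n := y)) ` {1..Suc n} = insert y (w ` {1..n})"
    by (auto simp: image_iff le_Suc_eq)
  show ?thesis unfolding N_star_def im
  proof (rule measure_eqI)
    fix A assume "A \<in> sets (add_atoms (add_point m y) (\<lambda>_. 1) (w ` {1..n}))"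
    then have "A \<in> sets borel" by simp
    then show "emeasure (add_atoms (add_point m y) (\<lambda>_. 1) (w ` {1..n})) A
        = emeasure (add_atoms m (\<lambda>_. 1) (insert y (w ` {1..n}))) A"
      using m y by (simp add: emeasure_add_atoms add_ac)
  qed simp
qed

lemma N_star_repeat:
  assumes "y \<in> w ` {1..n}"
  shows "N_star (Suc n) (w(Suc n := y)) m = N_star n w m"
proof -
  have "(w(Suc n := y)) ` {1..Suc n} = insert y (w ` {1..n})"
    by (auto simp: image_iff le_Suc_eq)
  then show ?thesis using assms by (simp add: N_star_def insert_absorb)
qed

lemma N_star_0: "m \<in> space bf_measures \<Longrightarrow> N_star 0 w m = m"
  unfolding N_star_def
  by (rule measure_eqI) (auto simp: emeasure_add_atoms space_bf_measuresD(1))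

text \<open>Grouping the indices by value turns the powers into a product over indices, the form
  from which the factor of the last index can be split off.\<close>

lemma tie_likelihood_eq_prod:
  "tie_likelihood h n w m = (\<Prod>i\<in>{1..n}. ennreal (h (w i) (N_star n w m)))"
proof -
  have "(\<Prod>i\<in>{1..n}. ennreal (h (w i) (N_star n w m)))
      = (\<Prod>x\<in>w ` {1..n}. \<Prod>i\<in>{i\<in>{1..n}. w i = x}. ennreal (h (w i) (N_star n w m)))"
    by (rule prod.image_gen) simp
  also have "\<dots> = tie_likelihood h n w m"
    unfolding tie_likelihood_def tie_cell_def by (intro prod.cong refl) simp
  finally show ?thesis by simp
qed

text \<open>From here on the Poisson law is used only through its Mecke equation, which is therefore
  an assumption of the locale; the final theorem discharges it with
  \<open>poisson_mecke\<close>.\<close>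

locale poisson_mixture =
  nonatomic_measure \<nu> + L: prob_space L
  for \<nu> :: "'w::polish_space measure" and L :: "'w measure measure" +
  fixes h :: "'w \<Rightarrow> 'w measure \<Rightarrow> real"
  assumes sets_L[measurable_cong]: "sets L = sets bf_measures"
    and mecke: "(\<lambda>(x, m). f x m) \<in> borel_measurable (borel \<Otimes>\<^sub>M bf_measures) \<Longrightarrow>
      (\<integral>\<^sup>+m. \<integral>\<^sup>+x. f x m \<partial>m \<partial>L) = (\<integral>\<^sup>+x. \<integral>\<^sup>+m. f x (add_point m x) \<partial>L \<partial>\<nu>)"
    and h: "(\<lambda>(x, m). h x m) \<in> borel_measurable (borel \<Otimes>\<^sub>M bf_measures)"
    and h_prob: "AE m in L. prob_space (h_measure h m)"
begin

abbreviation VS :: "nat \<Rightarrow> (nat \<Rightarrow> 'w) measure" where "VS \<equiv> vec_space"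
abbreviation BF :: "'w measure measure" where "BF \<equiv> bf_measures"

lemma space_L: "space L = space BF"
  using sets_L by (rule sets_eq_imp_space_eq)

lemma measurable_prod_h:
  "(\<lambda>(w, m). \<Prod>i\<in>{1..n}. ennreal (h (w i) m)) \<in> borel_measurable (VS n \<Otimes>\<^sub>M BF)"
  unfolding split_beta'
proof (rule borel_measurable_prod_ennreal)
  fix i assume "i \<in> {1..n}"
  from measurable_component_singleton[OF this, of "\<lambda>_. borel :: 'w measure"]
  have "(\<lambda>p. (fst p i, snd p)) \<in> measurable (VS n \<Otimes>\<^sub>M BF) (borel \<Otimes>\<^sub>M BF)"
    by (intro measurable_Pair measurable_snd) (rule measurable_compose[OF measurable_fst])
  from measurable_compose[OF this h]
  show "(\<lambda>p. ennreal (h (fst p i) (snd p))) \<in> borel_measurable (VS n \<Otimes>\<^sub>M BF)"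
    by simp
qed

lemma measurable_pair_N_star:
  "(\<lambda>(w, m). (w, N_star n w m)) \<in> measurable (VS n \<Otimes>\<^sub>M BF) (VS n \<Otimes>\<^sub>M BF)"
  unfolding split_beta'
  by (intro measurable_Pair measurable_fst) (use measurable_N_star[of n] in \<open>simp add: split_beta'\<close>)

lemma measurable_tie_likelihood:
  "(\<lambda>(w, m). tie_likelihood h n w m) \<in> borel_measurable (VS n \<Otimes>\<^sub>M BF)"
  using measurable_compose[OF measurable_pair_N_star measurable_prod_h]
  by (simp add: tie_likelihood_eq_prod split_beta')

lemma measurable_tie_mean:
  assumes "(\<lambda>(w, m). g w m) \<in> borel_measurable (VS n \<Otimes>\<^sub>M BF)"
  shows "(\<lambda>w. \<integral>\<^sup>+m. tie_likelihood h n w m * g w (N_star n w m) \<partial>L) \<in> borel_measurable (VS n)"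
proof (rule L.borel_measurable_nn_integral)
  have "(\<lambda>p. tie_likelihood h n (fst p) (snd p) * g (fst p) (N_star n (fst p) (snd p)))
      \<in> borel_measurable (VS n \<Otimes>\<^sub>M BF)"
    using measurable_tie_likelihood[of n] measurable_compose[OF measurable_pair_N_star assms]
    by (intro borel_measurable_times_ennreal) (simp_all add: split_beta')
  then show "(\<lambda>(w, m). tie_likelihood h n w m * g w (N_star n w m)) \<in> borel_measurable (VS n \<Otimes>\<^sub>M L)"
    using measurable_cong_sets[OF sets_pair_measure_cong[OF refl sets_L], of "VS n" borel]
    by (simp add: split_beta')
qed

lemma tie_sum_cong:
  "(\<And>w. w \<in> space (VS n) \<Longrightarrow> g w = g' w) \<Longrightarrow> tie_sum n g = tie_sum n g'"
  unfolding tie_sum_def by (intro sum.cong nn_integral_cong refl)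
    (auto simp only: space_vec_space from_cells_extensional)

text \<open>The induction has to range over all \<open>g\<close>: its hypothesis is applied to
  \<open>G\<close>, which contains the integral over the last coordinate and still depends on the
  random measure. Replacing that measure by \<open>N_star n w m\<close> then also changes the
  measure of integration inside \<open>G\<close>, which is where repeated values come from.\<close>

lemma nn_integral_mixture:
  assumes g: "(\<lambda>(w, m). g w m) \<in> borel_measurable (VS n \<Otimes>\<^sub>M BF)"
  shows "(\<integral>\<^sup>+m. \<integral>\<^sup>+w. g w m \<partial>PiM {1..n} (\<lambda>_. h_measure h m) \<partial>L)
    = tie_sum n (\<lambda>w. \<integral>\<^sup>+m. tie_likelihood h n w m * g w (N_star n w m) \<partial>L)"
  using g
proof (induction n arbitrary: g)
  case 0
  have "(\<integral>\<^sup>+m. \<integral>\<^sup>+w. g w m \<partial>PiM {1..0} (\<lambda>_. h_measure h m) \<partial>L) = (\<integral>\<^sup>+m. g (\<lambda>_. undefined) m \<partial>L)"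
    using P.nn_integral_empty by (intro nn_integral_cong) (simp add: PiM_empty nn_integral_count_space_finite)
  also have "\<dots> = (\<integral>\<^sup>+m. tie_likelihood h 0 (\<lambda>_. undefined) m * g (\<lambda>_. undefined) (N_star 0 (\<lambda>_. undefined) m) \<partial>L)"
    by (intro nn_integral_cong) (simp add: N_star_0 space_L tie_likelihood_eq_prod)
  finally show ?case by (simp add: tie_sum_0)
next
  case (Suc n)
  let ?a = "Suc n"
  define H where "H k w m = (\<Prod>i\<in>{1..k}. ennreal (h (w i) m))" for k :: nat and w and m
  define G where "G w m = (\<integral>\<^sup>+y. ennreal (h y m) * g (w(?a := y)) m \<partial>m)" for w m
  define Q where "Q w = (\<integral>\<^sup>+m. tie_likelihood h ?a w m * g w (N_star ?a w m) \<partial>L)" for w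
  have S: "insert ?a {1..n} = {1..?a}" by auto
  have lik: "tie_likelihood h k w m = H k w (N_star k w m)" for k w m
    by (simp add: tie_likelihood_eq_prod H_def)
  have HS: "H ?a (w(?a := y)) m = H n w m * ennreal (h y m)" for w y m
    unfolding H_def S[symmetric] by (simp add: mult.commute)
  have Hm: "(\<lambda>(w, m). H k w m) \<in> borel_measurable (VS k \<Otimes>\<^sub>M BF)" for k
    unfolding H_def by (rule measurable_prod_h)
  have Qm: "Q \<in> borel_measurable (VS ?a)"
    unfolding Q_def by (rule measurable_tie_mean[OF Suc.prems])
  have upd3: "(\<lambda>((w, m), y). (w(?a := y), m))
      \<in> measurable ((VS n \<Otimes>\<^sub>M BF) \<Otimes>\<^sub>M borel) (VS ?a \<Otimes>\<^sub>M BF)"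
  proof -
    have "(\<lambda>p. (fst (fst p), snd p)) \<in> measurable ((VS n \<Otimes>\<^sub>M BF) \<Otimes>\<^sub>M borel) (VS n \<Otimes>\<^sub>M (borel :: 'w measure))"
      by measurable
    from measurable_compose[OF this measurable_vec_upd]
    show ?thesis unfolding split_beta' by (intro measurable_Pair) (auto simp: split_beta')
  qed
  have Gm: "(\<lambda>(w, m). G w m) \<in> borel_measurable (VS n \<Otimes>\<^sub>M BF)"
  proof -
    have "(\<lambda>p. ennreal (h (snd p) (snd (fst p))) * g ((fst (fst p))(?a := snd p)) (snd (fst p)))
        \<in> borel_measurable ((VS n \<Otimes>\<^sub>M BF) \<Otimes>\<^sub>M borel)"
    proof (rule borel_measurable_times_ennreal)
      have "(\<lambda>p. (snd p, snd (fst p))) \<in> measurable ((VS n \<Otimes>\<^sub>M BF) \<Otimes>\<^sub>M (borel :: 'w measure)) (borel \<Otimes>\<^sub>M BF)"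
        by measurable
      from measurable_compose[OF this h]
      show "(\<lambda>p. ennreal (h (snd p) (snd (fst p)))) \<in> borel_measurable ((VS n \<Otimes>\<^sub>M BF) \<Otimes>\<^sub>M borel)"
        by simp
      show "(\<lambda>p. g ((fst (fst p))(?a := snd p)) (snd (fst p))) \<in> borel_measurable ((VS n \<Otimes>\<^sub>M BF) \<Otimes>\<^sub>M borel)"
        using measurable_compose[OF upd3 Suc.prems] by (simp add: split_beta')
    qed
    then have "(\<lambda>p. \<integral>\<^sup>+y. ennreal (h y (snd p)) * g ((fst p)(?a := y)) (snd p) \<partial>snd p)
        \<in> borel_measurable (VS n \<Otimes>\<^sub>M BF)"
      by (intro nn_integral_bf_measures_measurable measurable_snd) (simp add: split_beta')
    then show ?thesis unfolding G_def by (simp add: split_beta')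
  qed
  have "(\<integral>\<^sup>+m. \<integral>\<^sup>+w. g w m \<partial>PiM {1..?a} (\<lambda>_. h_measure h m) \<partial>L)
      = (\<integral>\<^sup>+m. \<integral>\<^sup>+w. G w m \<partial>PiM {1..n} (\<lambda>_. h_measure h m) \<partial>L)"
  \<comment> \<open>Splitting off the last coordinate of the product needs a sigma-finite factor,
    and \<open>h_measure h m\<close> is known to be a probability measure only for almost every
    \<open>m\<close>.\<close>
  proof (rule nn_integral_cong_AE)
    show "AE m in L. (\<integral>\<^sup>+w. g w m \<partial>PiM {1..?a} (\<lambda>_. h_measure h m))
        = (\<integral>\<^sup>+w. G w m \<partial>PiM {1..n} (\<lambda>_. h_measure h m))"
      using h_prob AE_space
    proof eventually_elim
      case (elim m)
      then have m: "m \<in> space BF" by (simp add: space_L)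
      let ?h = "h_measure h m"
      have sh[measurable_cong]: "sets ?h = sets borel" using space_bf_measuresD(1)[OF m] by (simp add: h_measure_def)
      interpret Ph: product_sigma_finite "\<lambda>_. ?h"
        using elim(1) by (intro product_sigma_finite.intro) (auto intro: prob_space_imp_sigma_finite)
      have sP: "sets (PiM I (\<lambda>_. ?h)) = sets (PiM I (\<lambda>_. borel))" for I :: "nat set"
        by (intro sets_PiM_cong) (auto simp: sh)
      have gm: "(\<lambda>w. g w m) \<in> borel_measurable (VS ?a)"
        using measurable_Pair1[OF Suc.prems m] by simp
      then have gm': "(\<lambda>w. g w m) \<in> borel_measurable (PiM (insert ?a {1..n}) (\<lambda>_. ?h))"
        unfolding S using measurable_cong_sets[OF sP refl] by blast
      have "(\<integral>\<^sup>+w. g w m \<partial>PiM {1..?a} (\<lambda>_. ?h)) = (\<integral>\<^sup>+w. \<integral>\<^sup>+y. g (w(?a := y)) m \<partial>?h \<partial>PiM {1..n} (\<lambda>_. ?h))"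
        unfolding S[symmetric] by (rule Ph.product_nn_integral_insert[OF _ _ gm']) auto
      also have "\<dots> = (\<integral>\<^sup>+w. G w m \<partial>PiM {1..n} (\<lambda>_. ?h))"
      proof (intro nn_integral_cong)
        fix w assume "w \<in> space (PiM {1..n} (\<lambda>_. ?h))"
        then have w: "w \<in> space (VS n)" using sets_eq_imp_space_eq[OF sP] by blast
        have "(\<lambda>y. g (w(?a := y)) m) \<in> borel_measurable borel"
          using measurable_compose[OF measurable_Pair2[OF measurable_vec_upd w] gm] by simp
        moreover have "(\<lambda>y. ennreal (h y m)) \<in> borel_measurable borel"
          using measurable_Pair1[OF h m] by simp
        ultimately show "(\<integral>\<^sup>+y. g (w(?a := y)) m \<partial>?h) = G w m"
          unfolding G_def h_measure_def
          by (intro nn_integral_density) (simp_all add: space_bf_measuresD(3)[OF m])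
      qed
      finally show ?case .
    qed
  qed
  also have "\<dots> = tie_sum n (\<lambda>w. \<integral>\<^sup>+m. tie_likelihood h n w m * G w (N_star n w m) \<partial>L)"
    by (rule Suc.IH[OF Gm])
  also have "\<dots> = tie_sum n (\<lambda>w. (\<Sum>y\<in>w ` {1..n}. Q (w(?a := y))) + (\<integral>\<^sup>+y. Q (w(?a := y)) \<partial>\<nu>))"
  proof (rule tie_sum_cong)
    fix w assume w: "w \<in> space (VS n)"
    \<comment> \<open>\<open>K\<close> collects all \<open>Suc n\<close> factors of
      \<open>h\<close>: the first \<open>n\<close> come from the likelihood and the last one from
      \<open>G\<close>, all at the same measure.\<close>
    define K where "K y m = H ?a (w(?a := y)) m * g (w(?a := y)) m" for y m
    have Km: "(\<lambda>(y, m). K y m) \<in> borel_measurable (borel \<Otimes>\<^sub>M BF)"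
    proof -
      have "(\<lambda>p. (w(?a := fst p), snd p)) \<in> measurable (borel \<Otimes>\<^sub>M BF) (VS ?a \<Otimes>\<^sub>M BF)"
        using measurable_compose[OF measurable_fst measurable_Pair2[OF measurable_vec_upd w]]
        by (intro measurable_Pair measurable_snd) simp
      from measurable_compose[OF this Hm] measurable_compose[OF this Suc.prems]
      show ?thesis unfolding K_def split_beta' by (intro borel_measurable_times_ennreal) simp_all
    qed
    have KNm: "(\<lambda>(y, m). K y (N_star n w m)) \<in> borel_measurable (borel \<Otimes>\<^sub>M BF)"
    proof -
      have "(\<lambda>p. (fst p, N_star n w (snd p))) \<in> measurable ((borel :: 'w measure) \<Otimes>\<^sub>M BF) (borel \<Otimes>\<^sub>M BF)"
        by (intro measurable_Pair measurable_fst) (rule measurable_compose[OF measurable_snd measurable_N_star1[OF w]])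
      from measurable_compose[OF this Km] show ?thesis by (simp add: split_beta')
    qed
    have K1: "(\<lambda>y. K y m) \<in> borel_measurable borel" if "m \<in> space BF" for m
      using measurable_Pair1[OF Km that] by simp
    have K2: "(\<lambda>m. K y (N_star n w m)) \<in> borel_measurable L" for y
      using measurable_Pair2[OF KNm, of y] unfolding measurable_cong_sets[OF sets_L refl] by simp
    have QK: "Q (w(?a := y)) = (\<integral>\<^sup>+m. K y (N_star ?a (w(?a := y)) m) \<partial>L)" for y
      by (simp add: Q_def K_def lik)
    have "(\<integral>\<^sup>+m. tie_likelihood h n w m * G w (N_star n w m) \<partial>L)
        = (\<integral>\<^sup>+m. (\<integral>\<^sup>+y. K y (N_star n w m) \<partial>m) + (\<Sum>y\<in>w ` {1..n}. K y (N_star n w m)) \<partial>L)"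
    proof (intro nn_integral_cong)
      fix m assume "m \<in> space L"
      then have m: "m \<in> space BF" by (simp add: space_L)
      let ?N = "N_star n w m"
      have N: "?N \<in> space BF" by (rule space_bf_measures_N_star[OF m])
      have "(\<lambda>y. ennreal (h y ?N) * g (w(?a := y)) ?N) \<in> borel_measurable borel"
      proof (rule borel_measurable_times_ennreal)
        show "(\<lambda>y. ennreal (h y ?N)) \<in> borel_measurable borel" using measurable_Pair1[OF h N] by simp
        show "(\<lambda>y. g (w(?a := y)) ?N) \<in> borel_measurable borel"
          using measurable_compose[OF measurable_Pair2[OF measurable_vec_upd w] measurable_Pair1[OF Suc.prems N]] by simp
      qed
      then have "tie_likelihood h n w m * G w ?N = (\<integral>\<^sup>+y. K y ?N \<partial>?N)"
        unfolding G_def lik K_def HS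
        by (subst nn_integral_cmult[symmetric]) (simp_all add: space_bf_measuresD(3)[OF N] mult.assoc)
      also have "\<dots> = (\<integral>\<^sup>+y. K y ?N \<partial>m) + (\<Sum>y\<in>w ` {1..n}. K y ?N)"
        using nn_integral_add_atoms[OF space_bf_measuresD(1)[OF m] K1[OF N], of "\<lambda>_. 1" "w ` {1..n}"]
        unfolding N_star_def by simp
      finally show "tie_likelihood h n w m * G w ?N = (\<integral>\<^sup>+y. K y ?N \<partial>m) + (\<Sum>y\<in>w ` {1..n}. K y ?N)" .
    qed
    also have "\<dots> = (\<integral>\<^sup>+m. \<integral>\<^sup>+y. K y (N_star n w m) \<partial>m \<partial>L) + (\<Sum>y\<in>w ` {1..n}. \<integral>\<^sup>+m. K y (N_star n w m) \<partial>L)"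
    proof -
      have "(\<lambda>(m, y). K y (N_star n w m)) \<in> borel_measurable (BF \<Otimes>\<^sub>M borel)"
        using measurable_compose[OF measurable_pair_swap' KNm] by (simp add: split_beta')
      then have "(\<lambda>m. \<integral>\<^sup>+y. K y (N_star n w m) \<partial>m) \<in> borel_measurable BF"
        by (intro nn_integral_bf_measures_measurable measurable_ident) simp_all
      then have "(\<lambda>m. \<integral>\<^sup>+y. K y (N_star n w m) \<partial>m) \<in> borel_measurable L"
        using measurable_cong_sets[OF sets_L refl] by blast
      then show ?thesis using K2 by (simp add: nn_integral_add nn_integral_sum)
    qed
    \<comment> \<open>A repeated value adds no atom, so the measure for the longer vector is the one
      already present.\<close>
    also have "(\<Sum>y\<in>w ` {1..n}. \<integral>\<^sup>+m. K y (N_star n w m) \<partial>L) = (\<Sum>y\<in>w ` {1..n}. Q (w(?a := y)))"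
      by (intro sum.cong refl) (simp add: QK N_star_repeat)
    also have "(\<integral>\<^sup>+m. \<integral>\<^sup>+y. K y (N_star n w m) \<partial>m \<partial>L) = (\<integral>\<^sup>+y. \<integral>\<^sup>+m. K y (N_star n w (add_point m y)) \<partial>L \<partial>\<nu>)"
      by (rule mecke[OF KNm])
    also have "\<dots> = (\<integral>\<^sup>+y. Q (w(?a := y)) \<partial>\<nu>)"
    \<comment> \<open>The inserted point turns into a new distinct value of the vector, except for
      the finitely many \<open>y\<close> equal to an old value, which are null.\<close>
    proof (rule nn_integral_cong_AE)
      have "AE y in \<nu>. y \<notin> w ` {1..n}" by (rule AE_notin_finite) simp
      then show "AE y in \<nu>. (\<integral>\<^sup>+m. K y (N_star n w (add_point m y)) \<partial>L) = Q (w(?a := y))"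
      proof eventually_elim
        case (elim y)
        then show ?case
          unfolding QK by (intro nn_integral_cong) (simp add: N_star_add_point space_L space_bf_measuresD(1))
      qed
    qed
    finally show "(\<integral>\<^sup>+m. tie_likelihood h n w m * G w (N_star n w m) \<partial>L)
        = (\<Sum>y\<in>w ` {1..n}. Q (w(?a := y))) + (\<integral>\<^sup>+y. Q (w(?a := y)) \<partial>\<nu>)"
      by (simp only: add.commute)
  qed
  also have "\<dots> = tie_sum ?a Q" by (rule tie_sum_Suc[OF Qm, symmetric])
  finally show ?case unfolding Q_def .
qed

end

section \<open>Conditional laws\<close>

text \<open>Conditional laws are specified on measurable rectangles only; uniqueness of functionals
  extends the identity to all jointly measurable integrands.\<close>

lemma conditional_law_nn_integral:
  assumes \<Omega>: "prob_space \<Omega>" and K: "conditional_law \<Omega> SX X SY Y K"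
    and g: "(\<lambda>(x, y). g x y) \<in> borel_measurable (SX \<Otimes>\<^sub>M SY)"
  shows "(\<integral>\<^sup>+\<omega>. g (X \<omega>) (Y \<omega>) \<partial>\<Omega>) = (\<integral>\<^sup>+x. \<integral>\<^sup>+y. g x y \<partial>K x \<partial>distr \<Omega> SX X)"
proof -
  interpret \<Omega>: prob_space \<Omega> by fact
  have X[measurable]: "X \<in> measurable \<Omega> SX" and Y[measurable]: "Y \<in> measurable \<Omega> SY"
    and sK: "\<And>x. x \<in> space SX \<Longrightarrow> sets (K x) = sets SY"
    and mK[measurable]: "\<And>B. B \<in> sets SY \<Longrightarrow> (\<lambda>x. emeasure (K x) B) \<in> borel_measurable SX"
    and pK: "AE \<omega> in \<Omega>. prob_space (K (X \<omega>))"
    and eK: "\<And>A B. A \<in> sets SX \<Longrightarrow> B \<in> sets SY \<Longrightarrow>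
        emeasure \<Omega> {\<omega>\<in>space \<Omega>. X \<omega> \<in> A \<and> Y \<omega> \<in> B} = (\<integral>\<^sup>+\<omega>. indicator A (X \<omega>) * emeasure (K (X \<omega>)) B \<partial>\<Omega>)"
    using K unfolding conditional_law_def by auto
  let ?D = "distr \<Omega> SX X"
  \<comment> \<open>Off the null set where \<open>K x\<close> has mass different from 1 we substitute the marginal law of \<open>Y\<close>.\<close>
  define K' where "K' x = (if emeasure (K x) (space SY) = 1 then K x else distr \<Omega> SY Y)" for x
  have one: "{x\<in>space SX. emeasure (K x) (space SY) = 1} \<in> sets SX"
    by measurable
  have K'm: "K' \<in> measurable SX (subprob_algebra SY)"
  proof (rule measurable_subprob_algebra)
    fix x assume x: "x \<in> space SX"
    show sK': "sets (K' x) = sets SY" by (simp add: K'_def sK x)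
    have "prob_space (K' x)"
    proof (cases "emeasure (K x) (space SY) = 1")
      case True
      then show ?thesis using sets_eq_imp_space_eq[OF sK[OF x]] by (auto simp: K'_def intro!: prob_spaceI)
    next
      case False
      then show ?thesis by (simp add: K'_def \<Omega>.prob_space_distr)
    qed
    then show "subprob_space (K' x)" by (rule prob_space_imp_subprob_space)
  next
    fix B assume B: "B \<in> sets SY"
    have "(\<lambda>x. if emeasure (K x) (space SY) = 1 then emeasure (K x) B else emeasure (distr \<Omega> SY Y) B)
        \<in> borel_measurable SX"
      using B by (intro measurable_If one mK) auto
    moreover have "(\<lambda>x. emeasure (K' x) B)
        = (\<lambda>x. if emeasure (K x) (space SY) = 1 then emeasure (K x) B else emeasure (distr \<Omega> SY Y) B)"
      by (auto simp: K'_def)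
    ultimately show "(\<lambda>x. emeasure (K' x) B) \<in> borel_measurable SX" by simp
  qed
  have AE1: "AE \<omega> in \<Omega>. K (X \<omega>) = K' (X \<omega>)"
    using pK AE_space
  proof eventually_elim
    case (elim \<omega>)
    then have "X \<omega> \<in> space SX" using measurable_space[OF X] by blast
    then have "space (K (X \<omega>)) = space SY" using sK sets_eq_imp_space_eq by blast
    then show ?case using prob_space.emeasure_space_1[OF elim(1)] by (simp add: K'_def)
  qed
  have AE2: "AE x in ?D. K x = K' x"
  proof -
    \<comment> \<open>Transfer to the law of \<open>X\<close> requires a measurable event. Equality
      of \<open>K x\<close> and \<open>K' x\<close> is not evidently one, but total mass 1 is, and
      it implies this equality.\<close>
    have "AE \<omega> in \<Omega>. emeasure (K (X \<omega>)) (space SY) = 1"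
      using pK AE_space
    proof eventually_elim
      case (elim \<omega>)
      then have "X \<omega> \<in> space SX" using measurable_space[OF X] by blast
      then have "space (K (X \<omega>)) = space SY" using sK sets_eq_imp_space_eq by blast
      then show ?case using prob_space.emeasure_space_1[OF elim(1)] by simp
    qed
    then have "AE x in ?D. emeasure (K x) (space SY) = 1"
      using AE_distr_iff[OF X one] by simp
    then show ?thesis by eventually_elim (simp add: K'_def)
  qed
  define \<Phi> where "\<Phi> f = (\<integral>\<^sup>+\<omega>. f (X \<omega>, Y \<omega>) \<partial>\<Omega>)" for f :: "_ \<Rightarrow> ennreal"
  define \<Psi> where "\<Psi> f = (\<integral>\<^sup>+x. \<integral>\<^sup>+y. f (x, y) \<partial>K' x \<partial>?D)" for f :: "_ \<Rightarrow> ennreal"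
  have \<Phi>: "nn_functional (SX \<Otimes>\<^sub>M SY) \<Phi>"
    unfolding \<Phi>_def by (intro nn_functional_integral) measurable
  have \<Psi>: "nn_functional (SX \<Otimes>\<^sub>M SY) \<Psi>"
    unfolding \<Psi>_def
  proof (rule nn_functional_mixture)
    fix x assume x: "x \<in> space ?D"
    then have s: "sets (K' x) = sets SY" using measurable_space[OF K'm] by (auto simp: space_subprob_algebra)
    show "nn_functional (SX \<Otimes>\<^sub>M SY) (\<lambda>f. \<integral>\<^sup>+y. f (x, y) \<partial>K' x)"
      using x s by (intro nn_functional_integral measurable_Pair measurable_const) (auto intro!: measurable_ident_sets)
  next
    fix f :: "_ \<Rightarrow> ennreal" assume f: "f \<in> borel_measurable (SX \<Otimes>\<^sub>M SY)"
    show "(\<lambda>x. \<integral>\<^sup>+y. f (x, y) \<partial>K' x) \<in> borel_measurable ?D"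
      using nn_integral_measurable_subprob_algebra2[OF _ K'm, of "\<lambda>x y. f (x, y)"] f by simp
  qed
  have "\<Phi> (\<lambda>(x, y). g x y) = \<Psi> (\<lambda>(x, y). g x y)"
  proof (rule nn_functional_eqI[OF \<Phi> \<Psi> Int_stable_pair_measure_generator _ sets_pair_measure[of SX SY, folded space_pair_measure]
        _ _ _ _ g, where A="\<lambda>_. space SX \<times> space SY"])
    show "{a \<times> b |a b. a \<in> sets SX \<and> b \<in> sets SY} \<subseteq> Pow (space (SX \<Otimes>\<^sub>M SY))"
      using pair_measure_closed by (simp add: space_pair_measure)
    show "range (\<lambda>_. space SX \<times> space SY) \<subseteq> {a \<times> b |a b. a \<in> sets SX \<and> b \<in> sets SY}" by auto
    show "(\<Union>i::nat. space SX \<times> space SY) = space (SX \<Otimes>\<^sub>M SY)" by (simp add: space_pair_measure)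
    have "\<Phi> (indicator (space SX \<times> space SY)) \<le> (\<integral>\<^sup>+\<omega>. 1 \<partial>\<Omega>)"
      unfolding \<Phi>_def by (intro nn_integral_mono) (simp add: indicator_def)
    then show "\<Phi> (indicator (space SX \<times> space SY)) \<noteq> \<infinity>" by (auto simp: \<Omega>.emeasure_space_1 top_unique)
    fix Z assume "Z \<in> {a \<times> b |a b. a \<in> sets SX \<and> b \<in> sets SY}"
    then obtain A B where Z: "Z = A \<times> B" and A[measurable]: "A \<in> sets SX" and B[measurable]: "B \<in> sets SY" by auto
    have "\<Phi> (indicator Z) = (\<integral>\<^sup>+\<omega>. indicator {\<omega>\<in>space \<Omega>. X \<omega> \<in> A \<and> Y \<omega> \<in> B} \<omega> \<partial>\<Omega>)"
      unfolding \<Phi>_def Z by (intro nn_integral_cong) (auto simp: indicator_def)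
    also have "\<dots> = emeasure \<Omega> {\<omega>\<in>space \<Omega>. X \<omega> \<in> A \<and> Y \<omega> \<in> B}"
      by (intro nn_integral_indicator) measurable
    also have "\<dots> = (\<integral>\<^sup>+\<omega>. indicator A (X \<omega>) * emeasure (K (X \<omega>)) B \<partial>\<Omega>)" by (rule eK[OF A B])
    also have "\<dots> = (\<integral>\<^sup>+\<omega>. indicator A (X \<omega>) * emeasure (K' (X \<omega>)) B \<partial>\<Omega>)"
      by (rule nn_integral_cong_AE) (use AE1 in eventually_elim, simp)
    also have "\<dots> = (\<integral>\<^sup>+x. indicator A x * emeasure (K' x) B \<partial>?D)"
      using measurable_compose[OF K'm measurable_emeasure_subprob_algebra[OF B]]
      by (subst nn_integral_distr[OF X]) auto
    also have "\<dots> = \<Psi> (indicator Z)"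
      unfolding \<Psi>_def
    proof (intro nn_integral_cong)
      fix x assume "x \<in> space ?D"
      then have s: "sets (K' x) = sets SY" using measurable_space[OF K'm] by (auto simp: space_subprob_algebra)
      have "(\<integral>\<^sup>+y. indicator Z (x, y) \<partial>K' x) = (\<integral>\<^sup>+y. indicator A x * indicator B y \<partial>K' x)"
        by (intro nn_integral_cong) (auto simp: Z indicator_def)
      also have "\<dots> = indicator A x * emeasure (K' x) B"
        by (rule nn_integral_cmult_indicator) (simp add: s)
      finally show "indicator A x * emeasure (K' x) B = (\<integral>\<^sup>+y. indicator Z (x, y) \<partial>K' x)" by simp
    qed
    finally show "\<Phi> (indicator Z) = \<Psi> (indicator Z)" .
  qed
  then have "(\<integral>\<^sup>+\<omega>. g (X \<omega>) (Y \<omega>) \<partial>\<Omega>) = (\<integral>\<^sup>+x. \<integral>\<^sup>+y. g x y \<partial>K' x \<partial>?D)"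
    by (simp add: \<Phi>_def \<Psi>_def)
  also have "\<dots> = (\<integral>\<^sup>+x. \<integral>\<^sup>+y. g x y \<partial>K x \<partial>?D)"
    by (rule nn_integral_cong_AE) (use AE2 in eventually_elim, simp)
  finally show ?thesis .
qed

text \<open>With \<open>T\<close> equal to \<open>h_measure h\<close>, this carries the posterior of
  \<open>N\<close> over to the random probability measure built from it.\<close>

lemma conditional_law_compose:
  assumes K: "conditional_law \<Omega> SX X SY Y K" and T: "T \<in> measurable SY SZ"
    and K': "\<And>x. x \<in> space SX \<Longrightarrow> K' x = distr (K x) SZ T"
  shows "conditional_law \<Omega> SX X SZ (\<lambda>\<omega>. T (Y \<omega>)) K'"
proof -
  have X: "X \<in> measurable \<Omega> SX" and Y: "Y \<in> measurable \<Omega> SY"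
    and sK: "\<And>x. x \<in> space SX \<Longrightarrow> sets (K x) = sets SY"
    and mK: "\<And>B. B \<in> sets SY \<Longrightarrow> (\<lambda>x. emeasure (K x) B) \<in> borel_measurable SX"
    and pK: "AE \<omega> in \<Omega>. prob_space (K (X \<omega>))"
    and eK: "\<And>A B. A \<in> sets SX \<Longrightarrow> B \<in> sets SY \<Longrightarrow>
        emeasure \<Omega> {\<omega>\<in>space \<Omega>. X \<omega> \<in> A \<and> Y \<omega> \<in> B} = (\<integral>\<^sup>+\<omega>. indicator A (X \<omega>) * emeasure (K (X \<omega>)) B \<partial>\<Omega>)"
    using K unfolding conditional_law_def by auto
  have XS: "X \<omega> \<in> space SX" if "\<omega> \<in> space \<Omega>" for \<omega> using measurable_space[OF X that] .
  have TK: "T \<in> measurable (K x) SZ" if "x \<in> space SX" for x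
    using T measurable_cong_sets[OF sK[OF that] refl] by blast
  have em: "emeasure (K' x) B = emeasure (K x) (T -` B \<inter> space SY)" if "x \<in> space SX" "B \<in> sets SZ" for x B
    using that sets_eq_imp_space_eq[OF sK[OF that(1)]] by (simp add: K' emeasure_distr[OF TK])
  have TB: "T -` B \<inter> space SY \<in> sets SY" if "B \<in> sets SZ" for B using T that by (rule measurable_sets)
  show ?thesis
    unfolding conditional_law_def
  proof (intro conjI ballI)
    show "X \<in> measurable \<Omega> SX" by fact
    show "(\<lambda>\<omega>. T (Y \<omega>)) \<in> measurable \<Omega> SZ" using measurable_compose[OF Y T] .
    show "sets (K' x) = sets SZ" if "x \<in> space SX" for x using that by (simp add: K')
    show "(\<lambda>x. emeasure (K' x) B) \<in> borel_measurable SX" if "B \<in> sets SZ" for B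
      using mK[OF TB[OF that]] em[OF _ that] by (simp cong: measurable_cong)
    show "AE \<omega> in \<Omega>. prob_space (K' (X \<omega>))"
      using pK AE_space
      by eventually_elim (simp add: K' XS prob_space.prob_space_distr TK)
    fix A B assume A: "A \<in> sets SX" and B: "B \<in> sets SZ"
    have "{\<omega>\<in>space \<Omega>. X \<omega> \<in> A \<and> T (Y \<omega>) \<in> B} = {\<omega>\<in>space \<Omega>. X \<omega> \<in> A \<and> Y \<omega> \<in> T -` B \<inter> space SY}"
      using measurable_space[OF Y] by auto
    then show "emeasure \<Omega> {\<omega>\<in>space \<Omega>. X \<omega> \<in> A \<and> T (Y \<omega>) \<in> B}
        = (\<integral>\<^sup>+\<omega>. indicator A (X \<omega>) * emeasure (K' (X \<omega>)) B \<partial>\<Omega>)"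
      using eK[OF A TB[OF B]] by (simp add: em[OF XS B] cong: nn_integral_cong)
  qed
qed

section \<open>The weighted random measure\<close>

lemma emeasure_h_measure:
  assumes h: "(\<lambda>(x, m). h x m) \<in> borel_measurable (borel \<Otimes>\<^sub>M bf_measures)"
    and m: "m \<in> space bf_measures" and B: "B \<in> sets borel"
  shows "emeasure (h_measure h m) B = (\<integral>\<^sup>+x. ennreal (h x m) * indicator B x \<partial>m)"
proof -
  have "(\<lambda>x. ennreal (h x m)) \<in> borel_measurable m"
    unfolding space_bf_measuresD(3)[OF m] using measurable_Pair1[OF h m] by simp
  then show ?thesis unfolding h_measure_def using B space_bf_measuresD(1)[OF m] by (subst emeasure_density) auto
qed

text \<open>The target is \<open>borel_measures\<close> because outside the almost sure event of
  normalization \<open>h_measure h m\<close> may be infinite on bounded sets.\<close>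

lemma measurable_h_measure:
  fixes h :: "'w::polish_space \<Rightarrow> 'w measure \<Rightarrow> real"
  assumes h: "(\<lambda>(x, m). h x m) \<in> borel_measurable (borel \<Otimes>\<^sub>M bf_measures)"
  shows "h_measure h \<in> measurable bf_measures borel_measures"
proof (rule measurable_borel_measuresI)
  fix m :: "'w measure" assume "m \<in> space bf_measures"
  then show "sets (h_measure h m) = sets borel" by (simp add: h_measure_def space_bf_measuresD(1))
next
  fix B :: "'w set" assume B: "B \<in> sets borel"
  have a: "(\<lambda>p. ennreal (h (snd p) (fst p))) \<in> borel_measurable ((bf_measures :: 'w measure measure) \<Otimes>\<^sub>M borel)"
    using measurable_compose[OF measurable_pair_swap' h] by (simp add: split_beta')
  have b: "(\<lambda>p. indicator B (snd p) :: ennreal) \<in> borel_measurable ((bf_measures :: 'w measure measure) \<Otimes>\<^sub>M borel)"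
    by (rule measurable_compose[OF measurable_snd borel_measurable_indicator[OF B]])
  have "(\<lambda>(m, x). ennreal (h x m) * indicator B x) \<in> borel_measurable ((bf_measures :: 'w measure measure) \<Otimes>\<^sub>M borel)"
    unfolding split_beta' by (rule borel_measurable_times_ennreal[OF a b])
  then have "(\<lambda>m. \<integral>\<^sup>+x. ennreal (h x m) * indicator B x \<partial>m) \<in> borel_measurable bf_measures"
    by (intro nn_integral_bf_measures_measurable) simp_all
  then show "(\<lambda>m. emeasure (h_measure h m) B) \<in> borel_measurable bf_measures"
    by (rule measurable_cong[THEN iffD1, rotated]) (simp add: emeasure_h_measure[OF h _ B])
qed

lemma h_measure_N_star:
  fixes h :: "'w::polish_space \<Rightarrow> 'w measure \<Rightarrow> real"
  assumes h: "(\<lambda>(x, m). h x m) \<in> borel_measurable (borel \<Otimes>\<^sub>M bf_measures)"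
    and m: "m \<in> space bf_measures"
  shows "h_measure h (N_star n w m) =
    add_atoms (density m (\<lambda>x. ennreal (h x (N_star n w m)))) (\<lambda>x. ennreal (h x (N_star n w m))) (w ` {1..n})"
proof (rule measure_eqI)
  let ?N = "N_star n w m"
  have N: "?N \<in> space bf_measures" by (rule space_bf_measures_N_star[OF m])
  have hN: "(\<lambda>x. ennreal (h x ?N)) \<in> borel_measurable borel" using measurable_Pair1[OF h N] by simp
  show "sets (h_measure h ?N) = sets (add_atoms (density m (\<lambda>x. ennreal (h x ?N))) (\<lambda>x. ennreal (h x ?N)) (w ` {1..n}))"
    using space_bf_measuresD(1)[OF N] by (simp add: h_measure_def)
  fix B assume "B \<in> sets (h_measure h ?N)"
  then have B: "B \<in> sets borel" using space_bf_measuresD(1)[OF N] by (simp add: h_measure_def)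
  have "emeasure (h_measure h ?N) B = (\<integral>\<^sup>+x. ennreal (h x ?N) * indicator B x \<partial>add_atoms m (\<lambda>_. 1) (w ` {1..n}))"
    using emeasure_h_measure[OF h N B] by (simp add: N_star_def)
  also have "\<dots> = (\<integral>\<^sup>+x. ennreal (h x ?N) * indicator B x \<partial>m) + (\<Sum>x\<in>w ` {1..n}. 1 * (ennreal (h x ?N) * indicator B x))"
    using hN B by (intro nn_integral_add_atoms space_bf_measuresD(1)[OF m] borel_measurable_times_ennreal) auto
  also have "(\<integral>\<^sup>+x. ennreal (h x ?N) * indicator B x \<partial>m) = emeasure (density m (\<lambda>x. ennreal (h x ?N))) B"
    using hN B space_bf_measuresD[OF m] by (subst emeasure_density) auto
  finally show "emeasure (h_measure h ?N) B
      = emeasure (add_atoms (density m (\<lambda>x. ennreal (h x ?N))) (\<lambda>x. ennreal (h x ?N)) (w ` {1..n})) B"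
    using B space_bf_measuresD(1)[OF m] by (simp add: emeasure_add_atoms)
qed

section \<open>The tie partition of a vector\<close>

lemma tie_cell_from_cells:
  assumes p: "partition_on {1..n} p" and x: "inj_on x p" and C: "C \<in> p"
  shows "tie_cell n (from_cells n p x) (x C) = C"
proof (intro equalityI subsetI)
  fix i assume "i \<in> tie_cell n (from_cells n p x) (x C)"
  then have i: "i \<in> {1..n}" "from_cells n p x i = x C" by (auto simp: tie_cell_def)
  then obtain D where D: "D \<in> p" "i \<in> D" using partition_onD1[OF p] by (metis UnionE)
  then have "x D = x C" using i(2) from_cells_eq[OF p D, of x] by simp
  then show "i \<in> C" using D C inj_onD[OF x] by blast
next
  fix i assume i: "i \<in> C"
  then have "i \<in> {1..n}" using partition_onD1[OF p] C by (metis UnionI)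
  then show "i \<in> tie_cell n (from_cells n p x) (x C)"
    using from_cells_eq[OF p C i] by (simp add: tie_cell_def)
qed

lemma tie_partition_from_cells:
  assumes p: "partition_on {1..n} p" and x: "inj_on x p"
  shows "tie_partition n (from_cells n p x) = p"
proof -
  have "tie_partition n (from_cells n p x) = (\<lambda>C. tie_cell n (from_cells n p x) (x C)) ` p"
    unfolding tie_partition_def from_cells_image[OF p] by (simp add: image_image)
  also have "\<dots> = (\<lambda>C. C) ` p" using tie_cell_from_cells[OF p x] by (intro image_cong) auto
  finally show ?thesis by simp
qed

text \<open>The partition is a function \<open>F\<close> of the relation of equal coordinates, of
  which there are finitely many. Fixing this relation is a finite conjunction of equalities of
  coordinates and their negations.\<close>

lemma sets_tie_partition:
  "{w \<in> space (vec_space n :: (nat \<Rightarrow> 'w::polish_space) measure). tie_partition n w = p} \<in> sets (vec_space n)"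
proof -
  let ?I = "{1..n}" and ?M = "vec_space n :: (nat \<Rightarrow> 'w) measure"
  define F where "F R = (\<lambda>i. {k\<in>?I. (k, i) \<in> R}) ` ?I" for R :: "(nat \<times> nat) set"
  let ?R = "\<lambda>w. {(i, j). i \<in> ?I \<and> j \<in> ?I \<and> w i = w j}"
  have tp: "tie_partition n w = F (?R w)" for w :: "nat \<Rightarrow> 'w"
    unfolding tie_partition_def F_def tie_cell_def image_image by (intro image_cong) auto
  have c: "(\<lambda>w. w i) \<in> measurable ?M borel" if "i \<in> ?I" for i
    using measurable_component_singleton[OF that, of "\<lambda>_. borel"] .
  have "{w \<in> space ?M. (w i = w j) = ((i, j) \<in> R)} \<in> sets ?M" if "i \<in> ?I" "j \<in> ?I" for i j R
  proof -
    have "{w \<in> space ?M. w i = w j} \<in> sets ?M" using c that by (intro measurable_equality_set) auto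
    then show ?thesis by (cases "(i, j) \<in> R") (auto intro: sets.sets_Collect_neg)
  qed
  then have m: "{w \<in> space ?M. \<forall>i\<in>?I. \<forall>j\<in>?I. (w i = w j) = ((i, j) \<in> R)} \<in> sets ?M" for R
    by (intro sets.sets_Collect_finite_All) auto
  have "{w \<in> space ?M. tie_partition n w = p}
      = (\<Union>R\<in>{R \<in> Pow (?I \<times> ?I). F R = p}. {w \<in> space ?M. \<forall>i\<in>?I. \<forall>j\<in>?I. (w i = w j) = ((i, j) \<in> R)})"
  proof (intro equalityI subsetI)
    fix w assume "w \<in> {w \<in> space ?M. tie_partition n w = p}"
    then show "w \<in> (\<Union>R\<in>{R \<in> Pow (?I \<times> ?I). F R = p}. {w \<in> space ?M. \<forall>i\<in>?I. \<forall>j\<in>?I. (w i = w j) = ((i, j) \<in> R)})"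
      by (intro UN_I[of "?R w"]) (auto simp: tp)
  next
    fix w assume "w \<in> (\<Union>R\<in>{R \<in> Pow (?I \<times> ?I). F R = p}. {w \<in> space ?M. \<forall>i\<in>?I. \<forall>j\<in>?I. (w i = w j) = ((i, j) \<in> R)})"
    then obtain R where R: "R \<subseteq> ?I \<times> ?I" "F R = p" "w \<in> space ?M" "\<forall>i\<in>?I. \<forall>j\<in>?I. (w i = w j) = ((i, j) \<in> R)"
      by auto
    then have "?R w = R" by auto
    then show "w \<in> {w \<in> space ?M. tie_partition n w = p}" using R by (simp add: tp)
  qed
  also have "\<dots> \<in> sets ?M" using m by (intro sets.finite_UN) auto
  finally show ?thesis .
qed

section \<open>Posterior, marginal law and EPPF\<close>

text \<open>Equal sizes give some bijection; it is corrected by a permutation of \<open>A\<close>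
  that matches the values.\<close>

lemma image_mset_mset_set_eq_bij_betw:
  assumes A: "finite A" and B: "finite B"
    and eq: "image_mset f (mset_set A) = image_mset g (mset_set B)"
  obtains \<sigma> where "bij_betw \<sigma> A B" "\<And>x. x \<in> A \<Longrightarrow> g (\<sigma> x) = f x"
proof -
  have "card A = card B" using arg_cong[OF eq, of size] A B by simp
  then obtain \<tau> where \<tau>: "bij_betw \<tau> A B" using finite_same_card_bij A B by blast
  have "image_mset \<tau> (mset_set A) = mset_set B"
    using \<tau> image_mset_mset_set[of \<tau> A] by (simp add: bij_betw_def)
  then have "image_mset f (mset_set A) = image_mset (g \<circ> \<tau>) (mset_set A)"
    using eq by (metis multiset.map_comp)
  from image_mset_eq_implies_permutes[OF A this]
  obtain \<pi> where \<pi>: "\<pi> permutes A" "\<forall>x\<in>A. f x = (g \<circ> \<tau>) (\<pi> x)" by blast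
  have "bij_betw (\<tau> \<circ> \<pi>) A B" using bij_betw_trans[OF permutes_imp_bij[OF \<pi>(1)] \<tau>] .
  then show thesis using \<pi>(2) that by auto
qed

text \<open>The value of \<open>psi\<close> depends on a vector only through its distinct values and
  their multiplicities, and these coincide for the two vectors. Injectivity of \<open>x\<close>
  keeps the multiplicities equal to cell sizes.\<close>

lemma psi_from_cells_bij_betw:
  assumes p: "partition_on {1..n} p" and q: "partition_on {1..n} q"
    and \<sigma>: "bij_betw \<sigma> p q" "\<And>C. C \<in> p \<Longrightarrow> card (\<sigma> C) = card C"
    and x: "inj_on x q"
  shows "psi L h n (from_cells n p (\<lambda>C\<in>p. x (\<sigma> C))) = psi L h n (from_cells n q x)"
proof -
  let ?x = "\<lambda>C\<in>p. x (\<sigma> C)"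
  let ?v = "from_cells n p ?x" and ?w = "from_cells n q x"
  have "inj_on (x \<circ> \<sigma>) p" using x \<sigma>(1) by (intro comp_inj_on) (auto simp: bij_betw_def)
  then have inj: "inj_on ?x p" by (rule inj_on_cong[THEN iffD1, rotated]) simp
  have im: "?v ` {1..n} = ?w ` {1..n}"
    unfolding from_cells_image[OF p] from_cells_image[OF q] using \<sigma>(1) by (auto simp: bij_betw_def)
  have N: "N_star n ?v = N_star n ?w" by (rule ext) (simp only: N_star_def im)
  have "card (tie_cell n ?v y) = card (tie_cell n ?w y)" if "y \<in> ?w ` {1..n}" for y
  proof -
    from that obtain C where C: "C \<in> p" "y = ?x C" using im from_cells_image[OF p, of ?x] by (metis imageE)
    then have \<sigma>C: "\<sigma> C \<in> q" "y = x (\<sigma> C)" using \<sigma>(1) by (auto simp: bij_betw_def)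
    have "tie_cell n ?v y = C" unfolding C(2) by (rule tie_cell_from_cells[OF p inj C(1)])
    moreover have "tie_cell n ?w y = \<sigma> C" unfolding \<sigma>C(2) by (rule tie_cell_from_cells[OF q x \<sigma>C(1)])
    ultimately show ?thesis using \<sigma>(2)[OF C(1)] by simp
  qed
  then have "tie_likelihood h n ?v = tie_likelihood h n ?w"
    unfolding tie_likelihood_def im N by (intro ext prod.cong refl) simp
  then show ?thesis by (simp add: psi_def)
qed

section \<open>The conditionally i.i.d. sample\<close>

locale conditionally_iid_sample =
  poisson_mixture \<nu> L h + \<Omega>: prob_space \<Omega>
  for \<Omega> :: "'a measure" and \<nu> :: "'w::polish_space measure" and L :: "'w measure measure"
    and h :: "'w \<Rightarrow> 'w measure \<Rightarrow> real" +
  fixes N :: "'a \<Rightarrow> 'w measure" and n :: nat and W :: "'a \<Rightarrow> nat \<Rightarrow> 'w"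
  assumes L_eq: "L = distr \<Omega> bf_measures N"
    and h_pos: "m \<in> space bf_measures \<Longrightarrow> 0 < h x m"
    and W_iid: "conditional_law \<Omega> bf_measures N (vec_space n) W (\<lambda>m. PiM {1..n} (\<lambda>_. h_measure h m))"
begin

abbreviation lik :: "(nat \<Rightarrow> 'w) \<Rightarrow> 'w measure \<Rightarrow> ennreal" where "lik \<equiv> tie_likelihood h n"

lemma measurable_N: "N \<in> measurable \<Omega> BF" and measurable_W: "W \<in> measurable \<Omega> (VS n)"
  using W_iid by (simp_all add: conditional_law_def)

lemma nn_integral_sample:
  assumes g: "(\<lambda>(w, m). g w m) \<in> borel_measurable (VS n \<Otimes>\<^sub>M BF)"
  shows "(\<integral>\<^sup>+\<omega>. g (W \<omega>) (N \<omega>) \<partial>\<Omega>) = tie_sum n (\<lambda>w. \<integral>\<^sup>+m. lik w m * g w (N_star n w m) \<partial>L)"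
proof -
  have "(\<lambda>(m, w). g w m) \<in> borel_measurable (BF \<Otimes>\<^sub>M VS n)"
    using measurable_compose[OF measurable_pair_swap' g] by (simp add: split_beta')
  from conditional_law_nn_integral[OF \<Omega>.prob_space_axioms W_iid this]
  show ?thesis using nn_integral_mixture[OF g] by (simp add: L_eq)
qed

lemma measurable_lik: "w \<in> space (VS n) \<Longrightarrow> lik w \<in> borel_measurable L"
  using measurable_Pair2[OF measurable_tie_likelihood] measurable_cong_sets[OF sets_L refl] by fastforce

lemma measurable_psi: "psi L h n \<in> borel_measurable (VS n)"
  using measurable_tie_mean[of "\<lambda>_ _. 1" n] by (simp add: psi_def[abs_def])

lemma nn_integral_W:
  assumes g: "g \<in> borel_measurable (VS n)"
  shows "(\<integral>\<^sup>+\<omega>. g (W \<omega>) \<partial>\<Omega>) = tie_sum n (\<lambda>w. g w * psi L h n w)"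
proof -
  have "(\<lambda>(w, m). g w) \<in> borel_measurable (VS n \<Otimes>\<^sub>M BF)"
    using measurable_compose[OF measurable_fst g] by (simp add: split_beta')
  from nn_integral_sample[OF this]
  have "(\<integral>\<^sup>+\<omega>. g (W \<omega>) \<partial>\<Omega>) = tie_sum n (\<lambda>w. \<integral>\<^sup>+m. lik w m * g w \<partial>L)" .
  also have "\<dots> = tie_sum n (\<lambda>w. g w * psi L h n w)"
  proof (rule tie_sum_cong)
    fix w assume w: "w \<in> space (VS n)"
    show "(\<integral>\<^sup>+m. lik w m * g w \<partial>L) = g w * psi L h n w"
      unfolding psi_def nn_integral_multc[OF measurable_lik[OF w]] by (rule mult.commute)
  qed
  finally show ?thesis .
qed

text \<open>Strict positivity of \<open>h\<close> makes the likelihood positive at every measure,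
  and such a function cannot integrate to 0 under a probability measure.\<close>

lemma psi_pos:
  assumes w: "w \<in> space (VS n)"
  shows "psi L h n w \<noteq> 0"
proof
  assume "psi L h n w = 0"
  then have "AE m in L. lik w m = 0"
    unfolding psi_def using nn_integral_0_iff_AE[OF measurable_lik[OF w]] by simp
  then have "AE m in L. False"
    using AE_space
  proof eventually_elim
    case (elim m)
    have "N_star n w m \<in> space BF" using elim(2) by (intro space_bf_measures_N_star) (simp add: space_L)
    then have "0 < h (w i) (N_star n w m)" for i by (rule h_pos)
    then have "lik w m \<noteq> 0" by (simp add: tie_likelihood_eq_prod ennreal_eq_0_iff not_le)
    then show ?case using elim(1) by simp
  qed
  then show False by simp
qed

text \<open>The integral for \<open>p\<close> is one summand of
  \<open>tie_sum n (psi L h n)\<close>, which is the total mass 1 of the law of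
  \<open>W\<close>.\<close>

lemma AE_psi_finite:
  assumes p: "partition_on {1..n} p"
  shows "AE x in PiM p (\<lambda>_. \<nu>). psi L h n (from_cells n p x) \<noteq> \<infinity>"
proof (rule nn_integral_PInf_AE)
  show "(\<lambda>x. psi L h n (from_cells n p x)) \<in> borel_measurable (PiM p (\<lambda>_. \<nu>))"
    by (rule measurable_from_cells_borel[OF p measurable_psi])
  have "(\<integral>\<^sup>+x. psi L h n (from_cells n p x) \<partial>PiM p (\<lambda>_. \<nu>)) \<le> tie_sum n (psi L h n)"
    unfolding tie_sum_def using p finitely_many_partition_on[of "{1..n}"]
    by (intro member_le_sum) auto
  also have "\<dots> = 1" using nn_integral_W[of "\<lambda>_. 1"] by (simp add: \<Omega>.emeasure_space_1)
  finally show "(\<integral>\<^sup>+x. psi L h n (from_cells n p x) \<partial>PiM p (\<lambda>_. \<nu>)) \<noteq> \<infinity>" by (auto simp: top_unique)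
qed

lemma tie_sum_cong_finite:
  assumes "\<And>w. w \<in> space (VS n) \<Longrightarrow> psi L h n w \<noteq> \<infinity> \<Longrightarrow> g w = g' w"
  shows "tie_sum n g = tie_sum n g'"
  unfolding tie_sum_def
proof (intro sum.cong refl nn_integral_cong_AE)
  fix p assume "p \<in> {p. partition_on {1..n} p}"
  then have "AE x in PiM p (\<lambda>_. \<nu>). psi L h n (from_cells n p x) \<noteq> \<infinity>" using AE_psi_finite by blast
  then show "AE x in PiM p (\<lambda>_. \<nu>). g (from_cells n p x) = g' (from_cells n p x)"
  proof eventually_elim
    case (elim x)
    show ?case by (rule assms[OF _ elim]) (simp only: space_vec_space from_cells_extensional)
  qed
qed

text \<open>The indicator of infinite \<open>psi\<close> vanishes almost everywhere in every
  partition term, so its integral under the law of \<open>W\<close> is 0, even after multiplication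
  by the density \<open>psi\<close>.\<close>

lemma AE_psi_W_finite: "AE \<omega> in \<Omega>. psi L h n (W \<omega>) \<noteq> \<infinity>"
proof -
  let ?g = "\<lambda>w. indicator {w \<in> space (VS n). psi L h n w = \<infinity>} w :: ennreal"
  have g: "?g \<in> borel_measurable (VS n)" using measurable_psi by measurable
  have "(\<integral>\<^sup>+\<omega>. ?g (W \<omega>) \<partial>\<Omega>) = tie_sum n (\<lambda>w. ?g w * psi L h n w)" by (rule nn_integral_W[OF g])
  also have "\<dots> = tie_sum n (\<lambda>w. 0)" by (rule tie_sum_cong_finite) auto
  also have "\<dots> = 0" by (simp add: tie_sum_def)
  finally have "AE \<omega> in \<Omega>. ?g (W \<omega>) = 0"
    using nn_integral_0_iff_AE[OF measurable_compose[OF measurable_W g]] by simp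
  then show ?thesis using AE_space
    by eventually_elim (use measurable_space[OF measurable_W] in \<open>auto simp: indicator_def split: if_splits\<close>)
qed

text \<open>\<open>pi_star\<close> governs the part of the measure left after removing the sampled
  atoms; the image under \<open>N_star n w\<close> puts these atoms back.\<close>

definition posterior :: "(nat \<Rightarrow> 'w) \<Rightarrow> 'w measure measure" where
  "posterior w = distr (pi_star L h n w) bf_measures (N_star n w)"

lemma measurable_N_star_pi_star:
  assumes "w \<in> space (VS n)"
  shows "N_star n w \<in> measurable (pi_star L h n w) BF"
  using measurable_N_star1[OF assms] measurable_cong_sets[of "pi_star L h n w" BF BF BF] sets_L
  by (simp add: pi_star_def)

lemma emeasure_posterior:
  assumes w: "w \<in> space (VS n)" and B: "B \<in> sets BF"
  shows "emeasure (posterior w) B = inverse (psi L h n w) * (\<integral>\<^sup>+m. lik w m * indicator B (N_star n w m) \<partial>L)"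
proof -
  have Nm: "N_star n w \<in> measurable L BF"
    using measurable_N_star1[OF w] measurable_cong_sets[OF sets_L refl] by blast
  have lm: "lik w \<in> borel_measurable L" by (rule measurable_lik[OF w])
  have "emeasure (posterior w) B = emeasure (pi_star L h n w) (N_star n w -` B \<inter> space L)"
    unfolding posterior_def by (subst emeasure_distr[OF measurable_N_star_pi_star[OF w] B]) (simp add: pi_star_def)
  also have "\<dots> = (\<integral>\<^sup>+m. inverse (psi L h n w) * lik w m * indicator (N_star n w -` B \<inter> space L) m \<partial>L)"
    unfolding pi_star_def
    by (rule emeasure_density) (use lm measurable_sets[OF Nm B] in auto)
  also have "\<dots> = (\<integral>\<^sup>+m. inverse (psi L h n w) * (lik w m * indicator B (N_star n w m)) \<partial>L)"
    by (intro nn_integral_cong) (auto simp: indicator_def mult.assoc)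
  also have "\<dots> = inverse (psi L h n w) * (\<integral>\<^sup>+m. lik w m * indicator B (N_star n w m) \<partial>L)"
    by (intro nn_integral_cmult borel_measurable_times_ennreal lm measurable_compose[OF Nm borel_measurable_indicator[OF B]])
  finally show ?thesis .
qed

lemma measurable_posterior_mean:
  assumes B: "B \<in> sets BF"
  shows "(\<lambda>w. \<integral>\<^sup>+m. lik w m * indicator B (N_star n w m) \<partial>L) \<in> borel_measurable (VS n)"
  using measurable_compose[OF measurable_snd borel_measurable_indicator[OF B], of "VS n"]
  by (intro measurable_tie_mean[of "\<lambda>_. indicator B"]) (simp add: split_beta')

lemma inverse_psi_mult:
  assumes "w \<in> space (VS n)" "psi L h n w \<noteq> \<infinity>"
  shows "inverse (psi L h n w) * psi L h n w = 1"
  using ennreal_divide_self[OF psi_pos[OF assms(1)]] assms(2)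
  by (simp add: divide_ennreal_def mult.commute less_top)

text \<open>Bayes' formula: the joint law has the unnormalized integral \<open>?J\<close> where the
  marginal law has \<open>psi\<close>. Since \<open>psi\<close> is nonzero and finite almost
  everywhere, the posterior mass times \<open>psi\<close> returns \<open>?J\<close>.\<close>

lemma conditional_law_posterior: "conditional_law \<Omega> (VS n) W BF N posterior"
  unfolding conditional_law_def
proof (intro conjI ballI measurable_N measurable_W)
  show "sets (posterior w) = sets BF" for w by (simp add: posterior_def)
  show pm: "(\<lambda>w. emeasure (posterior w) B) \<in> borel_measurable (VS n)" if B: "B \<in> sets BF" for B
  proof -
    have "(\<lambda>w. inverse (psi L h n w) * (\<integral>\<^sup>+m. lik w m * indicator B (N_star n w m) \<partial>L)) \<in> borel_measurable (VS n)"
      using measurable_psi measurable_posterior_mean[OF B] by measurable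
    then show ?thesis by (rule measurable_cong[THEN iffD1, rotated]) (simp add: emeasure_posterior[OF _ B])
  qed
  show "AE \<omega> in \<Omega>. prob_space (posterior (W \<omega>))"
    using AE_psi_W_finite AE_space
  proof eventually_elim
    case (elim \<omega>)
    then have w: "W \<omega> \<in> space (VS n)" using measurable_space[OF measurable_W] by blast
    have "(\<integral>\<^sup>+m. lik (W \<omega>) m * indicator (space BF) (N_star n (W \<omega>) m) \<partial>L) = psi L h n (W \<omega>)"
      unfolding psi_def by (intro nn_integral_cong) (simp add: space_L space_bf_measures_N_star)
    then have "emeasure (posterior (W \<omega>)) (space BF) = 1"
      using inverse_psi_mult[OF w elim(1)] by (simp add: emeasure_posterior[OF w])
    then show ?case by (intro prob_spaceI) (simp add: posterior_def)
  qed
  fix A B assume A: "A \<in> sets (VS n)" and B: "B \<in> sets BF"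
  let ?J = "\<lambda>w. \<integral>\<^sup>+m. lik w m * indicator B (N_star n w m) \<partial>L"
  have AB: "(\<lambda>(w, m). indicator A w * indicator B m :: ennreal) \<in> borel_measurable (VS n \<Otimes>\<^sub>M BF)"
    unfolding split_beta'
    by (intro borel_measurable_times_ennreal measurable_compose[OF measurable_fst borel_measurable_indicator[OF A]]
        measurable_compose[OF measurable_snd borel_measurable_indicator[OF B]])
  have set: "{\<omega>\<in>space \<Omega>. W \<omega> \<in> A \<and> N \<omega> \<in> B} \<in> sets \<Omega>"
    using measurable_sets[OF measurable_W A] measurable_sets[OF measurable_N B]
    by (auto simp: Int_def vimage_def conj_commute intro: sets.sets_Collect_conj)
  have "emeasure \<Omega> {\<omega>\<in>space \<Omega>. W \<omega> \<in> A \<and> N \<omega> \<in> B} = (\<integral>\<^sup>+\<omega>. indicator {\<omega>\<in>space \<Omega>. W \<omega> \<in> A \<and> N \<omega> \<in> B} \<omega> \<partial>\<Omega>)"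
    using set by simp
  also have "\<dots> = (\<integral>\<^sup>+\<omega>. indicator A (W \<omega>) * indicator B (N \<omega>) \<partial>\<Omega>)"
    by (intro nn_integral_cong) (auto simp: indicator_def)
  also have "\<dots> = tie_sum n (\<lambda>w. \<integral>\<^sup>+m. lik w m * (indicator A w * indicator B (N_star n w m)) \<partial>L)"
    by (rule nn_integral_sample[OF AB])
  also have "\<dots> = tie_sum n (\<lambda>w. (indicator A w * emeasure (posterior w) B) * psi L h n w)"
  proof (rule tie_sum_cong_finite)
    fix w assume w: "w \<in> space (VS n)" "psi L h n w \<noteq> \<infinity>"
    have Nm: "N_star n w \<in> measurable L BF"
      using measurable_N_star1[OF w(1)] measurable_cong_sets[OF sets_L refl] by blast
    have "(\<integral>\<^sup>+m. lik w m * (indicator A w * indicator B (N_star n w m)) \<partial>L)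
        = (\<integral>\<^sup>+m. indicator A w * (lik w m * indicator B (N_star n w m)) \<partial>L)"
      by (simp add: mult_ac)
    also have "\<dots> = indicator A w * ?J w"
      by (intro nn_integral_cmult borel_measurable_times_ennreal measurable_lik[OF w(1)]
          measurable_compose[OF Nm borel_measurable_indicator[OF B]])
    also have "\<dots> = indicator A w * ((inverse (psi L h n w) * psi L h n w) * ?J w)"
      by (simp add: inverse_psi_mult[OF w])
    finally show "(\<integral>\<^sup>+m. lik w m * (indicator A w * indicator B (N_star n w m)) \<partial>L)
        = (indicator A w * emeasure (posterior w) B) * psi L h n w"
      by (simp add: emeasure_posterior[OF w(1) B] mult_ac)
  qed
  also have "\<dots> = (\<integral>\<^sup>+\<omega>. indicator A (W \<omega>) * emeasure (posterior (W \<omega>)) B \<partial>\<Omega>)"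
    by (intro nn_integral_W[symmetric] borel_measurable_times_ennreal borel_measurable_indicator A pm[OF B])
  finally show "emeasure \<Omega> {\<omega>\<in>space \<Omega>. W \<omega> \<in> A \<and> N \<omega> \<in> B}
      = (\<integral>\<^sup>+\<omega>. indicator A (W \<omega>) * emeasure (posterior (W \<omega>)) B \<partial>\<Omega>)" .
qed

lemma conditional_law_posterior_h_measure:
  "conditional_law \<Omega> (VS n) W borel_measures (\<lambda>\<omega>. h_measure h (N \<omega>))
     (\<lambda>w. distr (pi_star L h n w) borel_measures (\<lambda>m. h_measure h (N_star n w m)))"
proof (rule conditional_law_compose[OF conditional_law_posterior measurable_h_measure[OF h]])
  fix w assume w: "w \<in> space (VS n)"
  show "distr (pi_star L h n w) borel_measures (\<lambda>m. h_measure h (N_star n w m))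
      = distr (posterior w) borel_measures (h_measure h)"
    unfolding posterior_def
    by (subst distr_distr[OF measurable_h_measure[OF h] measurable_N_star_pi_star[OF w]]) (simp add: o_def)
qed

lemma prob_space_h_measure_iff:
  assumes "m \<in> space BF"
  shows "prob_space (h_measure h m) \<longleftrightarrow> emeasure (h_measure h m) UNIV = 1"
proof -
  have "space (h_measure h m) = UNIV" using space_bf_measuresD(2)[OF assms] by (simp add: h_measure_def)
  then show ?thesis using prob_space.emeasure_space_1[of "h_measure h m"] by (auto intro: prob_spaceI)
qed

text \<open>Under the prior, the measures violating normalization form a null event. Averaging the
  posterior mass of this event over \<open>W\<close> gives its prior mass 0, so the posterior mass
  vanishes for almost every sample.\<close>

lemma AE_posterior_prob_space:
  "AE \<omega> in \<Omega>. AE m in pi_star L h n (W \<omega>). prob_space (h_measure h (N_star n (W \<omega>) m))"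
proof -
  let ?B = "{m \<in> space BF. emeasure (h_measure h m) UNIV \<noteq> 1}"
  have "(\<lambda>m. emeasure (h_measure h m) UNIV) \<in> borel_measurable BF"
    by (rule measurable_compose[OF measurable_h_measure[OF h] measurable_emeasure_borel_measures]) simp
  then have B: "?B \<in> sets BF" by measurable
  have nB: "{m \<in> space BF. m \<notin> ?B} \<in> sets BF"
    using sets.compl_sets[OF B] by (simp only: set_diff_eq)
  have "AE m in L. m \<notin> ?B"
    using h_prob AE_space by eventually_elim (simp add: space_L prob_space_h_measure_iff)
  then have NB: "AE \<omega> in \<Omega>. N \<omega> \<notin> ?B"
    using AE_distr_iff[OF measurable_N nB] unfolding L_eq by blast
  have "(\<integral>\<^sup>+\<omega>. indicator (space (VS n)) (W \<omega>) * emeasure (posterior (W \<omega>)) ?B \<partial>\<Omega>)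
      = emeasure \<Omega> {\<omega>\<in>space \<Omega>. W \<omega> \<in> space (VS n) \<and> N \<omega> \<in> ?B}"
  proof -
    have "\<forall>A\<in>sets (VS n). \<forall>B\<in>sets BF. emeasure \<Omega> {\<omega>\<in>space \<Omega>. W \<omega> \<in> A \<and> N \<omega> \<in> B}
        = (\<integral>\<^sup>+\<omega>. indicator A (W \<omega>) * emeasure (posterior (W \<omega>)) B \<partial>\<Omega>)"
      using conditional_law_posterior unfolding conditional_law_def by (elim conjE)
    from this[THEN bspec, OF sets.top, THEN bspec, OF B] show ?thesis by (rule sym)
  qed
  also have "\<dots> = 0"
    by (rule emeasure_eq_0_AE) (use NB in eventually_elim, blast)
  finally have z: "(\<integral>\<^sup>+\<omega>. indicator (space (VS n)) (W \<omega>) * emeasure (posterior (W \<omega>)) ?B \<partial>\<Omega>) = 0" .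
  have "(\<lambda>w. emeasure (posterior w) ?B) \<in> borel_measurable (VS n)"
    using conditional_law_posterior B unfolding conditional_law_def by blast
  then have "(\<lambda>\<omega>. indicator (space (VS n)) (W \<omega>) * emeasure (posterior (W \<omega>)) ?B) \<in> borel_measurable \<Omega>"
    by (intro borel_measurable_times_ennreal measurable_compose[OF measurable_W] borel_measurable_indicator) auto
  then have "AE \<omega> in \<Omega>. indicator (space (VS n)) (W \<omega>) * emeasure (posterior (W \<omega>)) ?B = 0"
    using nn_integral_0_iff_AE z by blast
  then show ?thesis using AE_space
  proof eventually_elim
    case (elim \<omega>)
    let ?w = "W \<omega>" and ?\<pi> = "pi_star L h n (W \<omega>)"
    have w: "?w \<in> space (VS n)" using elim(2) measurable_space[OF measurable_W] by blast
    have Nm: "N_star n ?w \<in> measurable ?\<pi> BF" by (rule measurable_N_star_pi_star[OF w])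
    have "emeasure ?\<pi> (N_star n ?w -` ?B \<inter> space ?\<pi>) = 0"
      using elim(1) w emeasure_distr[OF Nm B] by (simp add: posterior_def)
    then have "AE m in ?\<pi>. m \<notin> N_star n ?w -` ?B \<inter> space ?\<pi>"
      using measurable_sets[OF Nm B] by (intro AE_not_in) (simp add: null_setsI)
    then show ?case using AE_space
    proof eventually_elim
      case (elim m)
      then have "N_star n ?w m \<in> space BF" using measurable_space[OF Nm] by blast
      then show ?case using elim by (auto simp: prob_space_h_measure_iff)
    qed
  qed
qed

text \<open>For almost every \<open>m\<close> the conditional law of the sample is a product of
  equal factors, hence invariant under relabelling; mixing over \<open>m\<close> preserves
  this.\<close>

lemma exchangeable:
  assumes \<pi>: "\<pi> permutes {1..n}"
  shows "distr \<Omega> (VS n) (\<lambda>\<omega>. \<lambda>i\<in>{1..n}. W \<omega> (\<pi> i)) = distr \<Omega> (VS n) W"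
proof (rule measure_eqI)
  let ?T = "\<lambda>w :: nat \<Rightarrow> 'w. \<lambda>i\<in>{1..n}. w (\<pi> i)"
  have bij: "bij_betw \<pi> {1..n} {1..n}" using \<pi> by (rule permutes_imp_bij)
  have T: "?T \<in> measurable (VS n) (VS n)"
    using bij by (intro measurable_restrict measurable_component_singleton) (auto simp: bij_betw_def)
  fix A assume "A \<in> sets (distr \<Omega> (VS n) (\<lambda>\<omega>. ?T (W \<omega>)))"
  then have A: "A \<in> sets (VS n)" by simp
  \<comment> \<open>The formula is needed twice, with \<open>S\<close> the permutation of
    coordinates and with \<open>S\<close> the identity.\<close>
  have e: "emeasure (distr \<Omega> (VS n) (\<lambda>\<omega>. S (W \<omega>))) A
      = (\<integral>\<^sup>+m. \<integral>\<^sup>+w. indicator A (S w) \<partial>PiM {1..n} (\<lambda>_. h_measure h m) \<partial>L)"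
    if S: "S \<in> measurable (VS n) (VS n)" for S
  proof -
    have SA: "(\<lambda>w. indicator A (S w) :: ennreal) \<in> borel_measurable (VS n)"
      by (rule measurable_compose[OF S borel_measurable_indicator[OF A]])
    have "emeasure (distr \<Omega> (VS n) (\<lambda>\<omega>. S (W \<omega>))) A = (\<integral>\<^sup>+w. indicator A w \<partial>distr \<Omega> (VS n) (\<lambda>\<omega>. S (W \<omega>)))"
      using A by simp
    also have "\<dots> = (\<integral>\<^sup>+\<omega>. indicator A (S (W \<omega>)) \<partial>\<Omega>)"
      using A by (intro nn_integral_distr measurable_compose[OF measurable_W S]) simp
    also have "\<dots> = (\<integral>\<^sup>+m. \<integral>\<^sup>+w. indicator A (S w) \<partial>PiM {1..n} (\<lambda>_. h_measure h m) \<partial>L)"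
      using conditional_law_nn_integral[OF \<Omega>.prob_space_axioms W_iid, of "\<lambda>_ w. indicator A (S w)"]
        measurable_compose[OF measurable_snd SA, of BF] by (simp add: L_eq split_beta')
    finally show ?thesis .
  qed
  have "(\<integral>\<^sup>+m. \<integral>\<^sup>+w. indicator A (?T w) \<partial>PiM {1..n} (\<lambda>_. h_measure h m) \<partial>L)
      = (\<integral>\<^sup>+m. \<integral>\<^sup>+w. indicator A w \<partial>PiM {1..n} (\<lambda>_. h_measure h m) \<partial>L)"
  proof (rule nn_integral_cong_AE)
    show "AE m in L. (\<integral>\<^sup>+w. indicator A (?T w) \<partial>PiM {1..n} (\<lambda>_. h_measure h m))
        = (\<integral>\<^sup>+w. indicator A w \<partial>PiM {1..n} (\<lambda>_. h_measure h m))"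
      using h_prob AE_space
    proof eventually_elim
      case (elim m)
      let ?P = "PiM {1..n} (\<lambda>_. h_measure h m)"
      interpret H: sigma_finite_measure "h_measure h m" using elim(1) by (rule prob_space_imp_sigma_finite)
      have "sets ?P = sets (VS n)"
        using elim(2) by (intro sets_PiM_cong refl) (simp add: h_measure_def space_L space_bf_measuresD(1))
      then have T': "?T \<in> measurable ?P ?P" "A \<in> sets ?P"
        using T A measurable_cong_sets[of ?P "VS n" ?P "VS n"] by auto
      have "(\<integral>\<^sup>+w. indicator A w \<partial>?P) = (\<integral>\<^sup>+w. indicator A w \<partial>distr ?P ?P ?T)"
        by (subst H.distr_PiM_bij_betw[OF _ bij]) simp_all
      also have "\<dots> = (\<integral>\<^sup>+w. indicator A (?T w) \<partial>?P)"
        using T' by (intro nn_integral_distr) auto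
      finally show ?case by simp
    qed
  qed
  then show "emeasure (distr \<Omega> (VS n) (\<lambda>\<omega>. ?T (W \<omega>))) A = emeasure (distr \<Omega> (VS n) W) A"
    using e[OF T] e[OF measurable_ident_sets[OF refl]] by simp
qed simp

text \<open>Take the indicator of the tie pattern as integrand. In the term for \<open>q\<close> the
  vector has tie partition exactly \<open>q\<close> for almost all cell values, so only
  \<open>q = p\<close> contributes.\<close>

lemma eppf:
  assumes p: "partition_on {1..n} p"
  shows "emeasure \<Omega> {\<omega>\<in>space \<Omega>. tie_partition n (W \<omega>) = p}
    = (\<integral>\<^sup>+x. psi L h n (from_cells n p x) \<partial>PiM p (\<lambda>_. \<nu>))"
proof -
  let ?S = "{w \<in> space (VS n). tie_partition n w = p}"
  have S: "?S \<in> sets (VS n)" by (rule sets_tie_partition)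
  have eq: "{\<omega>\<in>space \<Omega>. tie_partition n (W \<omega>) = p} = W -` ?S \<inter> space \<Omega>"
    using measurable_space[OF measurable_W] by auto
  have "emeasure \<Omega> (W -` ?S \<inter> space \<Omega>) = (\<integral>\<^sup>+\<omega>. indicator (W -` ?S \<inter> space \<Omega>) \<omega> \<partial>\<Omega>)"
    using measurable_sets[OF measurable_W S] by simp
  also have "\<dots> = (\<integral>\<^sup>+\<omega>. indicator ?S (W \<omega>) \<partial>\<Omega>)"
    by (intro nn_integral_cong) (simp add: indicator_def)
  also have "\<dots> = tie_sum n (\<lambda>w. indicator ?S w * psi L h n w)"
    by (rule nn_integral_W) (use S in simp)
  also have "\<dots> = (\<Sum>q | partition_on {1..n} q. if q = p then \<integral>\<^sup>+x. psi L h n (from_cells n q x) \<partial>PiM q (\<lambda>_. \<nu>) else 0)"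
    unfolding tie_sum_def
  proof (rule sum.cong[OF refl])
    fix q assume "q \<in> {q. partition_on {1..n} q}"
    then have q: "partition_on {1..n} q" by simp
    have "(\<integral>\<^sup>+x. indicator ?S (from_cells n q x) * psi L h n (from_cells n q x) \<partial>PiM q (\<lambda>_. \<nu>))
        = (\<integral>\<^sup>+x. (if q = p then 1 else 0) * psi L h n (from_cells n q x) \<partial>PiM q (\<lambda>_. \<nu>))"
    proof (rule nn_integral_cong_AE)
      have "finite q" using q finite_elements by blast
      from AE_PiM_inj_on[OF this]
      show "AE x in PiM q (\<lambda>_. \<nu>). indicator ?S (from_cells n q x) * psi L h n (from_cells n q x)
          = (if q = p then 1 else 0) * psi L h n (from_cells n q x)"
      proof eventually_elim
        case (elim x)
        have "from_cells n q x \<in> ?S \<longleftrightarrow> q = p"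
          unfolding mem_Collect_eq tie_partition_from_cells[OF q elim] space_vec_space
          by (simp only: from_cells_extensional simp_thms)
        then show ?case by (simp add: indicator_def)
      qed
    qed
    then show "(\<integral>\<^sup>+x. indicator ?S (from_cells n q x) * psi L h n (from_cells n q x) \<partial>PiM q (\<lambda>_. \<nu>))
        = (if q = p then \<integral>\<^sup>+x. psi L h n (from_cells n q x) \<partial>PiM q (\<lambda>_. \<nu>) else 0)"
      by simp
  qed
  also have "\<dots> = (\<integral>\<^sup>+x. psi L h n (from_cells n p x) \<partial>PiM p (\<lambda>_. \<nu>))"
    using p finitely_many_partition_on[of "{1..n}"] by (subst sum.delta) auto
  finally show ?thesis unfolding eq .
qed

text \<open>A size-preserving bijection of the cells relabels the integration variables without
  changing \<open>psi\<close> almost everywhere. Hence the EPPF is a symmetric function of the cell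
  sizes alone.\<close>

lemma eppf_cong:
  assumes p: "partition_on {1..n} p" and q: "partition_on {1..n} q"
    and eq: "image_mset card (mset_set p) = image_mset card (mset_set q)"
  shows "(\<integral>\<^sup>+x. psi L h n (from_cells n p x) \<partial>PiM p (\<lambda>_. \<nu>)) = (\<integral>\<^sup>+x. psi L h n (from_cells n q x) \<partial>PiM q (\<lambda>_. \<nu>))"
proof -
  have fin: "finite p" "finite q" using p q finite_elements by blast+
  obtain \<sigma> where \<sigma>: "bij_betw \<sigma> p q" "\<And>C. C \<in> p \<Longrightarrow> card (\<sigma> C) = card C"
    using image_mset_mset_set_eq_bij_betw[OF fin eq] by blast
  have rm: "(\<lambda>x. \<lambda>C\<in>p. x (\<sigma> C)) \<in> measurable (PiM q (\<lambda>_. \<nu>)) (PiM p (\<lambda>_. \<nu>))"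
    using \<sigma>(1) by (intro measurable_restrict measurable_component_singleton) (auto simp: bij_betw_def)
  have "(\<integral>\<^sup>+x. psi L h n (from_cells n p x) \<partial>PiM p (\<lambda>_. \<nu>))
      = (\<integral>\<^sup>+x. psi L h n (from_cells n p x) \<partial>distr (PiM q (\<lambda>_. \<nu>)) (PiM p (\<lambda>_. \<nu>)) (\<lambda>x. \<lambda>C\<in>p. x (\<sigma> C)))"
    by (simp add: distr_PiM_bij_betw[OF fin(1) \<sigma>(1)])
  also have "\<dots> = (\<integral>\<^sup>+x. psi L h n (from_cells n p (\<lambda>C\<in>p. x (\<sigma> C))) \<partial>PiM q (\<lambda>_. \<nu>))"
    by (rule nn_integral_distr[OF rm]) (use measurable_from_cells_borel[OF p measurable_psi] in simp)
  also have "\<dots> = (\<integral>\<^sup>+x. psi L h n (from_cells n q x) \<partial>PiM q (\<lambda>_. \<nu>))"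
  proof (rule nn_integral_cong_AE)
    show "AE x in PiM q (\<lambda>_. \<nu>). psi L h n (from_cells n p (\<lambda>C\<in>p. x (\<sigma> C))) = psi L h n (from_cells n q x)"
      using AE_PiM_inj_on[OF fin(2)] by eventually_elim (rule psi_from_cells_bij_betw[OF p q \<sigma>])
  qed
  finally show ?thesis .
qed

end

theorem theorem3p1:
  fixes \<Omega> :: "'a measure"
    and \<nu> :: "'w::polish_space measure"
    and L :: "'w measure measure"
    and N :: "'a \<Rightarrow> 'w measure"
    and h :: "'w \<Rightarrow> 'w measure \<Rightarrow> real"
    and n :: nat
    and W :: "'a \<Rightarrow> nat \<Rightarrow> 'w"
  assumes "prob_space \<Omega>"
    and "sets \<nu> = sets borel"
    and "sigma_finite_measure \<nu>"
    and nonatomic: "\<And>x. emeasure \<nu> {x} = 0"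
    and boundedly_finite: "\<And>B. B \<in> sets borel \<Longrightarrow> bounded B \<Longrightarrow> emeasure \<nu> B < \<infinity>"
    and "poisson_random_measure \<Omega> \<nu> N"
    and poisson_law: "L = distr \<Omega> bf_measures N"
    and h_measurable: "(\<lambda>(x, m). h x m) \<in> borel_measurable (borel \<Otimes>\<^sub>M bf_measures)"
    and h_pos: "\<And>x m. m \<in> space bf_measures \<Longrightarrow> 0 < h x m"
    and h_normalized: "AE \<omega> in \<Omega>. (\<integral>\<^sup>+x. ennreal (h x (N \<omega>)) \<partial>N \<omega>) = 1"
    and "1 \<le> n"
    and W_iid_given_N: "conditional_law \<Omega> bf_measures N (vec_space n) W
           (\<lambda>m. PiM {1..n} (\<lambda>_. h_measure h m))"
  shows
    \<comment> \<open>(i)\<close>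
    "conditional_law \<Omega> (vec_space n) W bf_measures N
       (\<lambda>w. distr (pi_star L h n w) bf_measures (N_star n w)) \<and>
     \<comment> \<open>(ii)\<close>
     conditional_law \<Omega> (vec_space n) W borel_measures (\<lambda>\<omega>. h_measure h (N \<omega>))
       (\<lambda>w. distr (pi_star L h n w) borel_measures (\<lambda>m. h_measure h (N_star n w m))) \<and>
     (AE \<omega> in \<Omega>. AE m in pi_star L h n (W \<omega>). prob_space (h_measure h (N_star n (W \<omega>) m))) \<and>
     (\<forall>w. \<forall>m\<in>space bf_measures.
        h_measure h (N_star n w m) =
          add_atoms (density m (\<lambda>x. ennreal (h x (N_star n w m))))
            (\<lambda>x. ennreal (h x (N_star n w m))) (w ` {1..n})) \<and>
     \<comment> \<open>(iii): marginal law of W, exchangeability, and the EPPF\<close>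
     (\<forall>g\<in>borel_measurable (vec_space n).
        (\<integral>\<^sup>+w. g w \<partial>distr \<Omega> (vec_space n) W) =
          (\<Sum>p | partition_on {1..n} p.
             \<integral>\<^sup>+x. g (from_cells n p x) * psi L h n (from_cells n p x) \<partial>PiM p (\<lambda>_. \<nu>))) \<and>
     (\<forall>\<pi>. \<pi> permutes {1..n} \<longrightarrow>
        distr \<Omega> (vec_space n) (\<lambda>\<omega>. \<lambda>i\<in>{1..n}. W \<omega> (\<pi> i)) = distr \<Omega> (vec_space n) W) \<and>
     (\<forall>p. partition_on {1..n} p \<longrightarrow>
        emeasure \<Omega> {\<omega>\<in>space \<Omega>. tie_partition n (W \<omega>) = p} =
          (\<integral>\<^sup>+x. psi L h n (from_cells n p x) \<partial>PiM p (\<lambda>_. \<nu>))) \<and>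
     (\<forall>p q. partition_on {1..n} p \<and> partition_on {1..n} q \<and>
        image_mset card (mset_set p) = image_mset card (mset_set q) \<longrightarrow>
        emeasure \<Omega> {\<omega>\<in>space \<Omega>. tie_partition n (W \<omega>) = p} =
          emeasure \<Omega> {\<omega>\<in>space \<Omega>. tie_partition n (W \<omega>) = q})"
proof -
  interpret \<Omega>: prob_space \<Omega> by fact
  have N: "N \<in> measurable \<Omega> bf_measures" using assms(6) by (simp add: poisson_random_measure_def)
  have sp: "space (h_measure h m) = UNIV" if "m \<in> space bf_measures" for m
    using space_bf_measuresD(2)[OF that] by (simp add: h_measure_def)
  have em: "(\<lambda>m. emeasure (h_measure h m) UNIV) \<in> borel_measurable bf_measures"
    by (rule measurable_compose[OF measurable_h_measure[OF h_measurable] measurable_emeasure_borel_measures]) simp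
  have one: "{m \<in> space bf_measures. emeasure (h_measure h m) UNIV = 1} \<in> sets bf_measures"
    using em by measurable
  \<comment> \<open>Normalization is assumed along \<open>N\<close>, whereas the locale asks for it
    under the law \<open>L\<close>; the measurable event \<open>one\<close> permits the
    transfer.\<close>
  have "AE \<omega> in \<Omega>. emeasure (h_measure h (N \<omega>)) UNIV = 1"
    using h_normalized AE_space
  proof eventually_elim
    case (elim \<omega>)
    then have "N \<omega> \<in> space bf_measures" using measurable_space[OF N] by blast
    then show ?case using elim(1) by (simp add: emeasure_h_measure[OF h_measurable])
  qed
  then have "AE m in L. emeasure (h_measure h m) UNIV = 1"
    unfolding poisson_law using AE_distr_iff[OF N one] by simp
  then have h_prob: "AE m in L. prob_space (h_measure h m)"
    using AE_space by eventually_elim (auto simp: poisson_law sp intro: prob_spaceI)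
  have L: "prob_space L" unfolding poisson_law by (rule \<Omega>.prob_space_distr[OF N])
  interpret conditionally_iid_sample \<Omega> \<nu> L h N n W
  proof (intro conditionally_iid_sample.intro poisson_mixture.intro nonatomic_measure.intro
      nonatomic_measure_axioms.intro poisson_mixture_axioms.intro conditionally_iid_sample_axioms.intro)
    show "sets L = sets bf_measures" by (simp add: poisson_law)
    show "(\<integral>\<^sup>+m. \<integral>\<^sup>+x. f x m \<partial>m \<partial>L) = (\<integral>\<^sup>+x. \<integral>\<^sup>+m. f x (add_point m x) \<partial>L \<partial>\<nu>)"
      if "(\<lambda>(x, m). f x m) \<in> borel_measurable (borel \<Otimes>\<^sub>M bf_measures)" for f
      by (rule \<Omega>.poisson_mecke[OF assms(6) assms(2) boundedly_finite poisson_law that])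
  qed (fact assms L h_prob)+
  have iii: "(\<integral>\<^sup>+w. g w \<partial>distr \<Omega> (vec_space n) W) = (\<Sum>p | partition_on {1..n} p.
      \<integral>\<^sup>+x. g (from_cells n p x) * psi L h n (from_cells n p x) \<partial>PiM p (\<lambda>_. \<nu>))"
    if "g \<in> borel_measurable (vec_space n)" for g
    using that nn_integral_W[OF that] unfolding tie_sum_def
    by (subst nn_integral_distr[OF measurable_W]) simp_all
  have i: "conditional_law \<Omega> (vec_space n) W bf_measures N (\<lambda>w. distr (pi_star L h n w) bf_measures (N_star n w))"
    using conditional_law_posterior unfolding posterior_def[abs_def] .
  have ties: "emeasure \<Omega> {\<omega>\<in>space \<Omega>. tie_partition n (W \<omega>) = p} = emeasure \<Omega> {\<omega>\<in>space \<Omega>. tie_partition n (W \<omega>) = q}"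
    if "partition_on {1..n} p \<and> partition_on {1..n} q \<and> image_mset card (mset_set p) = image_mset card (mset_set q)" for p q
    using that eppf[of p] eppf[of q] eppf_cong[of p q] by simp
  show ?thesis
    by (intro conjI allI ballI impI) (fact i conditional_law_posterior_h_measure AE_posterior_prob_space
      | rule h_measure_N_star[OF h_measurable] exchangeable eppf iii ties; assumption)+
qed

end
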